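(* Let $(h_j)$ be a normalized Schauder basis for a reflexive Banach space $E$. Then the quasi-reflexive space $J(h_j)$ has the W.A.P. (weakly compact approximation property).
   Context: Given a normalized Schauder basis $(h_j)$ of a reflexive Banach space $E$, $J(h_j)$ is the Banach space of scalar sequences $(a_j)_{j\ge1}$ with $\lim_{j\to\infty}a_j=0$ and $$\|(a_j)\|=\sup\Big\{\Big\|\sum_{j=1}^n(a_{p_j}-a_{q_j})h_{p_j}\Big\|_E:\ 1\le p_1<q_1<\dots<p_n<q_n,\ n\in\mathbb N\Big\}<\infty .$$ A Banach space $X$ is quasi-reflexive if $\dim(X^{**}/X)<\infty$; it is a known result of Bellenot, Haydon and Odell that, for every normalized Schauder basis $(h_j)$ of a reflexive Banach space $E$, the space $J(h_j)$ is quasi-reflexive of order $1$, i.e. $\dim (J(h_j)^{**}/J(h_j))=1$. A Banach space $X$ has the weakly compact approximation property (W.A.P.) if there is a constant $C<\infty$ such that for every weakly compact set $D\subset X$ and every $\varepsilon>0$ there is a weakly compact operator $V:X\to X$ with $\sup_{x\in D}\|x-Vx\|<\varepsilon$ and $\|V\|\le C$. *)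

theory Defs
  imports "HOL-Analysis.Analysis" "HOL-Library.Function_Algebras"
begin

text \<open>
  The scalar field is a type 'k of class real_normed_field and euclidean_space; up to
  isomorphism these are exactly the real and the complex numbers, so both cases are covered.
  The space J(h) depends on the basis h and therefore cannot be a type.  Normed spaces are
  records consisting of a carrier, a scalar multiplication and a norm, the addition being that of the
  ambient group (pointwise addition, from Function_Algebras, on function types).
\<close>

record ('k, 'a) nspace =
  pts :: "'a set"
  smult :: "'k \<Rightarrow> 'a \<Rightarrow> 'a"
  nrm :: "'a \<Rightarrow> real"

text \<open>
  A Banach space over 'k, as a type of class banach with a scalar multiplication by 'k.
  Compatibility with scaleR follows from the axioms (agreement on rationals, then continuity).
\<close>

locale banach_over = vector_space sc
  for sc :: "'k::{real_normed_field, euclidean_space} \<Rightarrow> 'e::banach \<Rightarrow> 'e" +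
  assumes norm_sc: "norm (sc c x) = norm c * norm x"

lemma banach_over_real: "banach_over (scaleR :: real \<Rightarrow> 'e::banach \<Rightarrow> 'e)"
  by unfold_locales (auto simp: algebra_simps)

lemma banach_over_complex: "banach_over ((*) :: complex \<Rightarrow> complex \<Rightarrow> complex)"
  by unfold_locales (auto simp: algebra_simps norm_mult)

definition type_space :: "('k \<Rightarrow> 'e \<Rightarrow> 'e) \<Rightarrow> ('k, 'e::real_normed_vector) nspace" where
  "type_space sc = \<lparr>pts = UNIV, smult = sc, nrm = norm\<rparr>"

definition bounded_op :: "('k, 'a::ab_group_add) nspace \<Rightarrow> ('k, 'b::ab_group_add) nspace \<Rightarrow> ('a \<Rightarrow> 'b) \<Rightarrow> bool" where
  "bounded_op X Y T \<longleftrightarrow>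
     T ` pts X \<subseteq> pts Y \<and>
     (\<forall>x\<in>pts X. \<forall>y\<in>pts X. T (x + y) = T x + T y) \<and>
     (\<forall>c. \<forall>x\<in>pts X. T (smult X c x) = smult Y c (T x)) \<and>
     (\<exists>B. \<forall>x\<in>pts X. nrm Y (T x) \<le> B * nrm X x)"

definition op_norm :: "('k, 'a) nspace \<Rightarrow> ('k, 'b) nspace \<Rightarrow> ('a \<Rightarrow> 'b) \<Rightarrow> real" where
  "op_norm X Y T = (SUP x\<in>{x \<in> pts X. nrm X x \<le> 1}. nrm Y (T x))"

definition fscale :: "'k::times \<Rightarrow> ('a \<Rightarrow> 'k) \<Rightarrow> 'a \<Rightarrow> 'k" where
  "fscale c f = (\<lambda>x. c * f x)"

text \<open>
  Functionals are normalised to vanish off the carrier, so that each functional on X is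
  represented by exactly one function.
\<close>

definition dual_space ::
  "('k::real_normed_field, 'a::ab_group_add) nspace \<Rightarrow> ('k, 'a \<Rightarrow> 'k) nspace" where
  "dual_space X =
     \<lparr>pts = {f. bounded_op X (type_space (*)) f \<and> (\<forall>x. x \<notin> pts X \<longrightarrow> f x = 0)},
      smult = fscale,
      nrm = op_norm X (type_space (*))\<rparr>"

text \<open>Surjectivity of the canonical embedding into the bidual.\<close>

definition reflexive :: "('k::real_normed_field, 'a::ab_group_add) nspace \<Rightarrow> bool" where
  "reflexive X \<longleftrightarrow>
     (\<forall>\<Phi>\<in>pts (dual_space (dual_space X)). \<exists>x\<in>pts X. \<forall>f\<in>pts (dual_space X). \<Phi> f = f x)"

definition weak_topology :: "('k::real_normed_field, 'a::ab_group_add) nspace \<Rightarrow> 'a topology" where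
  "weak_topology X =
     topology_generated_by {{x \<in> pts X. f x \<in> U} | f U. f \<in> pts (dual_space X) \<and> open U}"

definition weakly_compact :: "('k::real_normed_field, 'a::ab_group_add) nspace \<Rightarrow> 'a set \<Rightarrow> bool" where
  "weakly_compact X D \<longleftrightarrow> compactin (weak_topology X) D"

definition weakly_compact_op ::
  "('k::real_normed_field, 'a::ab_group_add) nspace \<Rightarrow> ('k, 'b::ab_group_add) nspace \<Rightarrow> ('a \<Rightarrow> 'b) \<Rightarrow> bool" where
  "weakly_compact_op X Y T \<longleftrightarrow>
     bounded_op X Y T \<and>
     weakly_compact Y (weak_topology Y closure_of (T ` {x \<in> pts X. nrm X x \<le> 1}))"

text \<open>
  The supremum is taken in the extended reals, so that it is meaningful without knowing beforehand
  that D is nonempty and norm bounded.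
\<close>

definition WAP :: "('k::real_normed_field, 'a::ab_group_add) nspace \<Rightarrow> bool" where
  "WAP X \<longleftrightarrow>
     (\<exists>C. \<forall>D. weakly_compact X D \<longrightarrow>
        (\<forall>\<epsilon>>0. \<exists>V. weakly_compact_op X X V \<and>
           (SUP x\<in>D. ereal (nrm X (x - V x))) < ereal \<epsilon> \<and> op_norm X X V \<le> C))"

definition schauder_basis :: "('k \<Rightarrow> 'e::real_normed_vector \<Rightarrow> 'e) \<Rightarrow> (nat \<Rightarrow> 'e) \<Rightarrow> bool" where
  "schauder_basis sc h \<longleftrightarrow> (\<forall>x. \<exists>!a. (\<lambda>j. sc (a j) (h j)) sums x)"

text \<open>Sequences are indexed from 0 rather than from 1.\<close>

definition J_values :: "('k::real_normed_field \<Rightarrow> 'e::real_normed_vector \<Rightarrow> 'e) \<Rightarrow> (nat \<Rightarrow> 'e) \<Rightarrow> (nat \<Rightarrow> 'k) \<Rightarrow> real set" where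
  "J_values sc h a =
     {norm (\<Sum>i<n. sc (a (p i) - a (q i)) (h (p i))) | n p q.
        0 < n \<and> (\<forall>i<n. p i < q i) \<and> (\<forall>i. Suc i < n \<longrightarrow> q i < p (Suc i))}"

definition J_space :: "('k::real_normed_field \<Rightarrow> 'e::real_normed_vector \<Rightarrow> 'e) \<Rightarrow> (nat \<Rightarrow> 'e) \<Rightarrow> ('k, nat \<Rightarrow> 'k) nspace" where
  "J_space sc h =
     \<lparr>pts = {a. a \<longlonglongrightarrow> 0 \<and> bdd_above (J_values sc h a)},
      smult = fscale,
      nrm = (\<lambda>a. Sup (J_values sc h a))\<rparr>"

end

theory Submission
  imports Defs
begin

text \<open>
  Given a weakly compact set D, choose convex combinations \<open>mean N\<close> of coordinates with index at
  least N that are at most \<open>\<delta> / 2 ^ N\<close> on D. They exist because D is bounded and the coordinates tend to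
  zero pointwise on D. The operator \<open>smooth\<close> replaces a sequence on each block of a sparse grid by the
  constant \<open>mean N\<close>, where N is the end of the block. It is small on D. Its norm is at most 6: if
  \<open>p\<close> lies in the block ending at N and \<open>q\<close> in a later one ending at M, the increment from \<open>p\<close> to \<open>q\<close>
  is the difference of \<open>a p - mean M a\<close> and \<open>a p - mean N a\<close>, which are averages of increments of
  \<open>a\<close> that start at \<open>p\<close>, so that both have the right basis vector \<open>h p\<close>.

  As \<open>smooth\<close> fixes constants, \<open>remainder = id - smooth\<close> extends to all sequences of finite J-norm
  (these converge, since the basis of E is boundedly complete) with values still in J. The sequences of
  J-norm at most 1 form a compact set for pointwise convergence, on which \<open>remainder\<close> is continuous into
  the weak topology: by reflexivity of E, functionals on J are small on sequences that vanish on a long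
  initial segment. Hence \<open>remainder\<close> is weakly compact.
\<close>

section \<open>The Hahn--Banach theorem\<close>

text \<open>On a weakly compact \<open>D\<close> the coordinates tend to zero pointwise but in
  general not uniformly, so truncating sequences need not approximate the identity on
  \<open>D\<close>. Convex combinations restore the uniformity, and their decay
  \<open>1 / 2 ^ N\<close> lets the triangle inequality alone control every sum in the J-norm of the
  smoothed sequence.

  The obstacle to weak compactness is that pointwise limits of elements of the unit ball of J may
  leave J. They do so only along the constants, since a sequence of finite J-norm minus its limit
  lies in J; hence an operator that annihilates constants escapes the obstacle.

  The bound 6 is 2 times 3: there are two sums of averaged increments, and the window of a mean is
  only known to end by the third following starting point, so each sum is split into three
  interlaced ones. With the identity this gives the constant 7, independent of \<open>D\<close> and
  \<epsilon>.

  The theorem on convex combinations serves twice: for moduli of coordinates on \<open>D\<close>,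
  and for block sequences of J tested against functionals on E. The second use is how reflexivity of
  E reaches functionals on J.\<close>

definition sublinear :: "('e::real_vector \<Rightarrow> real) \<Rightarrow> bool" where
  "sublinear q \<longleftrightarrow> (\<forall>x y. q (x + y) \<le> q x + q y) \<and> (\<forall>t x. t \<ge> 0 \<longrightarrow> q (t *\<^sub>R x) = t * q x)"

lemma sublinear_add: "sublinear q \<Longrightarrow> q (x + y) \<le> q x + q y"
  and sublinear_scale: "sublinear q \<Longrightarrow> t \<ge> 0 \<Longrightarrow> q (t *\<^sub>R x) = t * q x"
  by (auto simp: sublinear_def)

lemma sublinear_zero: "sublinear q \<Longrightarrow> q 0 = 0"
  using sublinear_scale[of q 0 0] by simp

lemma sublinear_neg: "sublinear q \<Longrightarrow> - q (- x) \<le> q x"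
  using sublinear_add[of q x "- x"] sublinear_zero[of q] by simp

text \<open>This is the lower bound of a chain for Zorn's lemma. The infimum is finite because
  \<open>- p (- x) \<le> - q (- x) \<le> q x\<close>. It is subadditive because two members of a
  chain, evaluated at \<open>x\<close> and at \<open>y\<close>, can both be replaced by the smaller
  of the two.\<close>

lemma sublinear_Inf_chain:
  assumes "C \<noteq> {}" and sub: "\<And>q. q \<in> C \<Longrightarrow> sublinear q"
    and le: "\<And>q x. q \<in> C \<Longrightarrow> q x \<le> p x"
    and chain: "\<And>q r. q \<in> C \<Longrightarrow> r \<in> C \<Longrightarrow> q \<le> r \<or> r \<le> q"
  shows "sublinear (\<lambda>x. INF q\<in>C. q x)" and "\<And>q x. q \<in> C \<Longrightarrow> (INF q\<in>C. q x) \<le> q x"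
proof -
  have bdd: "bdd_below ((\<lambda>q. q x) ` C)" for x
  proof (rule bdd_belowI2)
    show "- p (- x) \<le> q x" if "q \<in> C" for q
      using sublinear_neg[OF sub[OF that], of x] le[OF that, of "- x"] by linarith
  qed
  show low: "(INF q\<in>C. q x) \<le> q x" if "q \<in> C" for q x
    by (rule cINF_lower[OF bdd that])
  have add: "(INF q\<in>C. q (x + y)) - (INF q\<in>C. q x) \<le> (INF q\<in>C. q y)" for x y
  proof (rule cINF_greatest[OF assms(1)])
    fix r assume r: "r \<in> C"
    have "(INF q\<in>C. q (x + y)) - r y \<le> (INF q\<in>C. q x)"
    proof (rule cINF_greatest[OF assms(1)])
      fix q assume q: "q \<in> C"
      obtain m where m: "m \<in> C" "m \<le> q" "m \<le> r"
        using chain[OF q r] q r by blast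
      have "(INF q\<in>C. q (x + y)) \<le> m x + m y"
        using low[OF m(1), of "x + y"] sublinear_add[OF sub[OF m(1)], of x y] by linarith
      also have "\<dots> \<le> q x + r y" using m by (intro add_mono) (auto simp: le_fun_def)
      finally show "(INF q\<in>C. q (x + y)) - r y \<le> q x" by linarith
    qed
    then show "(INF q\<in>C. q (x + y)) - (INF q\<in>C. q x) \<le> r y" by linarith
  qed
  have scale_le: "t * (INF q\<in>C. q x) \<le> (INF q\<in>C. q (t *\<^sub>R x))" if "t \<ge> 0" for t x
  proof (rule cINF_greatest[OF assms(1)])
    fix q assume "q \<in> C"
    then show "t * (INF q\<in>C. q x) \<le> q (t *\<^sub>R x)"
      using low[of q x] sublinear_scale[OF sub, of q t x] that by (simp add: mult_left_mono)
  qed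
  have scale: "(INF q\<in>C. q (t *\<^sub>R x)) = t * (INF q\<in>C. q x)" if t: "t \<ge> 0" for t x
  proof (cases "t = 0")
    case True
    have "(INF q\<in>C. q 0) = (INF q\<in>C. 0)"
      by (rule INF_cong) (simp_all add: sublinear_zero[OF sub])
    then show ?thesis using True assms(1) by simp
  next
    case False
    then have "t > 0" using t by simp
    then have "inverse t * (INF q\<in>C. q (t *\<^sub>R x)) \<le> (INF q\<in>C. q x)"
      using scale_le[of "inverse t" "t *\<^sub>R x"] by simp
    then have "(INF q\<in>C. q (t *\<^sub>R x)) \<le> t * (INF q\<in>C. q x)"
      using \<open>t > 0\<close> by (simp add: field_simps)
    then show ?thesis using scale_le[OF t, of x] by linarith
  qed
  show "sublinear (\<lambda>x. INF q\<in>C. q x)"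
    unfolding sublinear_def using add scale by (force simp: algebra_simps)
qed

text \<open>This is the largest sublinear functional below \<open>q\<close> whose value at
  \<open>- y\<close> is at most \<open>- q y\<close>: any such \<open>r\<close> satisfies \<open>r x
  \<le> r (x + t *\<^sub>R y) + t * r (- y) \<le> q (x + t *\<^sub>R y) - t * q y\<close>.\<close>

definition directional_inf :: "('e::real_vector \<Rightarrow> real) \<Rightarrow> 'e \<Rightarrow> 'e \<Rightarrow> real" where
  "directional_inf q y x = (INF t\<in>{0..}. q (x + t *\<^sub>R y) - t * q y)"

lemma directional_inf:
  assumes q: "sublinear q"
  shows sublinear_directional_inf: "sublinear (directional_inf q y)"
    and directional_inf_le: "directional_inf q y x \<le> q x"
    and directional_inf_neg: "directional_inf q y (- y) \<le> - q y"
proof -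
  have bdd: "bdd_below ((\<lambda>t. q (x + t *\<^sub>R y) - t * q y) ` {0..})" for x
  proof (rule bdd_belowI2)
    show "- q (- x) \<le> q (x + t *\<^sub>R y) - t * q y" if "t \<in> {0..}" for t
      using sublinear_add[OF q, of "x + t *\<^sub>R y" "- x"] sublinear_scale[OF q, of t y] that by simp
  qed
  have low: "directional_inf q y x \<le> q (x + t *\<^sub>R y) - t * q y" if "t \<ge> 0" for t x
    unfolding directional_inf_def by (rule cINF_lower[OF bdd]) (use that in simp)
  have great: "c \<le> directional_inf q y x" if "\<And>t. t \<ge> 0 \<Longrightarrow> c \<le> q (x + t *\<^sub>R y) - t * q y" for c x
    unfolding directional_inf_def by (rule cINF_greatest) (use that in auto)
  show "directional_inf q y x \<le> q x" for x using low[of 0 x] by simp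
  show "directional_inf q y (- y) \<le> - q y" using low[of 1 "- y"] sublinear_zero[OF q] by simp
  have add: "directional_inf q y (x + x') \<le> directional_inf q y x + directional_inf q y x'" for x x'
  proof -
    have "directional_inf q y (x + x') - directional_inf q y x \<le> directional_inf q y x'"
    proof (rule great)
      fix t' :: real assume t': "t' \<ge> 0"
      have "directional_inf q y (x + x') - (q (x' + t' *\<^sub>R y) - t' * q y) \<le> directional_inf q y x"
      proof (rule great)
        fix t :: real assume t: "t \<ge> 0"
        have "q (x + x' + (t + t') *\<^sub>R y) = q ((x + t *\<^sub>R y) + (x' + t' *\<^sub>R y))"
          by (rule arg_cong[where f = q]) (simp add: algebra_simps)
        then show "directional_inf q y (x + x') - (q (x' + t' *\<^sub>R y) - t' * q y) \<le> q (x + t *\<^sub>R y) - t * q y"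
          using low[of "t + t'" "x + x'"] t t' sublinear_add[OF q, of "x + t *\<^sub>R y" "x' + t' *\<^sub>R y"]
          by (simp add: algebra_simps)
      qed
      then show "directional_inf q y (x + x') - directional_inf q y x \<le> q (x' + t' *\<^sub>R y) - t' * q y"
        by linarith
    qed
    then show ?thesis by linarith
  qed
  have scale_le: "directional_inf q y (s *\<^sub>R x) \<le> s * directional_inf q y x" if s: "s > 0" for s x
  proof -
    have "inverse s * directional_inf q y (s *\<^sub>R x) \<le> directional_inf q y x"
    proof (rule great)
      fix t :: real assume t: "t \<ge> 0"
      have "q (s *\<^sub>R x + (s * t) *\<^sub>R y) = s * q (x + t *\<^sub>R y)"
        using sublinear_scale[OF q, of s "x + t *\<^sub>R y"] s by (simp add: algebra_simps)
      then have "directional_inf q y (s *\<^sub>R x) \<le> s * (q (x + t *\<^sub>R y) - t * q y)"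
        using low[of "s * t" "s *\<^sub>R x"] s t by (simp add: algebra_simps)
      then show "inverse s * directional_inf q y (s *\<^sub>R x) \<le> q (x + t *\<^sub>R y) - t * q y"
        using s by (simp add: field_simps)
    qed
    then show ?thesis using s by (simp add: field_simps)
  qed
  have scale: "directional_inf q y (s *\<^sub>R x) = s * directional_inf q y x" if s: "s \<ge> 0" for s x
  proof (cases "s = 0")
    case True
    have "0 \<le> directional_inf q y 0" by (rule great) (simp add: sublinear_scale[OF q])
    moreover have "directional_inf q y 0 \<le> 0" using low[of 0 0] sublinear_zero[OF q] by simp
    ultimately show ?thesis using True by simp
  next
    case False
    then have "s > 0" using s by simp
    then show ?thesis
      using scale_le[of s x] scale_le[of "inverse s" "s *\<^sub>R x"] by (simp add: field_simps)
  qed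
  show "sublinear (directional_inf q y)"
    unfolding sublinear_def using add scale by blast
qed

text \<open>A minimal sublinear functional \<open>q\<close> coincides with each \<open>directional_inf q y\<close>, so it is odd.\<close>

theorem sublinear_dominates_linear:
  fixes p :: "'e::real_vector \<Rightarrow> real"
  assumes p: "sublinear p"
  obtains u where "linear u" "\<And>x. u x \<le> p x"
proof -
  define A where "A = {q. sublinear q \<and> q \<le> p}"
  have "\<exists>m\<in>A. \<forall>a\<in>A. m \<ge> a \<longrightarrow> a = m"
  proof (rule predicate_Zorn)
    show "partial_order_on A (relation_of (\<ge>) A)"
      by (rule partial_order_on_relation_ofI) auto
    fix C assume C: "C \<in> Chains (relation_of (\<ge>) A)"
    show "\<exists>u\<in>A. \<forall>a\<in>C. a \<ge> u"
    proof (cases "C = {}")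
      case True
      then show ?thesis using p by (auto simp: A_def)
    next
      case False
      have CA: "C \<subseteq> A" and ch: "\<And>q r. q \<in> C \<Longrightarrow> r \<in> C \<Longrightarrow> q \<le> r \<or> r \<le> q"
        using C by (auto simp: Chains_def relation_of_def)
      have 1: "\<And>q. q \<in> C \<Longrightarrow> sublinear q" and 2: "\<And>q x. q \<in> C \<Longrightarrow> q x \<le> p x"
        using CA by (auto simp: A_def le_fun_def)
      have inf: "sublinear (\<lambda>x. INF q\<in>C. q x)" "\<And>q x. q \<in> C \<Longrightarrow> (INF q\<in>C. q x) \<le> q x"
        using sublinear_Inf_chain[of C p, OF False] 1 2 ch by blast+
      obtain q where q: "q \<in> C" using False by blast
      have "(INF q\<in>C. q x) \<le> p x" for x using inf(2)[OF q, of x] 2[OF q, of x] by linarith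
      then have "(\<lambda>x. INF q\<in>C. q x) \<in> A" using inf(1) by (auto simp: A_def le_fun_def)
      moreover have "\<forall>a\<in>C. a \<ge> (\<lambda>x. INF q\<in>C. q x)" using inf(2) by (auto simp: le_fun_def)
      ultimately show ?thesis by blast
    qed
  qed
  then obtain m where m: "m \<in> A" "\<And>a. a \<in> A \<Longrightarrow> a \<le> m \<Longrightarrow> a = m" by blast
  have sub: "sublinear m" and mp: "\<And>x. m x \<le> p x" using m by (auto simp: A_def le_fun_def)
  have "directional_inf m y = m" for y
  proof (rule m(2))
    show le: "directional_inf m y \<le> m" using directional_inf_le[OF sub] by (simp add: le_fun_def)
    show "directional_inf m y \<in> A"
      using sublinear_directional_inf[OF sub] le mp by (auto simp: A_def le_fun_def intro: order_trans)
  qed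
  then have odd: "m (- y) = - m y" for y
    using directional_inf_neg[OF sub, of y] sublinear_neg[OF sub, of "y"] by simp
  have "linear m"
  proof (rule linearI)
    show "m (x + y) = m x + m y" for x y
      using sublinear_add[OF sub, of x y] sublinear_add[OF sub, of "x + y" "- y"] odd by simp
    show "m (r *\<^sub>R x) = r *\<^sub>R m x" for r x
      using sublinear_scale[OF sub, of r x] sublinear_scale[OF sub, of "- r" x] odd[of "r *\<^sub>R x"]
      by (cases "r \<ge> 0") auto
  qed
  then show thesis using mp that by blast
qed

text \<open>A linear functional below \<open>directional_inf norm v\<close> lies below the norm and
  is at most \<open>- norm v\<close> at \<open>- v\<close>; linearity turns the latter into
  \<open>u v \<ge> norm v\<close>.\<close>

corollary norming_functional:
  fixes v :: "'e::real_normed_vector"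
  obtains u where "linear u" "\<And>x. \<bar>u x\<bar> \<le> norm x" "u v = norm v"
proof -
  have n: "sublinear (norm :: 'e \<Rightarrow> real)" by (simp add: sublinear_def norm_triangle_ineq)
  obtain u where u: "linear u" "\<And>x. u x \<le> directional_inf norm v x"
    using sublinear_dominates_linear[OF sublinear_directional_inf[OF n]] by blast
  have le: "u x \<le> norm x" for x using u(2)[of x] directional_inf_le[OF n, of v x] by linarith
  have abs: "\<bar>u x\<bar> \<le> norm x" for x
    using le[of x] le[of "- x"] linear_neg[OF u(1), of x] by simp
  moreover have "u v = norm v"
    using u(2)[of "- v"] directional_inf_neg[OF n, of v] linear_neg[OF u(1), of v] le[of v] by simp
  ultimately show thesis using that u(1) by blast
qed

section \<open>Convex combinations of pointwise null sequences\<close>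

text \<open>The coefficients are defined at all indices and vanish outside the window, so
  combinations with different windows can be written over a common range.\<close>

definition convex_comb :: "(nat \<Rightarrow> 'x \<Rightarrow> real) \<Rightarrow> nat \<Rightarrow> nat \<Rightarrow> ('x \<Rightarrow> real) \<Rightarrow> bool" where
  "convex_comb f n n' F \<longleftrightarrow>
     (\<exists>c. (\<forall>j. 0 \<le> c j) \<and> (\<forall>j. j \<notin> {n..<n'} \<longrightarrow> c j = 0) \<and> (\<Sum>j<n'. c j) = 1 \<and> F = (\<lambda>w. \<Sum>j<n'. c j * f j w))"

text \<open>The uniform closure on \<open>R\<close> of the convex hull of the tail from index
  \<open>n\<close>. The closure is taken because the infinite dyadic mixtures below are only limits
  of finite combinations. Values off \<open>R\<close> are left free.\<close>

definition closed_convex :: "(nat \<Rightarrow> 'x \<Rightarrow> real) \<Rightarrow> 'x set \<Rightarrow> nat \<Rightarrow> ('x \<Rightarrow> real) set" where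
  "closed_convex f R n = {F. \<forall>e>0. \<exists>n' G. convex_comb f n n' G \<and> (\<forall>w\<in>R. \<bar>F w - G w\<bar> \<le> e)}"

lemma closed_convexD:
  assumes "F \<in> closed_convex f R n" "e > 0"
  obtains n' G where "convex_comb f n n' G" "\<And>w. w \<in> R \<Longrightarrow> \<bar>F w - G w\<bar> \<le> e"
  using assms unfolding closed_convex_def by blast

lemma convex_comb_mono: "convex_comb f m m' F \<Longrightarrow> n \<le> m \<Longrightarrow> m' \<le> n' \<Longrightarrow> convex_comb f n n' F"
proof -
  assume "convex_comb f m m' F" and le: "n \<le> m" "m' \<le> n'"
  then obtain c where c: "\<forall>j. 0 \<le> c j" "\<forall>j. j \<notin> {m..<m'} \<longrightarrow> c j = 0" "(\<Sum>j<m'. c j) = 1"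
    "F = (\<lambda>w. \<Sum>j<m'. c j * f j w)" by (auto simp: convex_comb_def)
  have "(\<Sum>j<n'. c j * g j) = (\<Sum>j<m'. c j * g j)" for g :: "nat \<Rightarrow> real"
    by (rule sum.mono_neutral_right) (use c le in auto)
  from this this[of "\<lambda>_. 1"] show ?thesis
    unfolding convex_comb_def using c le by (intro exI[of _ c]) auto
qed

text \<open>Midpoints are all the convexity that is used, because the series formed later have the
  weights 1/2, 1/4, 1/8 and so on.\<close>

lemma convex_comb_mid:
  assumes "convex_comb f n m F" "convex_comb f n m' G"
  shows "convex_comb f n (max m m') (\<lambda>w. (F w + G w) / 2)"
proof -
  let ?M = "max m m'"
  have "convex_comb f n ?M F" "convex_comb f n ?M G"
    using assms by (auto elim!: convex_comb_mono)
  then obtain c d where c: "\<forall>j. 0 \<le> c j" "\<forall>j. j \<notin> {n..<?M} \<longrightarrow> c j = 0" "(\<Sum>j<?M. c j) = 1"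
      "F = (\<lambda>w. \<Sum>j<?M. c j * f j w)"
    and d: "\<forall>j. 0 \<le> d j" "\<forall>j. j \<notin> {n..<?M} \<longrightarrow> d j = 0" "(\<Sum>j<?M. d j) = 1"
      "G = (\<lambda>w. \<Sum>j<?M. d j * f j w)"
    unfolding convex_comb_def by blast
  have "(\<Sum>j<?M. (c j + d j) / 2 * g j) = ((\<Sum>j<?M. c j * g j) + (\<Sum>j<?M. d j * g j)) / 2" for g :: "nat \<Rightarrow> real"
    unfolding sum.distrib[symmetric] sum_divide_distrib by (rule sum.cong) (auto simp: field_simps)
  from this this[of "\<lambda>_. 1"] show ?thesis
    unfolding convex_comb_def using c d by (intro exI[of _ "\<lambda>j. (c j + d j) / 2"]) auto
qed

lemma convex_comb_le:
  assumes "convex_comb f n n' F" "\<And>j. j \<ge> n \<Longrightarrow> f j w \<le> b"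
  shows "F w \<le> b"
proof -
  from assms obtain c where c: "\<forall>j. 0 \<le> c j" "\<forall>j. j \<notin> {n..<n'} \<longrightarrow> c j = 0" "(\<Sum>j<n'. c j) = 1"
    "F = (\<lambda>w. \<Sum>j<n'. c j * f j w)" by (auto simp: convex_comb_def)
  have "F w \<le> (\<Sum>j<n'. c j * b)"
    unfolding c(4)
  proof (rule sum_mono)
    show "c j * f j w \<le> c j * b" for j
      using c assms(2)[of j] by (cases "j \<ge> n") (auto intro: mult_left_mono)
  qed
  then show ?thesis using c by (simp add: sum_distrib_right[symmetric])
qed

lemma convex_comb_ge:
  assumes "convex_comb f n n' F" "\<And>j. j \<ge> n \<Longrightarrow> b \<le> f j w"
  shows "b \<le> F w"
proof -
  from assms(1) obtain c where c: "\<forall>j. 0 \<le> c j" "\<forall>j. j \<notin> {n..<n'} \<longrightarrow> c j = 0" "(\<Sum>j<n'. c j) = 1"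
    "F = (\<lambda>w. \<Sum>j<n'. c j * f j w)" by (auto simp: convex_comb_def)
  then have "convex_comb (\<lambda>j w. - f j w) n n' (\<lambda>w. - F w)"
    unfolding convex_comb_def by (intro exI[of _ c]) (auto simp: sum_negf)
  from convex_comb_le[OF this, of w "- b"] assms(2) show ?thesis by auto
qed

lemma closed_convex_base: "f n \<in> closed_convex f R n"
proof -
  have "convex_comb f n (Suc n) (f n)"
    unfolding convex_comb_def
    by (intro exI[of _ "\<lambda>j. if j = n then 1 else 0"]) (auto simp: if_distrib[of "\<lambda>x. x * _"] sum.delta cong: if_cong)
  then show ?thesis unfolding closed_convex_def by (intro CollectI allI impI exI conjI) auto
qed

lemma closed_convex_mono: "n \<le> m \<Longrightarrow> closed_convex f R m \<subseteq> closed_convex f R n"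
  unfolding closed_convex_def by (blast intro: convex_comb_mono order_refl)

lemma closed_convex_mid:
  assumes "F \<in> closed_convex f R n" "G \<in> closed_convex f R n"
  shows "(\<lambda>w. (F w + G w) / 2) \<in> closed_convex f R n"
  unfolding closed_convex_def
proof (intro CollectI allI impI)
  fix e :: real assume "e > 0"
  then obtain m F' m' G' where *: "convex_comb f n m F'" "\<forall>w\<in>R. \<bar>F w - F' w\<bar> \<le> e"
      "convex_comb f n m' G'" "\<forall>w\<in>R. \<bar>G w - G' w\<bar> \<le> e"
    using assms unfolding closed_convex_def by blast
  have "\<bar>(F w + G w) / 2 - (F' w + G' w) / 2\<bar> \<le> e" if "w \<in> R" for w
    using *(2)[rule_format, OF that] *(4)[rule_format, OF that] unfolding abs_le_iff
    by (simp add: field_simps)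
  then show "\<exists>n' H. convex_comb f n n' H \<and> (\<forall>w\<in>R. \<bar>(F w + G w) / 2 - H w\<bar> \<le> e)"
    using convex_comb_mid[OF *(1,3)] by blast
qed

lemma closed_convex_limit:
  assumes "\<And>e. e > 0 \<Longrightarrow> \<exists>G\<in>closed_convex f R n. \<forall>w\<in>R. \<bar>F w - G w\<bar> \<le> e"
  shows "F \<in> closed_convex f R n"
  unfolding closed_convex_def
proof (intro CollectI allI impI)
  fix e :: real assume "e > 0"
  then obtain G where G: "G \<in> closed_convex f R n" "\<forall>w\<in>R. \<bar>F w - G w\<bar> \<le> e / 2"
    using assms[of "e / 2"] by auto
  have "e / 2 > 0" using \<open>e > 0\<close> by simp
  then obtain n' H where H: "convex_comb f n n' H" "\<And>w. w \<in> R \<Longrightarrow> \<bar>G w - H w\<bar> \<le> e / 2"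
    using closed_convexD[OF G(1)] by metis
  have "\<bar>F w - H w\<bar> \<le> e" if "w \<in> R" for w
    using G(2)[rule_format, OF that] H(2)[OF that] unfolding abs_le_iff by simp
  then show "\<exists>n' G. convex_comb f n n' G \<and> (\<forall>w\<in>R. \<bar>F w - G w\<bar> \<le> e)" using H(1) by blast
qed

lemma closed_convex_le:
  assumes "F \<in> closed_convex f R n" "w \<in> R" "\<And>j. j \<ge> n \<Longrightarrow> f j w \<le> b"
  shows "F w \<le> b"
proof (rule field_le_epsilon)
  fix e :: real assume "e > 0"
  then obtain n' G where G: "convex_comb f n n' G" "\<forall>w\<in>R. \<bar>F w - G w\<bar> \<le> e"
    using assms(1) unfolding closed_convex_def by blast
  then have "F w - G w \<le> e" "G w \<le> b"
    using assms(2) convex_comb_le[OF G(1) assms(3)] by (auto simp: abs_le_iff)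
  then show "F w \<le> b + e" by simp
qed

lemma closed_convex_abs:
  assumes "F \<in> closed_convex f R n" "w \<in> R" "\<And>j. \<bar>f j w\<bar> \<le> b"
  shows "\<bar>F w\<bar> \<le> b"
proof (rule field_le_epsilon)
  fix e :: real assume "e > 0"
  then obtain n' G where G: "convex_comb f n n' G" "\<forall>w\<in>R. \<bar>F w - G w\<bar> \<le> e"
    using assms(1) unfolding closed_convex_def by blast
  have "f j w \<le> b" "- b \<le> f j w" for j using assms(3)[of j] by auto
  then have "G w \<le> b" "- b \<le> G w"
    using convex_comb_le[OF G(1), of w b] convex_comb_ge[OF G(1), of "- b" w] by auto
  moreover have "F w - G w \<le> e" "- (F w - G w) \<le> e"
    using G(2) assms(2) by (auto simp: abs_le_iff)
  ultimately show "\<bar>F w\<bar> \<le> b + e" unfolding abs_le_iff by simp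
qed

lemma closed_convex_continuous:
  assumes F: "F \<in> closed_convex f R n" and f: "\<And>j. continuous_on R (f j)"
  shows "continuous_on R F"
proof -
  have "\<exists>G. continuous_on R G \<and> (\<forall>w\<in>R. \<bar>F w - G w\<bar> \<le> inverse (real (Suc k)))" for k
  proof -
    have "inverse (real (Suc k)) > 0" by simp
    then obtain n' G where G: "convex_comb f n n' G" "\<And>w. w \<in> R \<Longrightarrow> \<bar>F w - G w\<bar> \<le> inverse (real (Suc k))"
      using closed_convexD[OF F] by metis
    have "continuous_on R G"
      using G(1) unfolding convex_comb_def by (auto intro!: continuous_intros f)
    then show ?thesis using G by blast
  qed
  then obtain G where G: "\<And>k. continuous_on R (G k)" "\<And>k w. w \<in> R \<Longrightarrow> \<bar>F w - G k w\<bar> \<le> inverse (real (Suc k))"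
    by metis
  have "uniform_limit R G F sequentially"
  proof (rule uniform_limitI)
    fix e :: real assume "e > 0"
    then obtain K where K: "inverse (real (Suc K)) < e" using reals_Archimedean by blast
    have "dist (G k w) (F w) < e" if "k \<ge> K" "w \<in> R" for k w
    proof -
      have "inverse (real (Suc k)) \<le> inverse (real (Suc K))" using that(1) by (intro le_imp_inverse_le) auto
      then have "\<bar>F w - G k w\<bar> < e" using G(2)[OF that(2), of k] K by linarith
      then show ?thesis by (simp add: dist_real_def abs_minus_commute)
    qed
    then show "\<forall>\<^sub>F k in sequentially. \<forall>w\<in>R. dist (G k w) (F w) < e"
      unfolding eventually_sequentially by blast
  qed
  then show ?thesis using G(1) by (intro uniform_limit_theorem[of _ G]) auto
qed

text \<open>Splitting off the first term gives the recursion, which exhibits \<open>\<mu> n\<close>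
  as an iterated midpoint. Stopping after \<open>K\<close> midpoints and replacing the rest of the
  mixture by a single \<open>F\<close> costs at most \<open>2 * M / 2 ^ K\<close>, so
  \<open>\<mu> n\<close> is a uniform limit of members of the closed hull.\<close>

lemma dyadic_mix:
  assumes F: "\<And>n. F n \<in> closed_convex f R (N + n)" and b: "\<And>j w. w \<in> R \<Longrightarrow> \<bar>f j w\<bar> \<le> M"
  defines "\<mu> \<equiv> \<lambda>n w. \<Sum>k. (1/2)^(Suc k) * F (n + k) w"
  shows "w \<in> R \<Longrightarrow> \<mu> n w = (F n w + \<mu> (Suc n) w) / 2" and "\<mu> n \<in> closed_convex f R (N + n)"
proof -
  have Fb: "\<bar>F n w\<bar> \<le> M" if "w \<in> R" for n w
    by (rule closed_convex_abs[OF F that]) (use b that in auto)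
  have geo: "summable (\<lambda>k. (1/2)^(Suc k) * M)" by (intro summable_mult2) (simp add: summable_geometric)
  have bd: "norm ((1/2)^(Suc k) * F (n + k) w) \<le> (1/2)^(Suc k) * M" if "w \<in> R" for n k w
    using Fb[OF that, of "n + k"] by (simp add: abs_mult)
  have summ: "summable (\<lambda>k. (1/2)^(Suc k) * F (n + k) w)" if "w \<in> R" for n w
    by (rule summable_comparison_test'[OF geo, where N = 0]) (use bd[OF that] in simp)
  show step: "\<mu> n w = (F n w + \<mu> (Suc n) w) / 2" if w: "w \<in> R" for n w
  proof -
    have "\<mu> n w = (1/2) * F n w + (\<Sum>k. (1/2) * ((1/2)^(Suc k) * F (Suc n + k) w))"
      unfolding \<mu>_def using suminf_split_head[OF summ[OF w, of n]] by (simp add: mult.assoc)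
    also have "(\<Sum>k. (1/2) * ((1/2)^(Suc k) * F (Suc n + k) w)) = (1/2) * \<mu> (Suc n) w"
      unfolding \<mu>_def by (rule suminf_mult[OF summ[OF w]])
    finally show ?thesis by simp
  qed
  have \<mu>b: "\<bar>\<mu> n w\<bar> \<le> M" if w: "w \<in> R" for n w
  proof -
    have "\<bar>\<mu> n w\<bar> \<le> (\<Sum>k. (1/2)^(Suc k) * M)"
      unfolding \<mu>_def real_norm_def[symmetric] by (rule norm_suminf_le[OF bd[OF w] geo])
    also have "\<dots> = M"
      using sums_mult2[OF power_half_series, of M] by (simp add: sums_iff)
    finally show ?thesis .
  qed
  have approx: "\<exists>G\<in>closed_convex f R (N + n). \<forall>w\<in>R. \<bar>\<mu> n w - G w\<bar> \<le> (1/2)^K * (2 * M)" for K n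
  proof (induction K arbitrary: n)
    case 0
    show ?case using F[of n] \<mu>b[of _ n] Fb[of _ n] by (intro bexI[of _ "F n"]) force+
  next
    case (Suc K)
    obtain G where G: "G \<in> closed_convex f R (N + Suc n)" "\<forall>w\<in>R. \<bar>\<mu> (Suc n) w - G w\<bar> \<le> (1/2)^K * (2 * M)"
      using Suc by blast
    then have "G \<in> closed_convex f R (N + n)" using closed_convex_mono[of "N + n" "N + Suc n" f R] by auto
    then have "(\<lambda>w. (F n w + G w) / 2) \<in> closed_convex f R (N + n)" using F closed_convex_mid by blast
    moreover have "\<bar>\<mu> n w - (F n w + G w) / 2\<bar> \<le> (1/2)^(Suc K) * (2 * M)" if "w \<in> R" for w
    proof -
      have "\<mu> n w - (F n w + G w) / 2 = (\<mu> (Suc n) w - G w) / 2" using step[OF that, of n] by (simp add: field_simps)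
      then have "\<bar>\<mu> n w - (F n w + G w) / 2\<bar> = \<bar>\<mu> (Suc n) w - G w\<bar> / 2"
        by (simp only: abs_divide abs_numeral)
      also have "\<dots> \<le> (1/2)^K * (2 * M) / 2" using G(2) that by (intro divide_right_mono) auto
      finally show ?thesis by simp
    qed
    ultimately show ?case by (intro bexI[of _ "\<lambda>w. (F n w + G w) / 2"]) auto
  qed
  show "\<mu> n \<in> closed_convex f R (N + n)"
  proof (rule closed_convex_limit)
    fix e :: real assume e: "e > 0"
    have "(\<lambda>K. (1/2)^K * (2 * M)) \<longlonglongrightarrow> 0" by (intro tendsto_mult_left_zero LIMSEQ_realpow_zero) auto
    then have "\<forall>\<^sub>F K in sequentially. (1/2)^K * (2 * M) < e" using e order_tendstoD(2) by blast
    then obtain K where "(1/2)^K * (2 * M) < e" by (auto simp: eventually_sequentially)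
    then show "\<exists>G\<in>closed_convex f R (N + n). \<forall>w\<in>R. \<bar>\<mu> n w - G w\<bar> \<le> e" using approx[of n K] by force
  qed
qed

text \<open>
  Simons' argument: the combinations are chosen greedily, so that the supremum of a geometric series of
  them, which is attained by compactness, is attained at a point where all of its tails are large.
\<close>

theorem uniformly_small_convex_comb:
  fixes f :: "nat \<Rightarrow> 'x::topological_space \<Rightarrow> real"
  assumes R: "compact R" and f: "\<And>j. continuous_on R (f j)" and b: "\<And>j w. w \<in> R \<Longrightarrow> \<bar>f j w\<bar> \<le> M"
    and lim: "\<And>w. w \<in> R \<Longrightarrow> (\<lambda>j. f j w) \<longlonglongrightarrow> 0" and e: "e > 0"
  shows "\<exists>n' F. convex_comb f N n' F \<and> (\<forall>w\<in>R. F w \<le> e)"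
proof (rule ccontr)
  assume small: "\<not> ?thesis"
  then have big: "\<exists>w\<in>R. F w > e" if "convex_comb f N n' F" for n' F
    using that small by (meson not_le)
  \<comment> \<open>Passing to the uniform closure costs half of \<open>e\<close>; the other half
    stays a lower bound for the supremum over \<open>R\<close> of every member of
    \<open>C n\<close>.\<close>
  define m where "m = e / 2"
  have m: "m > 0" using e by (simp add: m_def)
  define p where "p F = (SUP w\<in>R. F w)" for F :: "'x \<Rightarrow> real"
  define C where "C n = closed_convex f R (N + n)" for n
  have "convex_comb f N (Suc N) (f N)"
    unfolding convex_comb_def
    by (intro exI[of _ "\<lambda>j. if j = N then 1 else 0"]) (auto simp: if_distrib[of "\<lambda>x. x * _"] sum.delta cong: if_cong)
  from big[OF this] have ne: "R \<noteq> {}" by auto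
  have Cb: "\<bar>F w\<bar> \<le> M" if "F \<in> C n" "w \<in> R" for F n w
    by (rule closed_convex_abs[OF that[unfolded C_def]]) (use b that in auto)
  have p_up: "F w \<le> p F" if "w \<in> R" "\<forall>v\<in>R. \<bar>F v\<bar> \<le> B" for F w B
    unfolding p_def by (rule cSUP_upper[OF that(1)], rule bdd_aboveI2[of _ _ B]) (use that(2) in force)
  have p_le: "p F \<le> B" if "\<And>w. w \<in> R \<Longrightarrow> F w \<le> B" for F B
    unfolding p_def by (rule cSUP_least[OF ne that])
  have C_big: "p F \<ge> m" if F: "F \<in> C n" for F n
  proof -
    obtain n' G where G: "convex_comb f (N + n) n' G" "\<forall>w\<in>R. \<bar>F w - G w\<bar> \<le> m"
      using F m unfolding closed_convex_def C_def by blast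
    then obtain w where w: "w \<in> R" "G w > e" using big[of n' G] convex_comb_mono[OF G(1), of N n'] by auto
    then have "- (F w - G w) \<le> m" using G(2) by (simp add: abs_le_iff)
    then have "F w \<ge> m" using w(2) unfolding m_def by simp
    also have "F w \<le> p F" by (rule p_up[OF w(1), of F M]) (use Cb[OF F] in auto)
    finally show ?thesis .
  qed
  \<comment> \<open>Exactly the slack in the induction \<open>d\<close>: it lowers the factor
    \<open>m + m * (1/2)^n\<close> to \<open>m + m * (1/2)^(Suc n)\<close>, which still exceeds
    \<open>m\<close>.\<close>
  define \<delta> where "\<delta> n = m * (1/2)^(Suc n) * (1/2)^(Suc n)" for n
  have \<delta>: "\<delta> n > 0" for n using m by (simp add: \<delta>_def)
  \<comment> \<open>\<open>A n\<close> is the sum of the first \<open>n\<close> terms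
    \<open>(1/2)^i * F i\<close>, and \<open>F n\<close> is chosen in \<open>C n\<close> so that the
    supremum of the next partial sum is minimal up to \<open>\<delta> n\<close>. Boundedness of
    \<open>A n\<close> on \<open>R\<close> is carried along since \<open>p\<close> is meaningful
    only for bounded functions.\<close>
  have "\<exists>A. A 0 = (\<lambda>_. 0) \<and> (\<forall>n. (\<exists>B. \<forall>w\<in>R. \<bar>A n w\<bar> \<le> B) \<and>
      (\<exists>F\<in>C n. A (Suc n) = (\<lambda>w. A n w + (1/2)^n * F w) \<and>
        (\<forall>G\<in>C n. p (A (Suc n)) \<le> p (\<lambda>w. A n w + (1/2)^n * G w) + \<delta> n)))"
  proof -
    have "\<exists>A. \<forall>n. ((n = 0 \<longrightarrow> A n = (\<lambda>_. 0)) \<and> (\<exists>B. \<forall>w\<in>R. \<bar>A n w\<bar> \<le> B)) \<and>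
      (\<exists>F\<in>C n. A (Suc n) = (\<lambda>w. A n w + (1/2)^n * F w) \<and>
        (\<forall>G\<in>C n. p (A (Suc n)) \<le> p (\<lambda>w. A n w + (1/2)^n * G w) + \<delta> n))"
    proof (rule dependent_nat_choice)
      show "\<exists>A::'x \<Rightarrow> real. (0 = (0::nat) \<longrightarrow> A = (\<lambda>_. 0)) \<and> (\<exists>B. \<forall>w\<in>R. \<bar>A w\<bar> \<le> B)"
        by (intro exI[of _ "\<lambda>_. 0"] conjI exI[of _ 0]) auto
      fix A :: "'x \<Rightarrow> real" and n :: nat
      assume "(n = 0 \<longrightarrow> A = (\<lambda>_. 0)) \<and> (\<exists>B. \<forall>w\<in>R. \<bar>A w\<bar> \<le> B)"
      then obtain B where B: "\<And>w. w \<in> R \<Longrightarrow> \<bar>A w\<bar> \<le> B" by blast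
      define val where "val G = p (\<lambda>w. A w + (1/2)^n * G w)" for G
      have sumb: "\<bar>A w + (1/2)^n * G w\<bar> \<le> B + M" if "G \<in> C n" "w \<in> R" for G w
      proof -
        have "\<bar>(1/2)^n * G w\<bar> \<le> 1 * \<bar>G w\<bar>" unfolding abs_mult
          by (intro mult_right_mono) (auto simp: power_le_one)
        then show ?thesis using B[OF that(2)] Cb[OF that] by linarith
      qed
      obtain w0 where w0: "w0 \<in> R" using ne by blast
      have "bdd_below (val ` C n)"
      proof (rule bdd_belowI2)
        fix G assume G: "G \<in> C n"
        have "A w0 + (1/2)^n * G w0 \<le> val G"
          unfolding val_def by (rule p_up[OF w0, where B = "B + M"]) (use sumb[OF G] in auto)
        then show "- (B + M) \<le> val G" using sumb[OF G w0] by linarith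
      qed
      moreover have Cne: "C n \<noteq> {}" using closed_convex_base unfolding C_def by blast
      ultimately obtain F where F: "F \<in> C n" "val F < Inf (val ` C n) + \<delta> n"
        using cInf_lessD[of "val ` C n" "Inf (val ` C n) + \<delta> n"] \<delta>[of n] by auto
      have "val F \<le> val G + \<delta> n" if "G \<in> C n" for G
        using cINF_lower[OF \<open>bdd_below (val ` C n)\<close> that] F(2) by linarith
      then show "\<exists>A'. ((Suc n = 0 \<longrightarrow> A' = (\<lambda>_. 0)) \<and> (\<exists>B. \<forall>w\<in>R. \<bar>A' w\<bar> \<le> B)) \<and>
         (\<exists>F\<in>C n. A' = (\<lambda>w. A w + (1/2)^n * F w) \<and>
           (\<forall>G\<in>C n. p A' \<le> p (\<lambda>w. A w + (1/2)^n * G w) + \<delta> n))"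
        using F(1) sumb[OF F(1)] unfolding val_def
        by (intro exI[of _ "\<lambda>w. A w + (1/2)^n * F w"] conjI exI[of _ "B + M"] bexI[of _ F]) auto
    qed
    then show ?thesis by blast
  qed
  then obtain A where A0: "A 0 = (\<lambda>_. 0)" and Ab: "\<And>n. \<exists>B. \<forall>w\<in>R. \<bar>A n w\<bar> \<le> B"
    and "\<And>n. \<exists>F\<in>C n. A (Suc n) = (\<lambda>w. A n w + (1/2)^n * F w) \<and>
        (\<forall>G\<in>C n. p (A (Suc n)) \<le> p (\<lambda>w. A n w + (1/2)^n * G w) + \<delta> n)"
    by blast
  from this(3) have "\<exists>F. \<forall>n. F n \<in> C n \<and> A (Suc n) = (\<lambda>w. A n w + (1/2)^n * F n w) \<and>
        (\<forall>G\<in>C n. p (A (Suc n)) \<le> p (\<lambda>w. A n w + (1/2)^n * G w) + \<delta> n)"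
    by (intro choice allI) blast
  then obtain F where F: "\<And>n. F n \<in> C n" and AS: "\<And>n. A (Suc n) = (\<lambda>w. A n w + (1/2)^n * F n w)"
    and greedy: "\<And>n G. G \<in> C n \<Longrightarrow> p (A (Suc n)) \<le> p (\<lambda>w. A n w + (1/2)^n * G w) + \<delta> n"
    by blast
  define \<mu> where "\<mu> = (\<lambda>n w. \<Sum>k. (1/2)^(Suc k) * F (n + k) w)"
  have \<mu>_step: "\<mu> n w = (F n w + \<mu> (Suc n) w) / 2" if "w \<in> R" for n w
    unfolding \<mu>_def
    by (rule dyadic_mix(1)[where F = F and f = f and N = N and R = R and M = M])
      (use F b that in \<open>auto simp: C_def\<close>)
  have \<mu>_C: "\<mu> n \<in> C n" for n
    unfolding \<mu>_def C_def
    by (rule dyadic_mix(2)[where F = F and f = f and N = N and R = R and M = M])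
      (use F b in \<open>auto simp: C_def\<close>)
  define s where "s w = 2 * \<mu> 0 w" for w
  have s: "s w = A n w + 2 * (1/2)^n * \<mu> n w" if "w \<in> R" for n w
  proof (induction n)
    case 0
    show ?case by (simp add: A0 s_def)
  next
    case (Suc n)
    have "\<mu> n w = (F n w + \<mu> (Suc n) w) / 2" using \<mu>_step[OF that, of n] .
    with Suc have "s w = A n w + 2 * (1/2)^n * ((F n w + \<mu> (Suc n) w) / 2)" by (simp only:)
    then show ?case by (simp add: AS algebra_simps)
  qed
  have sb: "\<forall>w\<in>R. \<bar>s w\<bar> \<le> 2 * M" using Cb[OF \<mu>_C[of 0]] by (simp add: s_def abs_mult)
  have "p (\<mu> 0) \<le> p s / 2"
  proof (rule p_le)
    fix w assume "w \<in> R"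
    from p_up[OF this sb] show "\<mu> 0 w \<le> p s / 2" unfolding s_def[of w] by simp
  qed
  then have ps: "p s \<ge> 2 * m" using C_big[OF \<mu>_C[of 0]] by linarith
  have d: "p s - p (A n) \<ge> (m + m * (1/2)^n) * (1/2)^n" for n
  proof (induction n)
    case 0
    have "p (A 0) \<le> 0" by (rule p_le) (simp add: A0)
    then show ?case using ps by simp
  next
    case (Suc n)
    obtain B where B: "\<forall>w\<in>R. \<bar>A n w\<bar> \<le> B" using Ab[of n] by blast
    \<comment> \<open>\<open>s - A n\<close> is twice \<open>(1/2)^n * \<mu> n\<close>, so this
      function is the midpoint of \<open>A n\<close> and \<open>s\<close>. As \<open>\<mu> n\<close>
      competes in the greedy choice, \<open>A (Suc n)\<close> can exceed this midpoint in supremum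
      only by \<open>\<delta> n\<close>.\<close>
    have "p (\<lambda>w. A n w + (1/2)^n * \<mu> n w) \<le> (p (A n) + p s) / 2"
    proof (rule p_le)
      fix w assume w: "w \<in> R"
      have "A n w + (1/2)^n * \<mu> n w = (A n w + s w) / 2" using s[OF w, of n] by simp
      also have "\<dots> \<le> (p (A n) + p s) / 2" using p_up[OF w B] p_up[OF w sb] by simp
      finally show "A n w + (1/2)^n * \<mu> n w \<le> (p (A n) + p s) / 2" .
    qed
    then have "p s - p (A (Suc n)) \<ge> (p s - p (A n)) / 2 - \<delta> n"
      using greedy[OF \<mu>_C[of n]] by argo
    moreover have "(p s - p (A n)) / 2 - \<delta> n \<ge> ((m + m * (1/2)^n) * (1/2)^n) / 2 - \<delta> n"
      using Suc by simp
    moreover have "((m + m * (1/2)^n) * (1/2)^n) / 2 - \<delta> n = (m + m * (1/2)^(Suc n)) * (1/2)^(Suc n)"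
      by (simp add: \<delta>_def field_simps)
    ultimately show ?case by linarith
  qed
  have "continuous_on R s"
    unfolding s_def by (intro continuous_intros closed_convex_continuous[OF \<mu>_C[unfolded C_def] f])
  then obtain w where w: "w \<in> R" "\<And>v. v \<in> R \<Longrightarrow> s v \<le> s w"
    using continuous_attains_sup[OF R ne] by blast
  then have sw: "s w = p s" using p_le[of s "s w"] p_up[OF w(1) sb] by force
  \<comment> \<open>At a maximum point of \<open>s\<close> the rest of the series equals
    \<open>p s - A n w\<close>, which is at least \<open>p s - p (A n)\<close>. The gap
    \<open>d\<close> then makes every mixture \<open>\<mu> n\<close> large at the same
    \<open>w\<close>, although \<open>\<mu> n\<close> only involves indices from
    \<open>N + n\<close> on, where \<open>f j w\<close> is eventually small.\<close>
  have \<mu>_big: "\<mu> n w \<ge> m / 2" for n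
  proof -
    obtain B where B: "\<forall>w\<in>R. \<bar>A n w\<bar> \<le> B" using Ab[of n] by blast
    have "2 * (1/2)^n * \<mu> n w = p s - A n w" using s[OF w(1), of n] sw by simp
    also have "\<dots> \<ge> p s - p (A n)" using p_up[OF w(1) B] by simp
    finally have "2 * (1/2)^n * \<mu> n w \<ge> (m + m * (1/2)^n) * (1/2)^n" using d[of n] by linarith
    then have "(2 * \<mu> n w) * (1/2)^n \<ge> (m + m * (1/2)^n) * (1/2)^n" by (simp add: mult_ac)
    then have "2 * \<mu> n w \<ge> m + m * (1/2)^n" by (subst (asm) mult_le_cancel_right_pos) auto
    moreover have "m * (1/2)^n \<ge> 0" using m by simp
    ultimately show ?thesis by linarith
  qed
  have "\<forall>\<^sub>F j in sequentially. f j w < m / 4"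
    using order_tendstoD(2)[OF lim[OF w(1)], of "m / 4"] m by simp
  then obtain n where "\<And>j. j \<ge> n \<Longrightarrow> f j w < m / 4" by (auto simp: eventually_sequentially)
  then have "\<mu> n w \<le> m / 4"
    using closed_convex_le[OF \<mu>_C[of n, unfolded C_def] w(1), of "m / 4"] by (simp add: less_imp_le)
  then show False using \<mu>_big[of n] m by linarith
qed

section \<open>Schauder bases\<close>

lemma compact_product:
  fixes S :: "'i \<Rightarrow> 'b::topological_space set"
  assumes "\<And>i. compact (S i)"
  shows "compact {f. \<forall>i. f i \<in> S i}"
proof -
  have "compactin (product_topology (\<lambda>_. euclidean) UNIV) (PiE UNIV S)"
    using assms by (subst compactin_PiE) auto
  then show ?thesis by (simp add: euclidean_product_topology PiE_UNIV_domain Pi_def)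
qed

section \<open>Real scalars and real-linear functionals\<close>

context banach_over
begin

text \<open>The defect \<open>d\<close> is additive and vanishes on the integers, so
  \<open>n * d r = d (frac (n * r))\<close>. The right side is bounded uniformly in
  \<open>n\<close>, which forces \<open>d r = 0\<close>.\<close>

lemma sc_of_real: "sc (of_real r) x = r *\<^sub>R x"
proof -
  define d where "d r = sc (of_real r) x - r *\<^sub>R x" for r
  have add: "d (r + s) = d r + d s" for r s
    by (simp add: d_def scale_left_distrib scaleR_left_distrib)
  have d0: "d 0 = 0" and d1: "d 1 = 0" by (simp_all add: d_def)
  have dn: "d (of_nat n * r) = of_nat n *\<^sub>R d r" for n r
    by (induction n) (simp_all add: d0 add distrib_right scaleR_left_distrib)
  have dneg: "d (- r) = - d r" for r using add[of r "- r"] d0 by (simp add: eq_neg_iff_add_eq_0 add.commute)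
  have dnat: "d (of_nat n) = 0" for n using dn[of n 1] d1 by simp
  have dint: "d (of_int k) = 0" for k
    by (cases k rule: int_cases2) (simp_all add: dnat dneg)
  have bound: "norm (d r) \<le> 2 * \<bar>r\<bar> * norm x" for r
    unfolding d_def using norm_triangle_ineq4[of "sc (of_real r) x" "r *\<^sub>R x"] by (simp add: norm_sc)
  have "real n * norm (d r) \<le> 2 * norm x" for n
  proof -
    let ?t = "real n * r"
    have "d ?t = d (frac ?t)" using add[of "frac ?t" "of_int \<lfloor>?t\<rfloor>"] dint by (simp add: frac_def)
    then have "norm (d ?t) \<le> 2 * \<bar>frac ?t\<bar> * norm x" using bound[of "frac ?t"] by simp
    also have "\<dots> \<le> 2 * 1 * norm x"
      using frac_lt_1[of ?t] frac_ge_0[of ?t] by (intro mult_right_mono) (auto simp: abs_le_iff)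
    finally show ?thesis by (simp add: dn)
  qed
  then have "norm (d r) = 0"
    using reals_Archimedean3[of "norm (d r)"] by (metis norm_ge_zero less_eq_real_def not_le)
  then show ?thesis by (simp add: d_def)
qed

lemma sc_scaleR_left: "sc (r *\<^sub>R c) x = r *\<^sub>R sc c x"
  by (simp add: scaleR_conv_of_real sc_of_real[symmetric])

lemma sc_scaleR_right: "sc c (r *\<^sub>R x) = r *\<^sub>R sc c x"
  by (simp add: sc_of_real[symmetric] scale_left_commute)

lemma bounded_linear_sc_left: "bounded_linear (\<lambda>c. sc c x)"
  by (rule bounded_linear_intro[of _ "norm x"])
    (simp_all add: scale_left_distrib sc_scaleR_left norm_sc)

lemma bounded_linear_sc_right: "bounded_linear (sc c)"
  by (rule bounded_linear_intro[of _ "norm c"])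
    (simp_all add: scale_right_distrib sc_scaleR_right norm_sc mult.commute)

lemmas continuous_on_sc_left [continuous_intros] = bounded_linear.continuous_on[OF bounded_linear_sc_left]

text \<open>
  Every real-linear functional is the \<open>1\<close>-component of a 'k-linear one, as the bilinear form
  \<open>inner (c * d) 1\<close> on the scalar field is nondegenerate.
\<close>

lemma real_functional_is_component:
  fixes u :: "'e \<Rightarrow> real"
  assumes u: "linear u" and b: "\<And>x. \<bar>u x\<bar> \<le> norm x"
  obtains g :: "'e \<Rightarrow> 'k" where "\<And>x y. g (x + y) = g x + g y" "\<And>c x. g (sc c x) = c * g x"
    "\<And>x. norm (g x) \<le> norm x" "\<And>x. u x = inner (g x) 1"
proof -
  have form0: "d = 0" if "\<And>c. inner (c * d) (1::'k) = 0" for d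
  proof (rule ccontr)
    assume "d \<noteq> 0"
    then show False using that[of "inverse d"] by simp
  qed
  have ex: "\<exists>d. \<forall>c. inner (c * d) (1::'k) = u (sc c x)" for x
  proof -
    \<comment> \<open>\<open>T d\<close> records the coordinates of the functional
      \<open>\<lambda>c. inner (c * d) 1\<close>. Nondegeneracy makes \<open>T\<close> injective,
      and finite dimension makes it onto, so every real-linear functional of the scalar has this
      form, in particular \<open>\<lambda>c. u (sc c x)\<close>.\<close>
    define T where "T d = (\<Sum>b\<in>Basis. inner (b * d) (1::'k) *\<^sub>R b)" for d
    have T: "inner (T d) b = inner (b * d) 1" if "b \<in> Basis" for b d
      using that by (simp add: T_def inner_sum_left inner_Basis if_distrib sum.delta cong: if_cong)
    have linT: "linear T"
      by (rule linearI) (simp_all add: T_def distrib_left inner_add_left scaleR_left_distrib sum.distrib scaleR_sum_right)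
    have ext: "f = g" if "linear f" "linear g" "\<And>b. b \<in> Basis \<Longrightarrow> f b = g b" for f g :: "'k \<Rightarrow> real"
      using linear_eq_stdbasis[OF that(1,2)] that(3) by blast
    have lin_form: "linear (\<lambda>c. inner (c * d) (1::'k))" for d
      by (rule linearI) (simp_all add: distrib_right inner_add_left)
    have "inj T"
    proof (rule linear_injective_0[OF linT, THEN iffD2], intro allI impI)
      fix d assume "T d = 0"
      then have "inner (b * d) 1 = 0" if "b \<in> Basis" for b using T[OF that, of d] by simp
      then have "(\<lambda>c. inner (c * d) 1) = (\<lambda>_. 0)" by (intro ext lin_form) (auto intro: linearI)
      then show "d = 0" using form0 by metis
    qed
    then have "surj T" using linT linear_injective_imp_surjective by blast
    then obtain d where "T d = (\<Sum>b\<in>Basis. u (sc b x) *\<^sub>R b)" by (metis surjE)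
    then have "inner (b * d) 1 = u (sc b x)" if "b \<in> Basis" for b
      using T[OF that, of d] that by (simp add: inner_sum_left inner_Basis if_distrib sum.delta cong: if_cong)
    moreover have "linear (\<lambda>c. u (sc c x))"
      by (rule linearI) (simp_all add: scale_left_distrib sc_scaleR_left linear_add[OF u] linear_scale[OF u])
    ultimately have "(\<lambda>c. inner (c * d) 1) = (\<lambda>c. u (sc c x))" by (intro ext lin_form)
    then show ?thesis by metis
  qed
  then obtain g where g: "\<And>x c. inner (c * g x) (1::'k) = u (sc c x)" by metis
  have eqI: "d = d'" if "\<And>c. inner (c * d) (1::'k) = inner (c * d') 1" for d d'
    using form0[of "d - d'"] that by (simp add: right_diff_distrib inner_diff_left)
  show thesis
  proof
    show "g (x + y) = g x + g y" for x y
      by (rule eqI) (simp add: g distrib_left inner_add_left scale_right_distrib linear_add[OF u])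
    show "g (sc c x) = c * g x" for c x
    proof (rule eqI)
      fix c' show "inner (c' * g (sc c x)) 1 = inner (c' * (c * g x)) 1"
        using g[of c' "sc c x"] g[of "c' * c" x] by (simp add: mult.assoc)
    qed
    show "u x = inner (g x) 1" for x using g[of 1 x] by simp
    show "norm (g x) \<le> norm x" for x
    proof (cases "g x = 0")
      case False
      \<comment> \<open>A scalar of modulus 1 that rotates \<open>g x\<close> to its norm, where
        \<open>g\<close> and \<open>u\<close> agree; the bound on \<open>u\<close> passes to
        \<open>g\<close> without loss.\<close>
      define c where "c = of_real (norm (g x)) / g x"
      have "norm c = 1" using False by (simp add: c_def norm_divide)
      have "c * g x = of_real (norm (g x))" using False by (simp add: c_def)
      then have "norm (g x) = u (sc c x)"
        using g[of c x] by (simp add: of_real_def dot_square_norm)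
      also have "\<dots> \<le> norm (sc c x)" using b[of "sc c x"] by simp
      also have "\<dots> = norm x" using \<open>norm c = 1\<close> by (simp add: norm_sc)
      finally show ?thesis .
    qed simp
  qed
qed

end

section \<open>Coefficients and partial sums of a basis\<close>

locale schauder_space = banach_over sc
  for sc :: "'k::{real_normed_field, euclidean_space} \<Rightarrow> 'e::banach \<Rightarrow> 'e" +
  fixes h :: "nat \<Rightarrow> 'e"
  assumes basis: "schauder_basis sc h" and norm_h: "norm (h j) = 1"
begin

definition coef :: "'e \<Rightarrow> nat \<Rightarrow> 'k" where
  "coef x = (THE a. (\<lambda>j. sc (a j) (h j)) sums x)"

lemma coef_sums: "(\<lambda>j. sc (coef x j) (h j)) sums x"
  using basis theI'[of "\<lambda>a. (\<lambda>j. sc (a j) (h j)) sums x"] unfolding schauder_basis_def coef_def by blast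

lemma coef_unique: "(\<lambda>j. sc (a j) (h j)) sums x \<Longrightarrow> coef x = a"
  using basis coef_sums[of x] unfolding schauder_basis_def by blast

lemma coef_add: "coef (x + y) j = coef x j + coef y j"
proof -
  have "(\<lambda>j. sc (coef x j + coef y j) (h j)) sums (x + y)"
    using sums_add[OF coef_sums[of x] coef_sums[of y]] by (simp add: scale_left_distrib)
  from coef_unique[OF this] show ?thesis by simp
qed

lemma coef_sc: "coef (sc c x) j = c * coef x j"
proof -
  have "(\<lambda>j. sc (c * coef x j) (h j)) sums (sc c x)"
    using bounded_linear.sums[OF bounded_linear_sc_right coef_sums] by (simp add: scale_scale)
  from coef_unique[OF this] show ?thesis by simp
qed

lemma coef_scaleR: "coef (r *\<^sub>R x) j = r *\<^sub>R coef x j"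
  using coef_sc[of "of_real r" x j] by (simp add: sc_of_real scaleR_conv_of_real)

lemma coef_diff: "coef (x - y) j = coef x j - coef y j"
  using coef_add[of "x - y" y j] by simp

lemma coef_0: "coef 0 j = 0"
  using coef_scaleR[of 0 0 j] by simp

lemma coef_sum: "coef (\<Sum>i\<in>A. f i) j = (\<Sum>i\<in>A. coef (f i) j)"
  by (induction A rule: infinite_finite_induct) (simp_all add: coef_0 coef_add)

lemma coef_h: "coef (h i) j = (if i = j then 1 else 0)"
proof -
  have "(\<lambda>j. sc (if i = j then 1 else 0) (h j)) sums (\<Sum>j\<in>{i}. sc (if i = j then 1 else 0) (h j))"
    by (rule sums_finite) auto
  then show ?thesis using coef_unique[of "\<lambda>j. if i = j then 1 else 0" "h i"] by simp
qed

lemma coef_zero_imp: "(\<And>j. coef x j = 0) \<Longrightarrow> x = 0"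
  using coef_sums[of x] sums_unique2[of "\<lambda>_. 0" x 0] by simp

definition psum :: "nat \<Rightarrow> 'e \<Rightarrow> 'e" where
  "psum n x = (\<Sum>j<n. sc (coef x j) (h j))"

lemma psum_tendsto: "(\<lambda>n. psum n x) \<longlonglongrightarrow> x"
  using coef_sums[of x] by (simp add: sums_def psum_def)

lemma psum_diff: "psum n (x - y) = psum n x - psum n y"
  by (simp add: psum_def coef_diff scale_left_diff_distrib sum_subtractf)

lemma psum_scaleR: "psum n (r *\<^sub>R x) = r *\<^sub>R psum n x"
  by (simp add: psum_def coef_scaleR sc_scaleR_left scaleR_sum_right)

lemma psum_bounded_at: "\<exists>M. \<forall>n. norm (psum n x) \<le> M"
  using convergent_imp_bounded[OF psum_tendsto] by (auto simp: bounded_iff)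

text \<open>Baire's theorem: the sets \<open>A m\<close> cover E, so the closure of one of them
  contains a ball. Half differences of points near \<open>x0 + y\<close> and \<open>x0 - y\<close>
  move the ball to the origin, and scaling reaches all \<open>y\<close>. Only approximation is
  obtained, because \<open>A m\<close> is not known to be closed before the coefficients are known
  to be continuous.\<close>

lemma psum_approx:
  obtains M where "M \<ge> 0" "\<And>y e. e > 0 \<Longrightarrow> \<exists>z. (\<forall>n. norm (psum n z) \<le> M * norm y) \<and> norm (y - z) < e"
proof -
  define A where "A m = {x. \<forall>n. norm (psum n x) \<le> real m}" for m :: nat
  have "\<exists>m. interior (closure (A m)) \<noteq> {}"
  proof (rule ccontr)
    assume no: "\<not> ?thesis"
    have "euclidean interior_of \<Union>(range (\<lambda>m. closure (A m))) = {}"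
      by (rule Baire_category_alt) (use no in \<open>auto simp: completely_metrizable_space_euclidean\<close>)
    moreover have "\<Union>(range (\<lambda>m. closure (A m))) = UNIV"
    proof (intro equalityI subsetI UNIV_I)
      fix x
      obtain M where M: "\<And>n. norm (psum n x) \<le> M" using psum_bounded_at by blast
      obtain m where "M \<le> real m" using real_arch_simple by blast
      then have "x \<in> A m" using M by (auto simp: A_def intro: order_trans)
      then show "x \<in> \<Union>(range (\<lambda>m. closure (A m)))" using closure_subset by blast
    qed
    ultimately show False by simp
  qed
  then obtain m x0 r where r: "r > 0" "ball x0 r \<subseteq> closure (A m)"
    by (meson all_not_in_conv interior_subset mem_interior subset_trans)
  have near: "\<exists>z. (\<forall>n. norm (psum n z) \<le> real m) \<and> norm (y - z) < e" if y: "norm y < r" and e: "e > 0" for y e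
  proof -
    have "x0 + y \<in> closure (A m)" "x0 - y \<in> closure (A m)" using y r(2) by (auto simp: dist_norm subset_iff)
    then obtain a b where a: "a \<in> A m" "dist a (x0 + y) < e" and b: "b \<in> A m" "dist b (x0 - y) < e"
      using e by (meson closure_approachable)
    let ?z = "(1/2) *\<^sub>R (a - b)"
    have "norm (psum n ?z) \<le> real m" for n
    proof -
      have "norm (psum n ?z) = norm (psum n a - psum n b) / 2" by (simp only: psum_scaleR psum_diff) simp
      also have "\<dots> \<le> (real m + real m) / 2"
        using a(1) b(1) norm_triangle_ineq4[of "psum n a" "psum n b"] unfolding A_def
        by (smt (verit) divide_right_mono mem_Collect_eq)
      finally show ?thesis by simp
    qed
    moreover have "norm (y - ?z) < e"
    proof -
      have "y - ?z = (1/2) *\<^sub>R ((x0 + y - a) - (x0 - y - b))"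
        by (simp add: algebra_simps scaleR_2[symmetric])
      then have "norm (y - ?z) \<le> (norm (x0 + y - a) + norm (x0 - y - b)) / 2"
        using norm_triangle_ineq4[of "x0 + y - a" "x0 - y - b"] by simp
      also have "\<dots> < e" using a(2) b(2) by (simp add: dist_norm norm_minus_commute)
      finally show ?thesis .
    qed
    ultimately show ?thesis by blast
  qed
  define M where "M = 2 * real m / r"
  have "\<exists>z. (\<forall>n. norm (psum n z) \<le> M * norm y) \<and> norm (y - z) < e" if e: "e > 0" for y e
  proof (cases "y = 0")
    case True
    then show ?thesis using e by (intro exI[of _ 0]) (simp add: psum_def coef_0)
  next
    case False
    define t where "t = r / (2 * norm y)"
    have t: "t > 0" using False r(1) by (simp add: t_def)
    have "norm (t *\<^sub>R y) < r" using t r(1) False by (simp add: t_def)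
    moreover have "t * e > 0" using t e by simp
    ultimately obtain z where z: "\<And>n. norm (psum n z) \<le> real m" "norm (t *\<^sub>R y - z) < t * e"
      using near by blast
    have "norm (psum n (inverse t *\<^sub>R z)) \<le> M * norm y" for n
      using z(1)[of n] t r(1) False unfolding psum_scaleR by (simp add: t_def M_def field_simps)
    moreover have "norm (y - inverse t *\<^sub>R z) < e"
    proof -
      have "t *\<^sub>R y - z = t *\<^sub>R (y - inverse t *\<^sub>R z)" using t by (simp add: algebra_simps)
      then have "norm (t *\<^sub>R y - z) = t * norm (y - inverse t *\<^sub>R z)" using t by simp
      then show ?thesis using z(2) t by simp
    qed
    ultimately show ?thesis by blast
  qed
  moreover have "M \<ge> 0" using r(1) by (simp add: M_def)
  ultimately show thesis using that by blast
qed

text \<open>Successive approximation, as for the open mapping theorem: \<open>x\<close> is a series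
  of vectors \<open>z k\<close> whose partial sums are bounded by \<open>M / 2 ^ k\<close> times the
  norm of \<open>x\<close>. The convergence is uniform in \<open>n\<close>, so the limits over
  \<open>n\<close> and \<open>k\<close> can be interchanged, and uniqueness of expansions identifies
  the result with the partial sums of \<open>x\<close>.\<close>

lemma psum_bounded: "\<exists>K. \<forall>n x. norm (psum n x) \<le> K * norm x"
proof -
  obtain M where M: "M \<ge> 0"
    and approx: "\<And>y e. e > 0 \<Longrightarrow> \<exists>z. (\<forall>n. norm (psum n z) \<le> M * norm y) \<and> norm (y - z) < e"
    using psum_approx by blast
  have "norm (psum n x) \<le> 2 * M * norm x" for n x
  proof (cases "x = 0")
    case True
    then show ?thesis by (simp add: psum_def coef_0)
  next
    case False
    define D where "D k = (1/2)^k * norm x" for k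
    have D: "D k > 0" for k using False by (simp add: D_def)
    have "\<exists>y. \<forall>k. ((k = 0 \<longrightarrow> y k = x) \<and> norm (y k) \<le> D k) \<and>
        (\<forall>n. norm (psum n (y k - y (Suc k))) \<le> M * D k)"
    proof (rule dependent_nat_choice)
      show "\<exists>y. (0 = (0::nat) \<longrightarrow> y = x) \<and> norm y \<le> D 0" by (simp add: D_def)
      fix y and k :: nat
      assume y: "(k = 0 \<longrightarrow> y = x) \<and> norm y \<le> D k"
      obtain z where z: "\<And>n. norm (psum n z) \<le> M * norm y" "norm (y - z) < D (Suc k)"
        using approx[OF D[of "Suc k"], of y] by blast
      have "norm (psum n z) \<le> M * D k" for n
        using z(1)[of n] y M by (meson mult_left_mono order_trans)
      then show "\<exists>y'. ((Suc k = 0 \<longrightarrow> y' = x) \<and> norm y' \<le> D (Suc k)) \<and> (\<forall>n. norm (psum n (y - y')) \<le> M * D k)"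
        using z(2) by (intro exI[of _ "y - z"]) auto
    qed
    then obtain y where y0: "y 0 = x" and yD: "\<And>k. norm (y k) \<le> D k"
      and yM: "\<And>k n. norm (psum n (y k - y (Suc k))) \<le> M * D k" by blast
    define z where "z k = y k - y (Suc k)" for k
    have zM: "norm (psum n (z k)) \<le> M * D k" for n k using yM by (simp add: z_def)
    have D_sums: "D sums (2 * norm x)"
      using sums_mult2[OF geometric_sums[of "1/2::real"], of "norm x"] by (simp add: D_def[abs_def])
    then have MD: "(\<lambda>k. M * D k) sums (M * (2 * norm x))" by (rule sums_mult)
    have y_lim: "y \<longlonglongrightarrow> 0"
      by (rule tendsto_norm_zero_cancel, rule tendsto_sandwich[OF _ _ tendsto_const summable_LIMSEQ_zero[of D]])
        (use yD sums_summable[OF D_sums] in auto)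
    have z_sums: "z sums x" using telescope_sums'[OF y_lim] y0 by (simp add: z_def[abs_def])
    define w where "w n = (\<Sum>k. psum n (z k))" for n
    have summ: "summable (\<lambda>k. psum n (z k))" for n
      by (rule summable_comparison_test'[OF sums_summable[OF MD], of 0]) (use zM in auto)
    have w_bound: "norm (w n) \<le> 2 * M * norm x" for n
    proof -
      have "norm (w n) \<le> (\<Sum>k. M * D k)"
        unfolding w_def by (rule norm_suminf_le[OF zM sums_summable[OF MD]])
      then show ?thesis using MD by (simp add: sums_iff mult_ac)
    qed
    have w_lim: "w \<longlonglongrightarrow> x"
    proof (rule swap_uniform_limit')
      show "\<forall>\<^sub>F K in sequentially. (\<lambda>n. \<Sum>k<K. psum n (z k)) \<longlonglongrightarrow> (\<Sum>k<K. z k)"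
        by (intro always_eventually allI tendsto_sum psum_tendsto)
      show "(\<lambda>K. \<Sum>k<K. z k) \<longlonglongrightarrow> x" using z_sums by (simp add: sums_def)
      show "uniform_limit UNIV (\<lambda>K n. \<Sum>k<K. psum n (z k)) w sequentially"
        unfolding w_def by (rule Weierstrass_m_test[OF _ sums_summable[OF MD]]) (use zM in auto)
    qed auto
    have coef_z: "norm (coef (z k) j) \<le> 2 * (M * D k)" for k j
    proof -
      have "sc (coef (z k) j) (h j) = psum (Suc j) (z k) - psum j (z k)" by (simp add: psum_def)
      then have "norm (coef (z k) j) = norm (psum (Suc j) (z k) - psum j (z k))"
        by (metis norm_sc norm_h mult.right_neutral)
      then show ?thesis
        using norm_triangle_ineq4[of "psum (Suc j) (z k)" "psum j (z k)"] zM[of "Suc j" k] zM[of j k] by linarith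
    qed
    have coef_summ: "summable (\<lambda>k. coef (z k) j)" for j
      by (rule summable_comparison_test'[OF summable_mult[OF sums_summable[OF MD], of 2], of 0])
        (use coef_z in auto)
    define b where "b j = (\<Sum>k. coef (z k) j)" for j
    \<comment> \<open>The coefficients \<open>b\<close> do not depend on \<open>n\<close>. Together
      with the convergence of \<open>w\<close> to \<open>x\<close> this makes \<open>b\<close> the
      expansion of \<open>x\<close>.\<close>
    have w_eq: "w n = (\<Sum>j<n. sc (b j) (h j))" for n
    proof -
      have "w n = (\<Sum>j<n. \<Sum>k. sc (coef (z k) j) (h j))"
        unfolding w_def psum_def
        by (rule suminf_sum) (rule bounded_linear.summable[OF bounded_linear_sc_left coef_summ])
      also have "\<dots> = (\<Sum>j<n. sc (b j) (h j))"
        unfolding b_def by (intro sum.cong refl bounded_linear.suminf[OF bounded_linear_sc_left coef_summ, symmetric])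
      finally show ?thesis .
    qed
    have "(\<lambda>j. sc (b j) (h j)) sums x" using w_lim by (simp add: sums_def w_eq[symmetric])
    then have "psum n x = w n" by (simp add: psum_def w_eq coef_unique)
    then show ?thesis using w_bound by simp
  qed
  then show ?thesis by blast
qed

lemma coef_bounded: "\<exists>K. \<forall>x j. norm (coef x j) \<le> K * norm x"
proof -
  obtain K where K: "\<And>n x. norm (psum n x) \<le> K * norm x" using psum_bounded by blast
  have "norm (coef x j) \<le> (2 * K) * norm x" for x j
  proof -
    have "sc (coef x j) (h j) = psum (Suc j) x - psum j x" by (simp add: psum_def)
    then have "norm (coef x j) = norm (psum (Suc j) x - psum j x)"
      by (metis norm_sc norm_h mult.right_neutral)
    then show ?thesis
      using norm_triangle_ineq4[of "psum (Suc j) x" "psum j x"] K[of "Suc j" x] K[of j x] by linarith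
  qed
  then show ?thesis by blast
qed

end

section \<open>Bases of reflexive spaces\<close>

locale reflexive_schauder_space = schauder_space sc h
  for sc :: "'k::{real_normed_field, euclidean_space} \<Rightarrow> 'e::banach \<Rightarrow> 'e" and h +
  assumes refl: "reflexive (type_space sc)"
begin

abbreviation edual :: "('e \<Rightarrow> 'k) set" where
  "edual \<equiv> pts (dual_space (type_space sc))"

lemma edual_iff: "g \<in> edual \<longleftrightarrow>
    (\<forall>x y. g (x + y) = g x + g y) \<and> (\<forall>c x. g (sc c x) = c * g x) \<and> (\<exists>B. \<forall>x. norm (g x) \<le> B * norm x)"
  by (auto simp: dual_space_def bounded_op_def type_space_def)

lemma edualD:
  assumes "g \<in> edual"
  shows "g (x + y) = g x + g y" "g (sc c x) = c * g x" "g 0 = 0"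
proof -
  show "g (x + y) = g x + g y" "g (sc c x) = c * g x" using assms by (auto simp: edual_iff)
  show "g 0 = 0" using assms[unfolded edual_iff] by (metis scale_zero_left mult_zero_left)
qed

lemma edual_norm:
  assumes g: "g \<in> edual"
  shows "norm (g x) \<le> op_norm (type_space sc) (type_space (*)) g * norm x"
proof (cases "x = 0")
  case True
  then show ?thesis using edualD(3)[OF g] by simp
next
  case False
  obtain B where B: "\<And>x. norm (g x) \<le> B * norm x" using g by (auto simp: edual_iff)
  have B': "norm (g x) \<le> \<bar>B\<bar>" if "norm x \<le> 1" for x
  proof -
    have "B * norm x \<le> \<bar>B\<bar> * norm x" by (rule mult_right_mono) auto
    also have "\<dots> \<le> \<bar>B\<bar> * 1" using that by (intro mult_left_mono) auto
    finally show ?thesis using B[of x] by simp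
  qed
  define c :: 'k where "c = of_real (inverse (norm x))"
  have c: "norm c = inverse (norm x)" by (simp add: c_def norm_inverse)
  have "norm (g (sc c x)) \<le> op_norm (type_space sc) (type_space (*)) g"
    unfolding op_norm_def
  proof (rule cSUP_upper2)
    show "bdd_above ((\<lambda>x. nrm (type_space (*)) (g x)) ` {x \<in> pts (type_space sc). nrm (type_space sc) x \<le> 1})"
      by (rule bdd_aboveI2[of _ _ "\<bar>B\<bar>"]) (use B' in \<open>auto simp: type_space_def\<close>)
    show "sc c x \<in> {x \<in> pts (type_space sc). nrm (type_space sc) x \<le> 1}"
      using False by (simp add: type_space_def norm_sc c)
  qed (simp add: type_space_def)
  then show ?thesis using False by (simp add: edualD(2)[OF g] norm_mult c field_simps)
qed

lemma edual_add: "g \<in> edual \<Longrightarrow> g' \<in> edual \<Longrightarrow> g + g' \<in> edual"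
proof -
  assume g: "g \<in> edual" "g' \<in> edual"
  then obtain B B' where "\<And>x. norm (g x) \<le> B * norm x" "\<And>x. norm (g' x) \<le> B' * norm x"
    by (auto simp: edual_iff)
  then have "norm (g x + g' x) \<le> (B + B') * norm x" for x
    by (smt (verit) norm_triangle_ineq distrib_right)
  then show ?thesis
    using edualD[OF g(1)] edualD[OF g(2)] unfolding edual_iff by (auto simp: algebra_simps intro!: exI[of _ "B + B'"])
qed

lemma edual_scale: "g \<in> edual \<Longrightarrow> fscale c g \<in> edual"
proof -
  assume g: "g \<in> edual"
  then obtain B where "\<And>x. norm (g x) \<le> B * norm x"
    by (auto simp: edual_iff)
  then have "norm (c * g x) \<le> (norm c * B) * norm x" for x
    by (simp add: norm_mult mult.assoc mult_left_mono)
  then show ?thesis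
    using edualD[OF g(1)] unfolding edual_iff fscale_def by (auto simp: algebra_simps intro!: exI[of _ "norm c * B"])
qed

lemma coef_edual: "(\<lambda>x. coef x j) \<in> edual"
  using coef_bounded unfolding edual_iff by (auto simp: coef_add coef_sc)

text \<open>Tychonoff's theorem gives a cluster point in the bidual, which reflexivity brings back to E.\<close>

lemma weak_cluster_point:
  assumes z: "\<And>k. norm (z k) \<le> M"
  shows "\<exists>x. \<forall>g\<in>edual. \<forall>C. closed C \<longrightarrow> (\<forall>\<^sub>F k in sequentially. g (z k) \<in> C) \<longrightarrow> g x \<in> C"
proof -
  define nn where "nn = op_norm (type_space sc) (type_space ((*) :: 'k \<Rightarrow> _))"
  \<comment> \<open>Functionals on the dual have to vanish off its carrier, hence the factor
    \<open>{0}\<close> there; on the carrier the balls come from the bound on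
    \<open>z\<close>.\<close>
  define S where "S g = (if g \<in> edual then cball 0 (nn g * M) else {0 :: 'k})" for g
  define e where "e k = (\<lambda>g. if g \<in> edual then g (z k) else 0)" for k
  define F where "F = filtermap e sequentially"
  have nn0: "nn g \<ge> 0" if g: "g \<in> edual" for g
    using order_trans[OF norm_ge_zero edual_norm[OF g, of "h 0"]] by (simp add: norm_h nn_def)
  have "norm (g (z k)) \<le> nn g * M" if g: "g \<in> edual" for g k
    using edual_norm[OF g, of "z k"] mult_left_mono[OF z[of k] nn0[OF g]] unfolding nn_def by linarith
  then have eS: "e k \<in> {f. \<forall>g. f g \<in> S g}" for k by (auto simp: e_def S_def)
  have "compact {f. \<forall>g. f g \<in> S g}" by (rule compact_product) (auto simp: S_def)
  moreover have "F \<noteq> bot" by (simp add: F_def filtermap_bot_iff)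
  moreover have "eventually (\<lambda>f. f \<in> {f. \<forall>g. f g \<in> S g}) F" using eS by (simp add: F_def eventually_filtermap)
  ultimately obtain \<Phi> where \<Phi>: "\<Phi> \<in> {f. \<forall>g. f g \<in> S g}" "inf (nhds \<Phi>) F \<noteq> bot"
    unfolding compact_filter by blast
  \<comment> \<open>Closed conditions that the evaluations satisfy eventually pass to the cluster
    point. Additivity, homogeneity and the conclusion of the lemma are all of this kind.\<close>
  have cluster: "\<Phi> \<in> A" if A: "closed A" "\<forall>\<^sub>F k in sequentially. e k \<in> A" for A
  proof (rule ccontr)
    assume "\<Phi> \<notin> A"
    then have "\<forall>\<^sub>F f in nhds \<Phi>. f \<in> - A" using A(1) by (intro eventually_nhds_in_open) auto
    moreover have "\<forall>\<^sub>F f in F. f \<in> A" using A(2) by (simp add: F_def eventually_filtermap)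
    ultimately have "\<forall>\<^sub>F f in inf (nhds \<Phi>) F. False"
      unfolding eventually_inf by (metis ComplD)
    then show False using \<Phi>(2) by (simp add: trivial_limit_def)
  qed
  have add: "\<Phi> (g + g') = \<Phi> g + \<Phi> g'" if g: "g \<in> edual" "g' \<in> edual" for g g'
  proof -
    have "\<Phi> \<in> {f. f (g + g') = f g + f g'}"
    proof (rule cluster)
      show "closed {f :: ('e \<Rightarrow> 'k) \<Rightarrow> 'k. f (g + g') = f g + f g'}"
        by (intro closed_Collect_eq continuous_intros continuous_on_product_coordinates)
      show "\<forall>\<^sub>F k in sequentially. e k \<in> {f. f (g + g') = f g + f g'}"
        using edual_add[OF g] g by (simp add: e_def)
    qed
    then show ?thesis by simp
  qed
  have scale: "\<Phi> (fscale c g) = c * \<Phi> g" if g: "g \<in> edual" for c g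
  proof -
    have "\<Phi> \<in> {f. f (fscale c g) = c * f g}"
    proof (rule cluster)
      show "closed {f :: ('e \<Rightarrow> 'k) \<Rightarrow> 'k. f (fscale c g) = c * f g}"
        by (intro closed_Collect_eq continuous_intros continuous_on_product_coordinates)
      show "\<forall>\<^sub>F k in sequentially. e k \<in> {f. f (fscale c g) = c * f g}"
        using edual_scale[OF g] g by (simp add: e_def fscale_def)
    qed
    then show ?thesis by simp
  qed
  have S: "\<Phi> g \<in> S g" for g using \<Phi>(1) by simp
  have "\<Phi> \<in> pts (dual_space (dual_space (type_space sc)))"
  proof -
    have "norm (\<Phi> g) \<le> M * nn g" if "g \<in> edual" for g
      using S[of g] that by (simp add: S_def mult.commute)
    moreover have "\<Phi> g = 0" if "g \<notin> edual" for g using S[of g] that by (simp add: S_def)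
    moreover have "nrm (dual_space (type_space sc)) = nn" "smult (dual_space (type_space sc)) = fscale"
      by (simp_all add: dual_space_def nn_def)
    moreover have "\<Phi> \<in> pts (dual_space (dual_space (type_space sc))) \<longleftrightarrow>
       (\<forall>g\<in>edual. \<forall>g'\<in>edual. \<Phi> (g + g') = \<Phi> g + \<Phi> g') \<and>
       (\<forall>c. \<forall>g\<in>edual. \<Phi> (smult (dual_space (type_space sc)) c g) = c * \<Phi> g) \<and>
       (\<exists>B. \<forall>g\<in>edual. norm (\<Phi> g) \<le> B * nrm (dual_space (type_space sc)) g) \<and>
       (\<forall>g. g \<notin> edual \<longrightarrow> \<Phi> g = 0)"
      by (subst dual_space_def) (auto simp: bounded_op_def type_space_def)
    ultimately show ?thesis using add scale by auto
  qed
  then obtain x where x: "\<And>g. g \<in> edual \<Longrightarrow> \<Phi> g = g x"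
    using refl unfolding reflexive_def by blast
  show ?thesis
  proof (intro exI ballI allI impI)
    fix g C assume g: "g \<in> edual" and C: "closed C" "\<forall>\<^sub>F k in sequentially. g (z k) \<in> C"
    have "\<Phi> \<in> (\<lambda>f. f g) -` C"
    proof (rule cluster)
      show "closed ((\<lambda>f. f g) -` C)"
        by (rule closed_vimage[OF C(1) continuous_on_product_coordinates])
      show "\<forall>\<^sub>F k in sequentially. e k \<in> (\<lambda>f. f g) -` C" using C(2) g by (simp add: e_def)
    qed
    then show "g x \<in> C" using x[OF g] by simp
  qed
qed

text \<open>Each coefficient functional is eventually constant, equal to \<open>b j\<close>, along
  the partial sums. A weak cluster point of them therefore has the coefficients \<open>b\<close>,
  and its expansion is the given series.\<close>

lemma boundedly_complete:
  assumes "\<And>n. norm (\<Sum>j<n. sc (b j) (h j)) \<le> M"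
  shows "summable (\<lambda>j. sc (b j) (h j))"
proof -
  obtain x where x: "\<forall>g\<in>edual. \<forall>C. closed C \<longrightarrow>
      (\<forall>\<^sub>F n in sequentially. g (\<Sum>j<n. sc (b j) (h j)) \<in> C) \<longrightarrow> g x \<in> C"
    by (rule exE, rule weak_cluster_point[of "\<lambda>n. \<Sum>j<n. sc (b j) (h j)", OF assms])
  have coef_part: "coef (\<Sum>i<n. sc (b i) (h i)) j = b j" if "j < n" for n j
  proof -
    have "coef (\<Sum>i<n. sc (b i) (h i)) j = (\<Sum>i<n. if i = j then b i else 0)"
      unfolding coef_sum by (intro sum.cong) (auto simp: coef_sc coef_h)
    then show ?thesis using that by simp
  qed
  have "coef x j = b j" for j
  proof -
    have "\<forall>\<^sub>F n in sequentially. coef (\<Sum>i<n. sc (b i) (h i)) j \<in> {b j}"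
      using eventually_gt_at_top[of j] by eventually_elim (simp add: coef_part)
    from x[rule_format, OF coef_edual _ this] show ?thesis by simp
  qed
  then show ?thesis using coef_sums[of x] by (simp add: sums_iff)
qed

text \<open>A subsequence on which \<open>u\<close> stays away from zero has a weak cluster point.
  All coefficients of this point vanish, so it is 0, yet the absolute value of \<open>u\<close>
  there is at least \<open>e\<close>. The real functional \<open>u\<close> is replaced by a
  'k-linear \<open>g\<close> because cluster points are tested against the dual of E.\<close>

lemma coordinatewise_null_imp_weakly_null:
  assumes z: "\<And>k. norm (z k) \<le> M" and coord: "\<And>j. (\<lambda>k. coef (z k) j) \<longlonglongrightarrow> 0"
    and u: "linear u" "\<And>x. \<bar>u x\<bar> \<le> norm x"
  shows "(\<lambda>k. u (z k)) \<longlonglongrightarrow> (0::real)"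
proof (rule ccontr)
  assume "\<not> ?thesis"
  then obtain e where e: "e > 0" "\<not> (\<forall>\<^sub>F k in sequentially. dist (u (z k)) 0 < e)"
    unfolding tendsto_iff by blast
  then have "\<forall>m. \<exists>n>m. \<bar>u (z n)\<bar> \<ge> e"
    unfolding eventually_sequentially by (auto simp: dist_real_def not_less) (meson Suc_leD less_eq_Suc_le not_less)
  then have "infinite {n. \<bar>u (z n)\<bar> \<ge> e}" by (simp add: infinite_nat_iff_unbounded)
  then obtain r :: "nat \<Rightarrow> nat" where r: "strict_mono r" "\<And>n. \<bar>u (z (r n))\<bar> \<ge> e"
    using infinite_enumerate by blast
  obtain g where g: "\<And>x y. g (x + y) = g x + g y" "\<And>c x. g (sc c x) = c * g x"
    "\<And>x. norm (g x) \<le> norm x" "\<And>x. u x = inner (g x) 1"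
    using real_functional_is_component[OF u] by blast
  have ged: "g \<in> edual" unfolding edual_iff using g by (auto intro!: exI[of _ 1])
  obtain x where x: "\<forall>g\<in>edual. \<forall>C. closed C \<longrightarrow>
      (\<forall>\<^sub>F n in sequentially. g (z (r n)) \<in> C) \<longrightarrow> g x \<in> C"
    by (rule exE, rule weak_cluster_point[of "\<lambda>n. z (r n)", OF z])
  have "coef x j = 0" for j
  proof -
    have "norm (coef x j) \<le> d" if "d > 0" for d
    proof -
      have "(\<lambda>n. coef (z (r n)) j) \<longlonglongrightarrow> 0" using LIMSEQ_subseq_LIMSEQ[OF coord r(1)] by (simp add: o_def)
      from tendstoD[OF this that] have "\<forall>\<^sub>F n in sequentially. coef (z (r n)) j \<in> cball 0 d"
        by eventually_elim simp
      then have "coef x j \<in> cball 0 d"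
        by (rule x[rule_format, of "\<lambda>x. coef x j", OF coef_edual closed_cball])
      then show ?thesis by simp
    qed
    then have "norm (coef x j) \<le> 0" by (rule field_le_epsilon) simp
    then show ?thesis by simp
  qed
  then have "x = 0" by (rule coef_zero_imp)
  moreover have "g x \<in> {c. e \<le> \<bar>inner c 1\<bar>}"
  proof (rule x[rule_format, OF ged])
    show "closed {c::'k. e \<le> \<bar>inner c 1\<bar>}" by (intro closed_Collect_le continuous_intros)
    show "\<forall>\<^sub>F n in sequentially. g (z (r n)) \<in> {c. e \<le> \<bar>inner c 1\<bar>}" using r(2) by (simp add: g(4))
  qed
  ultimately show False using edualD(3)[OF ged] e(1) by simp
qed

end

section \<open>The norm of J(h)\<close>

definition block_index :: "(nat \<Rightarrow> nat) \<Rightarrow> nat \<Rightarrow> nat" where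
  "block_index n j = (LEAST k. j < n (Suc k))"

lemma block_index_eq:
  assumes "strict_mono n" "n k \<le> j" "j < n (Suc k)"
  shows "block_index n j = k"
  unfolding block_index_def
proof (rule Least_equality)
  show "j < n (Suc k)" by (rule assms(3))
  fix l assume "j < n (Suc l)"
  then have "n k < n (Suc l)" using assms(2) by simp
  then show "k \<le> l" using assms(1) by (simp add: strict_mono_less)
qed

lemma block_index:
  assumes n: "strict_mono n" and j: "n 0 \<le> j"
  shows "n (block_index n j) \<le> j" "j < n (Suc (block_index n j))"
proof -
  have "j < n (Suc j)" using strict_mono_imp_increasing[OF n, of "Suc j"] by simp
  then show *: "j < n (Suc (block_index n j))" unfolding block_index_def by (rule LeastI)
  show "n (block_index n j) \<le> j"
  proof (cases "block_index n j")
    case (Suc k)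
    then have "\<not> j < n (Suc k)" using not_less_Least[of k "\<lambda>k. j < n (Suc k)"] by (simp add: block_index_def)
    then show ?thesis using Suc by simp
  qed (use j in simp)
qed

text \<open>A chain \<open>p1 < q1 < p2 < q2 < ...\<close> is encoded by the set of its left ends
  and a map to the right ends, so that chains can be restricted, split and merged without
  renumbering. The empty chain is allowed, and the values of \<open>q\<close> off \<open>A\<close>
  are irrelevant.\<close>

definition interlaced :: "nat set \<Rightarrow> (nat \<Rightarrow> nat) \<Rightarrow> bool" where
  "interlaced A q \<longleftrightarrow> finite A \<and> (\<forall>p\<in>A. p < q p) \<and> (\<forall>p\<in>A. \<forall>p'\<in>A. p < p' \<longrightarrow> q p < p')"

lemma interlaced_finite: "interlaced A q \<Longrightarrow> finite A"
  and interlaced_less: "interlaced A q \<Longrightarrow> p \<in> A \<Longrightarrow> p < q p"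
  and interlaced_next: "interlaced A q \<Longrightarrow> p \<in> A \<Longrightarrow> p' \<in> A \<Longrightarrow> p < p' \<Longrightarrow> q p < p'"
  by (auto simp: interlaced_def)

lemma interlaced_subset: "interlaced A q \<Longrightarrow> B \<subseteq> A \<Longrightarrow> interlaced B q"
  unfolding interlaced_def using finite_subset by blast

lemma interlaced_empty: "interlaced {} q"
  by (simp add: interlaced_def)

lemma interlaced_singleton: "p < q \<Longrightarrow> interlaced {p} (\<lambda>_. q)"
  by (simp add: interlaced_def)

definition (in banach_over) jsum :: "(nat \<Rightarrow> 'e) \<Rightarrow> nat set \<Rightarrow> (nat \<Rightarrow> nat) \<Rightarrow> (nat \<Rightarrow> 'k) \<Rightarrow> 'e" where
  "jsum h A q a = (\<Sum>p\<in>A. sc (a p - a (q p)) (h p))"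

context banach_over
begin

lemma J_values_interlaced: "J_values sc h a = {norm (jsum h A q a) | A q. interlaced A q \<and> A \<noteq> {}}"
proof (intro equalityI subsetI)
  fix v assume "v \<in> J_values sc h a"
  then obtain n p q where v: "v = norm (\<Sum>i<n. sc (a (p i) - a (q i)) (h (p i)))" and n: "0 < n"
    and pq: "\<And>i. i < n \<Longrightarrow> p i < q i" and qp: "\<And>i. Suc i < n \<Longrightarrow> q i < p (Suc i)"
    unfolding J_values_def by blast
  have step: "q i < p j" if "i < j" "j < n" for i j
    using that
  proof (induction j)
    case (Suc j)
    show ?case
    proof (cases "i = j")
      case False
      then have "q i < p j" using Suc by simp
      also have "\<dots> < q j" using pq Suc by simp
      also have "\<dots> < p (Suc j)" using qp Suc by simp
      finally show ?thesis .
    qed (use qp Suc in simp)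
  qed simp
  have mono: "p i < p j" if "i < j" "j < n" for i j
    using pq[of i] step[OF that] that by simp
  have inj: "inj_on p {..<n}"
    by (rule linorder_inj_onI) (use mono in fastforce)+
  define q' where "q' m = q (inv_into {..<n} p m)" for m
  have q': "q' (p i) = q i" if "i < n" for i using inv_into_f_f[OF inj] that by (simp add: q'_def)
  have "interlaced (p ` {..<n}) q'"
    unfolding interlaced_def
  proof (intro conjI ballI impI)
    fix x y assume "x \<in> p ` {..<n}" "y \<in> p ` {..<n}" "x < y"
    then obtain i j where ij: "x = p i" "y = p j" "i < n" "j < n" by auto
    have "i < j" using \<open>x < y\<close> ij mono[of j i] by (cases i j rule: linorder_cases) auto
    then show "q' x < y" using step ij q' by simp
  qed (use pq q' in auto)
  moreover have "jsum h (p ` {..<n}) q' a = (\<Sum>i<n. sc (a (p i) - a (q i)) (h (p i)))"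
    unfolding jsum_def by (subst sum.reindex[OF inj]) (simp add: q')
  moreover have "p ` {..<n} \<noteq> {}" using n by auto
  ultimately show "v \<in> {norm (jsum h A q a) | A q. interlaced A q \<and> A \<noteq> {}}" unfolding v
    by (intro CollectI exI[of _ "p ` {..<n}"] exI[of _ q']) simp
next
  fix v assume "v \<in> {norm (jsum h A q a) | A q. interlaced A q \<and> A \<noteq> {}}"
  then obtain A q where v: "v = norm (jsum h A q a)" and A: "interlaced A q" "A \<noteq> {}" by blast
  define xs where "xs = sorted_list_of_set A"
  have xs: "set xs = A" "distinct xs" "sorted_wrt (<) xs"
    using interlaced_finite[OF A(1)] by (auto simp: xs_def)
  have "jsum h A q a = (\<Sum>i<length xs. sc (a (xs ! i) - a (q (xs ! i))) (h (xs ! i)))"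
    unfolding jsum_def
    by (rule sum.reindex_bij_betw[OF bij_betw_nth[OF xs(2) refl xs(1)[symmetric]], symmetric])
  moreover have "0 < length xs" using xs(1) A(2) by auto
  moreover have "xs ! i < q (xs ! i)" if "i < length xs" for i
    by (rule interlaced_less[OF A(1)]) (use that xs(1) nth_mem in blast)
  moreover have "q (xs ! i) < xs ! Suc i" if "Suc i < length xs" for i
  proof (rule interlaced_next[OF A(1)])
    show "xs ! i \<in> A" "xs ! Suc i \<in> A" using that unfolding xs(1)[symmetric] by simp_all
    show "xs ! i < xs ! Suc i" using sorted_wrt_nth_less[OF xs(3) lessI that] .
  qed
  ultimately show "v \<in> J_values sc h a"
    unfolding J_values_def v
    by (intro CollectI exI[of _ "length xs"] exI[of _ "\<lambda>i. xs ! i"] exI[of _ "\<lambda>i. q (xs ! i)"]) simp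
qed

lemma jsum_add: "jsum h A q (a + b) = jsum h A q a + jsum h A q b"
  unfolding jsum_def sum.distrib[symmetric] scale_left_distrib[symmetric]
  by (rule sum.cong) (simp_all add: diff_add_eq diff_diff_eq add.assoc add_diff_eq)

lemma jsum_scale: "jsum h A q (fscale c a) = sc c (jsum h A q a)"
  unfolding jsum_def fscale_def scale_sum_right scale_scale right_diff_distrib ..

lemma jsum_diff: "jsum h A q (a - b) = jsum h A q a - jsum h A q b"
  unfolding jsum_def sum_subtractf[symmetric] scale_left_diff_distrib[symmetric]
  by (rule sum.cong) (simp_all add: algebra_simps)

lemma jsum_union: "finite A \<Longrightarrow> finite B \<Longrightarrow> A \<inter> B = {} \<Longrightarrow> jsum h (A \<union> B) q a = jsum h A q a + jsum h B q a"
  unfolding jsum_def by (rule sum.union_disjoint)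

lemma jsum_cong: "(\<And>p. p \<in> A \<Longrightarrow> a p - a (q p) = b p - b (q p)) \<Longrightarrow> jsum h A q a = jsum h A q b"
  unfolding jsum_def by (rule sum.cong) auto

end

definition cut_below :: "nat \<Rightarrow> (nat \<Rightarrow> 'k::zero) \<Rightarrow> nat \<Rightarrow> 'k" where
  "cut_below N a = (\<lambda>j. if j < N then 0 else a j)"

section \<open>The J-norm, truncations and tails\<close>

context reflexive_schauder_space
begin

text \<open>A bound on the J-norm that makes sense for sequences outside J as well. Such sequences,
  with a limit other than zero, arise as pointwise limits of elements of the unit ball.\<close>

definition jbound :: "(nat \<Rightarrow> 'k) \<Rightarrow> real \<Rightarrow> bool" where
  "jbound a B \<longleftrightarrow> (\<forall>A q. interlaced A q \<longrightarrow> norm (jsum h A q a) \<le> B)"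

abbreviation J :: "('k, nat \<Rightarrow> 'k) nspace" where "J \<equiv> J_space sc h"

lemma jbound_nonneg: "jbound a B \<Longrightarrow> 0 \<le> B"
  unfolding jbound_def using interlaced_empty by (metis norm_ge_zero order_trans)

lemma jboundD: "jbound a B \<Longrightarrow> interlaced A q \<Longrightarrow> norm (jsum h A q a) \<le> B"
  by (simp add: jbound_def)

lemma jbound_J_values: "jbound a B \<longleftrightarrow> (\<forall>v\<in>J_values sc h a. v \<le> B)"
proof
  assume *: "\<forall>v\<in>J_values sc h a. v \<le> B"
  have ne: "norm (jsum h A q a) \<le> B" if "interlaced A q" "A \<noteq> {}" for A q
    using * that unfolding J_values_interlaced by blast
  have "0 \<le> B"
    using order_trans[OF norm_ge_zero ne[OF interlaced_singleton[of 0 1]]] by simp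
  show "jbound a B"
    unfolding jbound_def
  proof (intro allI impI)
    fix A q assume "interlaced A q"
    then show "norm (jsum h A q a) \<le> B"
      using ne[of A q] \<open>0 \<le> B\<close> by (cases "A = {}") (simp_all add: jsum_def)
  qed
next
  assume "jbound a B"
  then show "\<forall>v\<in>J_values sc h a. v \<le> B"
    unfolding J_values_interlaced jbound_def by blast
qed

lemma J_values_nonempty: "J_values sc h a \<noteq> {}"
proof -
  have "interlaced {0} (\<lambda>_. 1)" by (simp add: interlaced_def)
  then show ?thesis unfolding J_values_interlaced by blast
qed

lemma J_pts: "a \<in> pts J \<longleftrightarrow> a \<longlonglongrightarrow> 0 \<and> (\<exists>B. jbound a B)"
  by (simp add: J_space_def jbound_J_values bdd_above_def)

lemma J_smult: "smult J = fscale"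
  by (simp add: J_space_def)

lemma J_nrm_le: "jbound a B \<Longrightarrow> nrm J a \<le> B"
  by (simp add: J_space_def jbound_J_values cSup_least[OF J_values_nonempty])

lemma jbound_nrm: "a \<in> pts J \<Longrightarrow> jbound a (nrm J a)"
  by (simp add: J_space_def jbound_J_values cSup_upper)

lemma J_nrm_nonneg: "a \<in> pts J \<Longrightarrow> 0 \<le> nrm J a"
  using jbound_nrm jbound_nonneg by blast

lemma jbound_add: "jbound a B \<Longrightarrow> jbound b B' \<Longrightarrow> jbound (a + b) (B + B')"
  unfolding jbound_def jsum_add by (blast intro: add_mono norm_triangle_le)

lemma jbound_diff: "jbound a B \<Longrightarrow> jbound b B' \<Longrightarrow> jbound (a - b) (B + B')"
  unfolding jbound_def jsum_diff by (blast intro: add_mono norm_triangle_le_diff)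

lemma jbound_scale: "jbound a B \<Longrightarrow> jbound (fscale c a) (norm c * B)"
  unfolding jbound_def jsum_scale norm_sc by (simp add: mult_left_mono)

lemma jbound_mono: "jbound a B \<Longrightarrow> B \<le> B' \<Longrightarrow> jbound a B'"
  unfolding jbound_def by (meson order_trans)

lemma J_add: "a \<in> pts J \<Longrightarrow> b \<in> pts J \<Longrightarrow> a + b \<in> pts J"
proof -
  assume a: "a \<in> pts J" "b \<in> pts J"
  then have "(\<lambda>j. a j + b j) \<longlonglongrightarrow> 0 + 0" unfolding J_pts by (intro tendsto_add) auto
  then show ?thesis using a jbound_add[of a _ b] unfolding J_pts plus_fun_def by auto
qed

lemma J_scale: "a \<in> pts J \<Longrightarrow> fscale c a \<in> pts J"
proof -
  assume a: "a \<in> pts J"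
  then have "(\<lambda>j. c * a j) \<longlonglongrightarrow> 0" unfolding J_pts by (intro tendsto_mult_right_zero) auto
  then show ?thesis using a jbound_scale[of a _ c] unfolding J_pts fscale_def by auto
qed

lemma J_diff: "a \<in> pts J \<Longrightarrow> b \<in> pts J \<Longrightarrow> a - b \<in> pts J"
proof -
  assume a: "a \<in> pts J" "b \<in> pts J"
  have eq: "a - b = a + fscale (-1) b" by (simp add: fscale_def fun_eq_iff)
  show ?thesis unfolding eq by (rule J_add[OF a(1) J_scale[OF a(2)]])
qed

lemma J_nrm_scale: "a \<in> pts J \<Longrightarrow> nrm J (fscale c a) \<le> norm c * nrm J a"
  using J_nrm_le jbound_scale jbound_nrm by blast

lemma jbound_increment: "jbound a B \<Longrightarrow> norm (a p - a q) \<le> B"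
proof -
  assume B: "jbound a B"
  have *: "norm (a p - a q) \<le> B" if "p < q" for p q
    using jboundD[OF B interlaced_singleton[OF that]] by (simp add: jsum_def norm_sc norm_h)
  show ?thesis
    using *[of p q] *[of q p] jbound_nonneg[OF B]
    by (cases p q rule: linorder_cases) (auto simp: norm_minus_commute)
qed

lemma J_coord: "a \<in> pts J \<Longrightarrow> norm (a j) \<le> nrm J a"
proof -
  assume a: "a \<in> pts J"
  then have "(\<lambda>q. a j - a q) \<longlonglongrightarrow> a j - 0" unfolding J_pts by (intro tendsto_intros) auto
  then have "(\<lambda>q. norm (a j - a q)) \<longlonglongrightarrow> norm (a j)" using tendsto_norm by fastforce
  then show ?thesis
    by (rule LIMSEQ_le_const2) (use jbound_increment[OF jbound_nrm[OF a]] in auto)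
qed

text \<open>Pairs beyond \<open>N\<close> are unaffected and pairs below \<open>N\<close> contribute
  nothing. By interlacing at most one pair straddles \<open>N\<close>, and it costs the modulus of a
  single coordinate \<open>a (q p)\<close>.\<close>

lemma jsum_cut_below:
  assumes A: "interlaced A q" and b: "\<And>j. j \<ge> N \<Longrightarrow> norm (a j) \<le> b" "0 \<le> b"
  shows "norm (jsum h A q (cut_below N a)) \<le> b + norm (jsum h {p\<in>A. N \<le> p} q a)"
proof -
  define A1 where "A1 = {p\<in>A. p < N}"
  define A2 where "A2 = {p\<in>A. N \<le> p}"
  have fin: "finite A" by (rule interlaced_finite[OF A])
  have "A = A1 \<union> A2" by (auto simp: A1_def A2_def)
  then have split: "jsum h A q (cut_below N a) = jsum h A1 q (cut_below N a) + jsum h A2 q (cut_below N a)"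
    using jsum_union[of A1 A2] fin by (metis (no_types, lifting) A1_def A2_def disjoint_iff finite_Un mem_Collect_eq not_le)
  have "jsum h A2 q (cut_below N a) = jsum h A2 q a"
    by (rule jsum_cong) (use interlaced_less[OF A] in \<open>fastforce simp: A2_def cut_below_def\<close>)
  moreover have "norm (jsum h A1 q (cut_below N a)) \<le> b"
  proof (cases "\<exists>p\<in>A1. N \<le> q p")
    case False
    then have "jsum h A1 q (cut_below N a) = 0"
      unfolding jsum_def by (intro sum.neutral) (auto simp: A1_def cut_below_def)
    then show ?thesis using b(2) by simp
  next
    case True
    then obtain p where p: "p \<in> A1" "N \<le> q p" by blast
    have others: "q p' < N" if "p' \<in> A1" "p' \<noteq> p" for p'
      using interlaced_next[OF A, of p p'] interlaced_next[OF A, of p' p] p that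
      by (cases p p' rule: linorder_cases) (auto simp: A1_def)
    have "jsum h A1 q (cut_below N a) = (\<Sum>p'\<in>{p}. sc (cut_below N a p' - cut_below N a (q p')) (h p'))"
      unfolding jsum_def
      by (rule sum.mono_neutral_right) (use p others fin in \<open>auto simp: A1_def cut_below_def\<close>)
    then show ?thesis using p b(1)[of "q p"] by (simp add: A1_def cut_below_def norm_sc norm_h)
  qed
  ultimately show ?thesis
    unfolding split A2_def[symmetric] by (intro norm_triangle_le) simp
qed

lemma jbound_cut_below:
  assumes "jbound a B" "\<And>j. j \<ge> N \<Longrightarrow> norm (a j) \<le> b" "0 \<le> b"
  shows "jbound (cut_below N a) (b + B)"
  unfolding jbound_def
proof (intro allI impI)
  fix A q assume A: "interlaced A q"
  have "norm (jsum h {p \<in> A. N \<le> p} q a) \<le> B"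
    by (rule jboundD[OF assms(1) interlaced_subset[OF A]]) auto
  then show "norm (jsum h A q (cut_below N a)) \<le> b + B"
    using jsum_cut_below[where a = a and N = N, OF A assms(2,3)] by simp
qed

lemma cut_below_tendsto: "(a \<longlongrightarrow> l) sequentially \<Longrightarrow> cut_below N a \<longlonglongrightarrow> l"
  by (rule Lim_transform_eventually)
    (auto simp: cut_below_def intro: eventually_mono[OF eventually_ge_at_top[of N]])

lemma J_cut_below: "a \<in> pts J \<Longrightarrow> cut_below N a \<in> pts J \<and> nrm J (cut_below N a) \<le> 2 * nrm J a"
proof -
  assume a: "a \<in> pts J"
  have b: "jbound (cut_below N a) (2 * nrm J a)"
    using jbound_cut_below[OF jbound_nrm[OF a] J_coord[OF a] J_nrm_nonneg[OF a]] by simp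
  then show ?thesis using a J_nrm_le[OF b] cut_below_tendsto unfolding J_pts by blast
qed

text \<open>
  Otherwise infinitely many far out sums of norm at least \<open>e\<close> concatenate to a divergent series with
  bounded partial sums.
\<close>

lemma jsum_tail_small:
  assumes B: "jbound a B" and e: "e > 0"
  shows "\<exists>N. \<forall>A q. interlaced A q \<longrightarrow> A \<subseteq> {N..} \<longrightarrow> norm (jsum h A q a) \<le> e"
proof (rule ccontr)
  assume "\<not> ?thesis"
  then have "\<exists>A q. interlaced A q \<and> A \<subseteq> {N..} \<and> norm (jsum h A q a) > e" for N
    by (meson not_le)
  then obtain A q where A: "\<And>N. interlaced (A N) (q N)" "\<And>N. A N \<subseteq> {N..}"
    "\<And>N. norm (jsum h (A N) (q N) a) > e"
    by metis
  have fin: "finite (A N)" for N using A(1) by (rule interlaced_finite)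
  \<comment> \<open>A bound beyond all left and right ends of the sum chosen for \<open>N\<close>.
    Restarting the choice at each bound, along the iterates \<open>n\<close>, keeps the chosen sums
    apart.\<close>
  define m where "m N = Suc (Max (insert N (q N ` A N)))" for N
  have m: "N < m N" for N using fin[of N] unfolding m_def by (meson Max_ge finite_imageI finite_insert insertI1 le_imp_less_Suc)
  have mq: "q N p < m N" if "p \<in> A N" for N p
    using fin[of N] that unfolding m_def by (intro le_imp_less_Suc Max_ge) auto
  have mA: "p < m N" if "p \<in> A N" for N p using mq[OF that] interlaced_less[OF A(1) that] by simp
  define n where "n k = (m ^^ k) 0" for k
  have nS: "n (Suc k) = m (n k)" for k by (simp add: n_def)
  have n: "strict_mono n" by (rule strict_monoI_Suc) (simp add: nS m)
  have n0: "n 0 = 0" by (simp add: n_def)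
  \<comment> \<open>The start of the block containing \<open>j\<close>; it tells which of the chosen
    sums \<open>j\<close> could belong to, so that \<open>S\<close> and \<open>q'\<close> are the
    concatenation of all of them.\<close>
  define I where "I j = n (block_index n j)" for j
  have I_le: "I j \<le> j" "j < m (I j)" for j
    using block_index[OF n, of j] by (simp_all add: n0 I_def nS)
  have I_eq: "I j = n k" if "j \<in> A (n k)" for j k
    using block_index_eq[OF n, of k j] A(2)[of "n k"] that mA[OF that] by (auto simp: I_def nS)
  define S where "S = {j. j \<in> A (I j)}"
  define q' where "q' j = q (I j) j" for j
  have inter: "interlaced (S \<inter> {..<l}) q'" for l
    unfolding interlaced_def
  proof (intro conjI ballI impI)
    fix p assume p: "p \<in> S \<inter> {..<l}"
    then show "p < q' p" using interlaced_less[OF A(1)] by (simp add: S_def q'_def)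
    fix p' assume p': "p' \<in> S \<inter> {..<l}" and less: "p < p'"
    show "q' p < p'"
    proof (cases "I p = I p'")
      case True
      then show ?thesis using interlaced_next[OF A(1), of p "I p"] p p' less by (simp add: S_def q'_def)
    next
      case False
      have "block_index n p < block_index n p'"
      proof (rule ccontr)
        assume "\<not> ?thesis"
        then have "block_index n p' < block_index n p" using False by (cases "block_index n p = block_index n p'") (auto simp: I_def)
        then have "n (Suc (block_index n p')) \<le> n (block_index n p)" using n by (simp add: strict_mono_less_eq)
        then show False using I_le[of p] I_le[of p'] less by (simp add: I_def nS)
      qed
      then have "n (Suc (block_index n p)) \<le> n (block_index n p')" using n by (simp add: strict_mono_less_eq)
      then have "m (I p) \<le> p'" using I_le(1)[of p'] by (simp add: I_def nS)
      moreover have "q' p < m (I p)" using mq p by (simp add: S_def q'_def)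
      ultimately show ?thesis by simp
    qed
  qed auto
  \<comment> \<open>The partial sums of this series are J-sums of \<open>a\<close> over initial
    parts of the concatenation, so \<open>B\<close> bounds them all. Convergence then contradicts
    the size of the individual blocks.\<close>
  define b where "b j = (if j \<in> S then a j - a (q' j) else 0)" for j
  have "(\<Sum>j<l. sc (b j) (h j)) = jsum h (S \<inter> {..<l}) q' a" for l
    unfolding jsum_def by (rule sum.mono_neutral_cong_right) (auto simp: b_def)
  then have "norm (\<Sum>j<l. sc (b j) (h j)) \<le> B" for l using jboundD[OF B inter] by simp
  then have "summable (\<lambda>j. sc (b j) (h j))" by (rule boundedly_complete)
  then obtain L where L: "\<And>i j. i \<ge> L \<Longrightarrow> norm (\<Sum>j=i..<j. sc (b j) (h j)) < e"
    using e unfolding summable_Cauchy by meson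
  have "L \<le> n L" using strict_mono_imp_increasing[OF n] by simp
  have "(\<Sum>j=n L..<n (Suc L). sc (b j) (h j)) = jsum h (A (n L)) (q (n L)) a"
    unfolding jsum_def
  proof (rule sum.mono_neutral_cong_right)
    show "A (n L) \<subseteq> {n L..<n (Suc L)}" using A(2)[of "n L"] mA[of _ "n L"] by (auto simp: nS)
    show "\<forall>j\<in>{n L..<n (Suc L)} - A (n L). sc (b j) (h j) = 0"
      using block_index_eq[OF n, of L] by (auto simp: b_def S_def I_def)
    show "sc (b j) (h j) = sc (a j - a (q (n L) j)) (h j)" if "j \<in> A (n L)" for j
      using I_eq[OF that] that by (simp add: b_def S_def q'_def)
  qed auto
  then show False using A(3)[of "n L"] L[OF \<open>L \<le> n L\<close>, of "n (Suc L)"] by simp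
qed

text \<open>This gives density of the finitely supported sequences in J. The straddling pair is
  controlled by \<open>a \<longlonglongrightarrow> 0\<close> and the pairs beyond the cut by
  \<open>jsum_tail_small\<close>, at \<open>e / 2\<close> each.\<close>

lemma J_cut_below_small: "a \<in> pts J \<Longrightarrow> e > 0 \<Longrightarrow> \<exists>N. nrm J (cut_below N a) \<le> e"
proof -
  assume a: "a \<in> pts J" and e: "e > 0"
  then obtain N1 where N1: "\<And>A q. interlaced A q \<Longrightarrow> A \<subseteq> {N1..} \<Longrightarrow> norm (jsum h A q a) \<le> e / 2"
    using jsum_tail_small[OF jbound_nrm[OF a], of "e / 2"] by auto
  have "a \<longlonglongrightarrow> 0" using a by (simp add: J_pts)
  then have "\<forall>\<^sub>F j in sequentially. norm (a j) < e / 2" using e by (auto dest: tendstoD[of _ _ _ "e / 2"])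
  then obtain N2 where N2: "\<And>j. j \<ge> N2 \<Longrightarrow> norm (a j) < e / 2" by (auto simp: eventually_sequentially)
  have "jbound (cut_below (max N1 N2) a) e"
    unfolding jbound_def
  proof (intro allI impI)
    fix A q assume A: "interlaced A q"
    have "norm (jsum h A q (cut_below (max N1 N2) a)) \<le> e / 2 + norm (jsum h {p\<in>A. max N1 N2 \<le> p} q a)"
      by (rule jsum_cut_below[OF A]) (use N2 e in \<open>auto intro: less_imp_le\<close>)
    also have "norm (jsum h {p\<in>A. max N1 N2 \<le> p} q a) \<le> e / 2"
      by (rule N1[OF interlaced_subset[OF A]]) auto
    finally show "norm (jsum h A q (cut_below (max N1 N2) a)) \<le> e" by simp
  qed
  then show ?thesis using J_nrm_le by blast
qed

text \<open>A one-element \<open>A\<close> gives the norm of a single increment, so the tail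
  estimate contains the Cauchy condition. The limit may differ from zero.\<close>

lemma jbound_convergent:
  assumes B: "jbound a B"
  shows "convergent a"
proof -
  have "Cauchy a"
  proof (rule CauchyI')
    fix e :: real assume e: "e > 0"
    then obtain N where N: "\<And>A q. interlaced A q \<Longrightarrow> A \<subseteq> {N..} \<Longrightarrow> norm (jsum h A q a) \<le> e / 2"
      using jsum_tail_small[OF B, of "e / 2"] by auto
    have "dist (a p) (a q) < e" if "p \<ge> N" "p < q" for p q
      using N[OF interlaced_singleton[OF that(2)]] that(1) e by (simp add: jsum_def norm_sc norm_h dist_norm)
    then show "\<exists>N. \<forall>p\<ge>N. \<forall>q>p. dist (a p) (a q) < e" by blast
  qed
  then show ?thesis by (rule Cauchy_convergent)
qed

end

section \<open>Functionals on J(h)\<close>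

text \<open>Alaoglu's theorem in the topology of pointwise convergence: linearity is a closed
  condition inside a product of compact intervals.\<close>

lemma compact_linear_functionals:
  "compact {u :: 'e::real_normed_vector \<Rightarrow> real. linear u \<and> (\<forall>x. \<bar>u x\<bar> \<le> norm x)}"
proof -
  have *: "{u :: 'e \<Rightarrow> real. linear u \<and> (\<forall>x. \<bar>u x\<bar> \<le> norm x)} =
      {u. \<forall>x. u x \<in> cball 0 (norm x)} \<inter> ((\<Inter>x y. {u. u (x + y) = u x + u y}) \<inter> (\<Inter>r x. {u. u (r *\<^sub>R x) = r * u x}))"
    by (auto simp: linear_iff)
  have "compact {u :: 'e \<Rightarrow> real. \<forall>x. u x \<in> cball 0 (norm x)}"
    by (rule compact_product) simp
  moreover have "closed {u :: 'e \<Rightarrow> real. u (x + y) = u x + u y}" for x y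
    by (intro closed_Collect_eq continuous_intros continuous_on_product_coordinates)
  moreover have "closed {u :: 'e \<Rightarrow> real. u (r *\<^sub>R x) = r * u x}" for r x
    by (intro closed_Collect_eq continuous_intros continuous_on_product_coordinates)
  ultimately show ?thesis
    unfolding * by (intro compact_Int_closed closed_Int closed_INT ballI) auto
qed

text \<open>Joint continuity holds because each \<open>z k\<close> varies in the norm topology and
  all functionals are 1-Lipschitz.\<close>

lemma continuous_on_evaluation:
  fixes k :: 'i
  assumes R: "\<And>z u. (z, u) \<in> R \<Longrightarrow> linear u \<and> (\<forall>x. \<bar>u x\<bar> \<le> norm x)"
  shows "continuous_on R (\<lambda>(z :: 'i \<Rightarrow> 'e::real_normed_vector, u :: 'e \<Rightarrow> real). u (z k))"
  unfolding continuous_on_def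
proof
  fix w0 assume "w0 \<in> R"
  let ?F = "at w0 within R"
  have "continuous_on UNIV (\<lambda>w :: ('i \<Rightarrow> 'e) \<times> ('e \<Rightarrow> real). snd w (fst w0 k))"
    by (rule continuous_on_compose2[OF continuous_on_product_coordinates continuous_on_snd[OF continuous_on_id]]) auto
  then have 1: "((\<lambda>w. snd w (fst w0 k)) \<longlongrightarrow> snd w0 (fst w0 k)) ?F"
    unfolding continuous_on_def using tendsto_within_subset by blast
  have "continuous_on UNIV (\<lambda>w :: ('i \<Rightarrow> 'e) \<times> ('e \<Rightarrow> real). fst w k)"
    by (rule continuous_on_compose2[OF continuous_on_product_coordinates continuous_on_fst[OF continuous_on_id]]) auto
  then have "((\<lambda>w. fst w k) \<longlongrightarrow> fst w0 k) ?F"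
    unfolding continuous_on_def using tendsto_within_subset by blast
  then have "((\<lambda>w. norm (fst w k - fst w0 k)) \<longlongrightarrow> 0) ?F"
    using LIM_zero tendsto_norm_zero by blast
  moreover have "\<forall>\<^sub>F w in ?F. norm (snd w (fst w k) - snd w (fst w0 k)) \<le> norm (fst w k - fst w0 k)"
    unfolding eventually_at_topological
  proof (intro exI[of _ UNIV] conjI ballI impI open_UNIV UNIV_I)
    fix w assume "w \<in> R"
    then have u: "linear (snd w)" "\<And>x. \<bar>snd w x\<bar> \<le> norm x" using R[of "fst w" "snd w"] by auto
    show "norm (snd w (fst w k) - snd w (fst w0 k)) \<le> norm (fst w k - fst w0 k)"
      using u(2)[of "fst w k - fst w0 k"] by (simp add: linear_diff[OF u(1)])
  qed
  ultimately have "((\<lambda>w. snd w (fst w k) - snd w (fst w0 k)) \<longlongrightarrow> 0) ?F"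
    by (rule Lim_null_comparison[rotated])
  from tendsto_add[OF this 1]
  show "((\<lambda>(z, u). u (z k)) \<longlongrightarrow> (case w0 of (z, u) \<Rightarrow> u (z k))) ?F"
    by (simp add: case_prod_unfold)
qed

context reflexive_schauder_space
begin

abbreviation jdual :: "((nat \<Rightarrow> 'k) \<Rightarrow> 'k) set" where
  "jdual \<equiv> pts (dual_space J)"

lemma jdual_iff: "f \<in> jdual \<longleftrightarrow>
    (\<forall>a\<in>pts J. \<forall>b\<in>pts J. f (a + b) = f a + f b) \<and> (\<forall>c. \<forall>a\<in>pts J. f (fscale c a) = c * f a) \<and>
    (\<exists>B. \<forall>a\<in>pts J. norm (f a) \<le> B * nrm J a) \<and> (\<forall>a. a \<notin> pts J \<longrightarrow> f a = 0)"
  unfolding dual_space_def bounded_op_def by (simp add: type_space_def J_smult)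

lemma zero_in_J: "0 \<in> pts J"
proof -
  have "jbound 0 0" by (simp add: jbound_def jsum_def)
  then show ?thesis unfolding J_pts by (auto simp: zero_fun_def)
qed

lemma jdualD:
  assumes "f \<in> jdual"
  shows "a \<in> pts J \<Longrightarrow> b \<in> pts J \<Longrightarrow> f (a + b) = f a + f b" "a \<in> pts J \<Longrightarrow> f (fscale c a) = c * f a" "f 0 = 0"
    "a \<in> pts J \<Longrightarrow> b \<in> pts J \<Longrightarrow> f (a - b) = f a - f b"
proof -
  show add: "f (a + b) = f a + f b" if "a \<in> pts J" "b \<in> pts J" for a b
    using assms that by (simp add: jdual_iff)
  show scale: "f (fscale c a) = c * f a" if "a \<in> pts J" for c a using assms that by (simp add: jdual_iff)
  show "f 0 = 0" using add[OF zero_in_J zero_in_J] by simp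
  show "f (a - b) = f a - f b" if "a \<in> pts J" "b \<in> pts J" for a b
    using add[OF J_diff[OF that] that(2)] by simp
qed

lemma jdual_bound:
  assumes "f \<in> jdual"
  obtains B where "B > 0" "\<And>a. a \<in> pts J \<Longrightarrow> norm (f a) \<le> B * nrm J a"
proof -
  obtain B where B: "\<And>a. a \<in> pts J \<Longrightarrow> norm (f a) \<le> B * nrm J a" using assms unfolding jdual_iff by blast
  have "norm (f a) \<le> (\<bar>B\<bar> + 1) * nrm J a" if "a \<in> pts J" for a
    using B[OF that] J_nrm_nonneg[OF that] mult_right_mono[of B "\<bar>B\<bar> + 1" "nrm J a"] by linarith
  then show thesis using that[of "\<bar>B\<bar> + 1"] by auto
qed

lemma continuous_on_coef: "continuous_on S (\<lambda>x. coef x j)"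
proof -
  obtain K where "\<And>x j. norm (coef x j) \<le> K * norm x" using coef_bounded by blast
  then have "bounded_linear (\<lambda>x. coef x j)"
    by (intro bounded_linear_intro[of _ K]) (simp_all add: coef_add coef_scaleR mult.commute)
  then show ?thesis by (rule linear_continuous_on)
qed

lemma coef_jsum: "finite A \<Longrightarrow> coef (jsum h A q a) j = (if j \<in> A then a j - a (q j) else 0)"
proof -
  assume A: "finite A"
  have "coef (jsum h A q a) j = (\<Sum>p\<in>A. if p = j then a p - a (q p) else 0)"
    unfolding jsum_def coef_sum by (intro sum.cong) (auto simp: coef_sc coef_h)
  then show ?thesis using A by simp
qed

text \<open>A finitely supported sequence has finitely many values, hence finitely many increments,
  and only the indices below \<open>M\<close> contribute. Finiteness makes these sets of vectors
  norm compact, so that Tychonoff's theorem and joint continuity of evaluation apply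
  together.\<close>

lemma finite_block_jsums:
  assumes supp: "\<And>j. M \<le> j \<Longrightarrow> a j = 0"
  shows "finite {jsum h A q a | A q. interlaced A q}"
proof -
  define S where "S = insert 0 (a ` {..<M})"
  have aS: "a j \<in> S" for j using supp[of j] by (cases "j < M") (auto simp: S_def)
  define D where "D = (\<lambda>(x, y). x - y) ` (S \<times> S)"
  have D: "a i - a j \<in> D" for i j
    unfolding D_def by (rule image_eqI[of _ _ "(a i, a j)"]) (use aS in auto)
  have D0: "0 \<in> D" using D[of 0 0] by simp
  have "finite D" by (simp add: D_def S_def)
  then have "finite ((\<lambda>\<alpha>. \<Sum>j<M. sc (\<alpha> j) (h j)) ` (PiE {..<M} (\<lambda>_. D)))"
    by (intro finite_imageI finite_PiE) auto
  moreover have "jsum h A q a \<in> (\<lambda>\<alpha>. \<Sum>j<M. sc (\<alpha> j) (h j)) ` (PiE {..<M} (\<lambda>_. D))" if A: "interlaced A q" for A q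
  proof (rule image_eqI)
    let ?\<alpha> = "\<lambda>j\<in>{..<M}. if j \<in> A then a j - a (q j) else 0"
    show "?\<alpha> \<in> PiE {..<M} (\<lambda>_. D)" using D D0 by (intro PiE_I) auto
    have "jsum h A q a = (\<Sum>j\<in>A \<inter> {..<M}. sc (a j - a (q j)) (h j))"
      unfolding jsum_def
    proof (rule sum.mono_neutral_right)
      show "\<forall>i\<in>A - A \<inter> {..<M}. sc (a i - a (q i)) (h i) = 0"
      proof
        fix i assume "i \<in> A - A \<inter> {..<M}"
        then have "M \<le> i" "M \<le> q i" using interlaced_less[OF A, of i] by auto
        then show "sc (a i - a (q i)) (h i) = 0" using supp by simp
      qed
    qed (use interlaced_finite[OF A] in auto)
    also have "\<dots> = (\<Sum>j<M. sc (?\<alpha> j) (h j))"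
      by (rule sum.mono_neutral_cong_left) auto
    finally show "jsum h A q a = (\<Sum>j<M. sc (?\<alpha> j) (h j))" .
  qed
  ultimately show ?thesis by (auto intro: finite_subset)
qed

text \<open>
  If a functional were bounded away from zero on a bounded block sequence, so would be all convex
  combinations of the block sequence.
  The vectors \<open>jsum h A q (x k)\<close> are, for all choices of \<open>A\<close> and \<open>q\<close>, sequences in a compact set of weakly
  null sequences of E, so some convex combination has small norm in J.
\<close>

lemma block_sequence_convex_small:
  assumes n: "strict_mono n" and xJ: "\<And>k. x k \<in> pts J" and x0: "\<And>k j. j < n k \<or> n (Suc k) \<le> j \<Longrightarrow> x k j = 0"
    and xb: "\<And>k. nrm J (x k) \<le> M" and e: "e > 0"
  shows "\<exists>m c. (\<forall>k. 0 \<le> c k) \<and> (\<Sum>k<m. c k) = 1 \<and>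
    (\<forall>A q. interlaced A q \<longrightarrow> norm (\<Sum>k<m. c k *\<^sub>R jsum h A q (x k)) \<le> e)"
proof -
  define S where "S k = {jsum h A q (x k) | A q. interlaced A q}" for k
  have finS: "finite (S k)" for k unfolding S_def by (rule finite_block_jsums[of "n (Suc k)"]) (use x0 in auto)
  have Sb: "norm v \<le> M" if "v \<in> S k" for v k
    using that jboundD[OF jbound_mono[OF jbound_nrm[OF xJ] xb]] by (auto simp: S_def)
  \<comment> \<open>The second condition is a closed trace of the fact that one pair
    \<open>A\<close>, \<open>q\<close> serves all \<open>k\<close>. For \<open>j < n k\<close> with
    \<open>k < l\<close>, both \<open>x k\<close> and \<open>x l\<close> vanish at \<open>j\<close>,
    so a nonzero coefficient can only come from \<open>q j\<close>, which lies in at most one block.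
    This makes every coordinate of a member of \<open>Z\<close> eventually zero.\<close>
  define Z where "Z = {z. \<forall>k. z k \<in> S k} \<inter>
      (\<Inter>(j, k, l)\<in>{(j, k, l). j < n k \<and> k < l}. {z. coef (z k) j = 0 \<or> coef (z l) j = 0})"
  define U where "U = {u :: 'e \<Rightarrow> real. linear u \<and> (\<forall>x. \<bar>u x\<bar> \<le> norm x)}"
  have "compact Z"
    unfolding Z_def
  proof (intro compact_Int_closed closed_INT ballI)
    show "compact {z. \<forall>k. z k \<in> S k}" by (rule compact_product) (simp add: finS finite_imp_compact)
    have cont: "continuous_on UNIV (\<lambda>z :: nat \<Rightarrow> 'e. coef (z k) j)" for k j
      by (rule continuous_on_compose2[OF continuous_on_coef[of UNIV] continuous_on_product_coordinates]) auto
    show "closed (case t of (j, k, l) \<Rightarrow> {z. coef (z k) j = 0 \<or> coef (z l) j = 0})" for t :: "nat \<times> nat \<times> nat"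
      by (cases t) (auto intro!: closed_Collect_disj closed_Collect_eq continuous_on_const cont)
  qed
  then have compact: "compact (Z \<times> U)"
    unfolding U_def by (intro compact_Times compact_linear_functionals)
  have Zb: "norm (z k) \<le> M" if "z \<in> Z" for z k using that Sb[of "z k" k] by (auto simp: Z_def)
  have null: "(\<lambda>k. u (z k)) \<longlonglongrightarrow> 0" if z: "z \<in> Z" and u: "u \<in> U" for z u
  proof (rule coordinatewise_null_imp_weakly_null)
    show "norm (z k) \<le> M" for k by (rule Zb[OF z])
    show "linear u" "\<bar>u x\<bar> \<le> norm x" for x using u by (auto simp: U_def)
    show "(\<lambda>k. coef (z k) j) \<longlonglongrightarrow> 0" for j
    proof (cases "\<exists>k. j < n k \<and> coef (z k) j \<noteq> 0")
      case True
      then obtain k where k: "j < n k" "coef (z k) j \<noteq> 0" by blast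
      have "coef (z l) j = 0" if "l > k" for l using z k that by (auto simp: Z_def)
      then show ?thesis
        by (intro tendsto_eventually) (auto intro: eventually_mono[OF eventually_gt_at_top[of k]])
    next
      case False
      have "j < n l" if "l > j" for l using strict_mono_imp_increasing[OF n, of l] that by simp
      with False have "coef (z l) j = 0" if "l > j" for l using that by blast
      then show ?thesis
        by (intro tendsto_eventually) (auto intro: eventually_mono[OF eventually_gt_at_top[of j]])
    qed
  qed
  have "\<exists>m F. convex_comb (\<lambda>k (z, u). u (z k)) 0 m F \<and> (\<forall>w\<in>Z \<times> U. F w \<le> e)"
  proof (rule uniformly_small_convex_comb[OF compact _ _ _ e])
    show "continuous_on (Z \<times> U) (\<lambda>(z, u). u (z k))" for k
      by (rule continuous_on_evaluation) (auto simp: U_def)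
    show "\<bar>case w of (z, u) \<Rightarrow> u (z k)\<bar> \<le> M" if "w \<in> Z \<times> U" for k w
      using that Zb by (auto simp: U_def intro: order_trans)
    show "(\<lambda>k. case w of (z, u) \<Rightarrow> u (z k)) \<longlonglongrightarrow> 0" if "w \<in> Z \<times> U" for w
      using that null by auto
  qed
  then obtain m c where c: "\<And>k. 0 \<le> c k" "(\<Sum>k<m. c k) = 1"
    and small: "\<And>z u. z \<in> Z \<Longrightarrow> u \<in> U \<Longrightarrow> (\<Sum>k<m. c k * u (z k)) \<le> e"
    unfolding convex_comb_def by force
  have "norm (\<Sum>k<m. c k *\<^sub>R jsum h A q (x k)) \<le> e" if A: "interlaced A q" for A q
  proof -
    define z where "z k = jsum h A q (x k)" for k
    have "z \<in> Z"
    proof -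
      have "coef (z k) j = 0 \<or> coef (z l) j = 0" if jk: "j < n k" "k < l" for j k l
      proof -
        have kl: "n (Suc k) \<le> n l" "n k \<le> n l" using n jk(2) by (simp_all add: strict_mono_less_eq)
        have xj: "x k j = 0" "x l j = 0" using x0 jk(1) kl(2) by auto
        have "x k (q j) = 0 \<or> x l (q j) = 0"
          using x0[of "q j" k] x0[of "q j" l] kl(1) by (meson le_less_trans not_le order_less_le_trans)
        then show ?thesis using xj by (auto simp: z_def coef_jsum[OF interlaced_finite[OF A]])
      qed
      moreover have "z k \<in> S k" for k using A by (auto simp: z_def S_def)
      ultimately show ?thesis by (auto simp: Z_def)
    qed
    define v where "v = (\<Sum>k<m. c k *\<^sub>R z k)"
    \<comment> \<open>A norming functional of \<open>v\<close> yields a point of the compact set at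
      which the combination equals \<open>norm v\<close>.\<close>
    obtain u where u: "linear u" "\<And>x. \<bar>u x\<bar> \<le> norm x" "u v = norm v" using norming_functional[of v] by blast
    have "norm v = u v" using u(3) by simp
    also have "\<dots> = (\<Sum>k<m. c k * u (z k))"
      by (simp add: v_def linear_sum[OF u(1)] linear_scale[OF u(1)])
    also have "\<dots> \<le> e" by (rule small[OF \<open>z \<in> Z\<close>]) (use u in \<open>auto simp: U_def\<close>)
    finally show ?thesis by (simp add: v_def z_def)
  qed
  then show ?thesis using c by blast
qed

text \<open>This says that the unit vectors of J are shrinking. Its failure provides bounded vectors
  of finite support, arbitrarily far out, on which the real component of \<open>f\<close> is at
  least \<open>\<eta> / 2\<close>. Convex combinations keep this lower bound, while one of them has
  small norm by \<open>block_sequence_convex_small\<close>.\<close>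

lemma jdual_tail_small:
  assumes f: "f \<in> jdual" and \<eta>: "\<eta> > 0"
  shows "\<exists>N. \<forall>a\<in>pts J. (\<forall>j<N. a j = 0) \<longrightarrow> norm (f a) \<le> \<eta> * nrm J a"
proof (rule ccontr)
  assume "\<not> ?thesis"
  then have neg: "\<exists>a\<in>pts J. (\<forall>j<N. a j = 0) \<and> \<eta> * nrm J a < norm (f a)" for N by (meson not_le)
  obtain B where B: "B > 0" "\<And>a. a \<in> pts J \<Longrightarrow> norm (f a) \<le> B * nrm J a" using jdual_bound[OF f] by blast
  have "\<exists>x M. x \<in> pts J \<and> N < M \<and> (\<forall>j. j < N \<or> M \<le> j \<longrightarrow> x j = 0) \<and> nrm J x \<le> 3 \<and> \<eta> / 2 \<le> inner (f x) 1" for N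
  proof -
    obtain a where a: "a \<in> pts J" "\<And>j. j < N \<Longrightarrow> a j = 0" "\<eta> * nrm J a < norm (f a)" using neg by blast
    have fa: "norm (f a) > 0" using a(3) \<eta> J_nrm_nonneg[OF a(1)] by (smt (verit) mult_nonneg_nonneg)
    then have na: "nrm J a > 0" using B(2)[OF a(1)] J_nrm_nonneg[OF a(1)] by (cases "nrm J a = 0") auto
    define r where "r = norm (f a) / nrm J a"
    have r: "r > \<eta>" using a(3) na by (simp add: r_def field_simps)
    \<comment> \<open>This scalar divides \<open>a\<close> by its norm and at the same time rotates
      \<open>f a\<close>, so that \<open>f y = r\<close> is real and exceeds \<eta>. The later
      truncation may then cost \<open>\<eta> / 2\<close>.\<close>
    define c where "c = of_real r / f a"
    have nc: "norm c = 1 / nrm J a" using fa na by (simp add: c_def r_def norm_divide norm_mult)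
    define y where "y = fscale c a"
    have y: "y \<in> pts J" unfolding y_def by (rule J_scale[OF a(1)])
    have ny: "nrm J y \<le> 1" using J_nrm_scale[OF a(1), of c] nc na by (simp add: y_def)
    have fy: "f y = of_real r" using jdualD(2)[OF f a(1), of c] fa by (simp add: y_def c_def)
    obtain M where M: "nrm J (cut_below M y) \<le> \<eta> / (2 * B)"
      using J_cut_below_small[OF y, of "\<eta> / (2 * B)"] \<eta> B(1) by auto
    define x where "x = y - cut_below M y"
    note cut = J_cut_below[OF y, of M]
    have x: "x \<in> pts J" unfolding x_def using J_diff[OF y] cut by blast
    have "jbound x (nrm J y + nrm J (cut_below M y))"
      unfolding x_def using jbound_diff[OF jbound_nrm[OF y] jbound_nrm] cut by blast
    \<comment> \<open>The bound 3 is 1 for \<open>y\<close> plus 2 for its truncation.\<close>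
    then have nx: "nrm J x \<le> 3" using J_nrm_le[of x] ny cut by force
    have "f x = f y - f (cut_below M y)" unfolding x_def using jdualD(4)[OF f y] cut by blast
    then have "inner (f x) 1 = r - inner (f (cut_below M y)) 1"
      by (simp add: fy inner_diff_left of_real_def dot_square_norm)
    moreover have "norm (f (cut_below M y)) \<le> \<eta> / 2"
    proof -
      have "norm (f (cut_below M y)) \<le> B * nrm J (cut_below M y)" using B(2) cut by blast
      also have "\<dots> \<le> B * (\<eta> / (2 * B))" using M B(1) by (intro mult_left_mono) auto
      finally show ?thesis using B(1) by simp
    qed
    moreover have "\<bar>inner (f (cut_below M y)) 1\<bar> \<le> norm (f (cut_below M y))"
      using Cauchy_Schwarz_ineq2[of "f (cut_below M y)" 1] by simp
    ultimately have fx: "\<eta> / 2 \<le> inner (f x) 1" using r by (simp add: abs_le_iff)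
    \<comment> \<open>The maximum with \<open>Suc N\<close> puts the end of the support window
      strictly beyond its start, so that iterating \<open>M\<close> gives a strictly increasing
      sequence of blocks.\<close>
    have "x j = 0" if "j < N \<or> max M (Suc N) \<le> j" for j
      using that a(2) by (auto simp: x_def y_def cut_below_def fscale_def)
    then show ?thesis using x nx fx by (intro exI[of _ x] exI[of _ "max M (Suc N)"]) auto
  qed
  then obtain X M where X: "\<And>N. X N \<in> pts J" "\<And>N. N < M N" "\<And>N j. j < N \<or> M N \<le> j \<Longrightarrow> X N j = 0"
    "\<And>N. nrm J (X N) \<le> 3" "\<And>N. \<eta> / 2 \<le> inner (f (X N)) 1"
    by metis
  define n where "n k = (M ^^ k) 0" for k
  have nS: "n (Suc k) = M (n k)" for k by (simp add: n_def)
  have n: "strict_mono n" by (rule strict_monoI_Suc) (simp add: nS X(2))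
  define x where "x k = X (n k)" for k
  \<comment> \<open>With the bound \<open>B\<close> on \<open>f\<close>, a combination of norm at
    most \<open>e\<close> has \<open>f\<close>-value at most \<open>\<eta> / 4\<close>, below the
    \<open>\<eta> / 2\<close> that convexity preserves.\<close>
  define e where "e = \<eta> / (4 * B)"
  have e: "e > 0" using \<eta> B(1) by (simp add: e_def)
  have "\<exists>m c. (\<forall>k. 0 \<le> c k) \<and> (\<Sum>k<m. c k) = 1 \<and>
    (\<forall>A q. interlaced A q \<longrightarrow> norm (\<Sum>k<m. c k *\<^sub>R jsum h A q (x k)) \<le> e)"
  proof (rule block_sequence_convex_small[OF n _ _ _ e, of x 3])
    show "x k \<in> pts J" "nrm J (x k) \<le> 3" for k by (simp_all add: x_def X)
    show "x k j = 0" if "j < n k \<or> n (Suc k) \<le> j" for k j using X(3)[of j "n k"] that by (simp add: x_def nS)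
  qed
  then obtain m c where c: "\<And>k. 0 \<le> c k" "(\<Sum>k<m. c k) = 1"
    and small: "\<And>A q. interlaced A q \<Longrightarrow> norm (\<Sum>k<m. c k *\<^sub>R jsum h A q (x k)) \<le> e"
    by blast
  define y where "y l = (\<Sum>k<l. fscale (of_real (c k)) (x k))" for l
  have y: "y l \<in> pts J \<and> f (y l) = (\<Sum>k<l. of_real (c k) * f (x k)) \<and>
      (\<forall>A q. jsum h A q (y l) = (\<Sum>k<l. c k *\<^sub>R jsum h A q (x k)))" for l
  proof (induction l)
    case 0
    then show ?case using zero_in_J jdualD(3)[OF f] by (simp add: y_def jsum_def zero_fun_def)
  next
    case (Suc l)
    have xl: "x l \<in> pts J" by (simp add: x_def X)
    have eq: "y (Suc l) = y l + fscale (of_real (c l)) (x l)" by (simp add: y_def)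
    from Suc have yl: "y l \<in> pts J" by blast
    have "y (Suc l) \<in> pts J" unfolding eq by (rule J_add[OF yl J_scale[OF xl]])
    moreover have "f (y (Suc l)) = (\<Sum>k<Suc l. of_real (c k) * f (x k))"
      unfolding eq jdualD(1)[OF f yl J_scale[OF xl]] jdualD(2)[OF f xl] using Suc by simp
    moreover have "jsum h A q (y (Suc l)) = (\<Sum>k<Suc l. c k *\<^sub>R jsum h A q (x k))" for A q
      unfolding eq jsum_add jsum_scale sc_of_real using Suc by simp
    ultimately show ?case by blast
  qed
  have "jbound (y m) e" unfolding jbound_def using y small by simp
  then have "norm (f (y m)) \<le> B * e"
    using B(2)[of "y m"] y[of m] J_nrm_le[of "y m" e] B(1) by (meson mult_left_mono less_imp_le order_trans)
  also have "\<dots> = \<eta> / 4" using B(1) by (simp add: e_def)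
  finally have "norm (f (y m)) \<le> \<eta> / 4" .
  moreover have "inner (f (y m)) 1 \<ge> \<eta> / 2"
  proof -
    have "\<eta> / 2 = (\<Sum>k<m. c k) * (\<eta> / 2)" using c(2) by simp
    also have "\<dots> = (\<Sum>k<m. c k * (\<eta> / 2))" by (rule sum_distrib_right)
    also have "\<dots> \<le> (\<Sum>k<m. c k * inner (f (x k)) 1)"
      using c(1) X(5) by (intro sum_mono mult_left_mono) (auto simp: x_def)
    also have "\<dots> = inner (f (y m)) 1"
      using y[of m] by (simp add: inner_sum_left scaleR_conv_of_real[symmetric])
    finally show ?thesis .
  qed
  moreover have "\<bar>inner (f (y m)) 1\<bar> \<le> norm (f (y m))" using Cauchy_Schwarz_ineq2[of "f (y m)" 1] by simp
  ultimately show False using \<eta> by simp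
qed

end

section \<open>Smoothing operators\<close>

text \<open>Replacing right ends by averages gives a convex combination, over independent choices of
  \<open>s p\<close> in \<open>F p\<close>, of ordinary sums, and the norm is convex. The vector
  \<open>v\<close> holds the terms whose right ends have already been chosen in the
  induction.\<close>

lemma (in banach_over) norm_jsum_average_le:
  assumes "finite A" and F: "\<And>p. p \<in> A \<Longrightarrow> finite (F p)"
    and l0: "\<And>p j. p \<in> A \<Longrightarrow> j \<in> F p \<Longrightarrow> 0 \<le> l p j" and l1: "\<And>p. p \<in> A \<Longrightarrow> (\<Sum>j\<in>F p. l p j) = 1"
    and B: "\<And>s. (\<And>p. p \<in> A \<Longrightarrow> s p \<in> F p) \<Longrightarrow> norm (v + jsum h A s a) \<le> B"
  shows "norm (v + (\<Sum>p\<in>A. sc (a p - (\<Sum>j\<in>F p. l p j *\<^sub>R a j)) (h p))) \<le> B"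
  using assms
proof (induction A arbitrary: v rule: finite_induct)
  case empty
  then show ?case by (simp add: jsum_def)
next
  case (insert x A)
  define R where "R = (\<Sum>p\<in>A. sc (a p - (\<Sum>j\<in>F p. l p j *\<^sub>R a j)) (h p))"
  have le: "norm (v + sc (a x - a j) (h x) + R) \<le> B" if j: "j \<in> F x" for j
    unfolding R_def
  proof (rule insert.IH)
    fix s assume s: "\<And>p. p \<in> A \<Longrightarrow> s p \<in> F p"
    have "jsum h A (s(x := j)) a = jsum h A s a"
      unfolding jsum_def by (rule sum.cong) (use insert.hyps in auto)
    then have "jsum h (insert x A) (s(x := j)) a = sc (a x - a j) (h x) + jsum h A s a"
      using insert.hyps by (simp add: jsum_def)
    moreover have "norm (v + jsum h (insert x A) (s(x := j)) a) \<le> B"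
      by (rule insert.prems) (use s j in auto)
    ultimately show "norm (v + sc (a x - a j) (h x) + jsum h A s a) \<le> B" by (simp add: add.assoc)
  qed (use insert.prems in auto)
  have l1x: "(\<Sum>j\<in>F x. l x j) = 1" using insert.prems(3) by simp
  have "sc (a x - (\<Sum>j\<in>F x. l x j *\<^sub>R a j)) (h x) = (\<Sum>j\<in>F x. l x j *\<^sub>R sc (a x - a j) (h x))"
  proof -
    have "a x - (\<Sum>j\<in>F x. l x j *\<^sub>R a j) = (\<Sum>j\<in>F x. l x j *\<^sub>R (a x - a j))"
      by (simp add: scaleR_diff_right sum_subtractf scaleR_sum_left[symmetric] l1x)
    then show ?thesis by (simp add: scale_sum_left sc_scaleR_left)
  qed
  then have "v + (\<Sum>p\<in>insert x A. sc (a p - (\<Sum>j\<in>F p. l p j *\<^sub>R a j)) (h p)) =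
      (\<Sum>j\<in>F x. l x j *\<^sub>R (v + sc (a x - a j) (h x) + R))"
    using insert.hyps
    by (simp add: R_def[symmetric] scaleR_add_right sum.distrib scaleR_sum_left[symmetric] l1x add.assoc)
  also have "norm \<dots> \<le> (\<Sum>j\<in>F x. l x j * B)"
    by (rule sum_norm_le) (use insert.prems(2) le in \<open>auto simp: mult_left_mono\<close>)
  also have "\<dots> = B" by (simp add: sum_distrib_right[symmetric] l1x)
  finally show ?case .
qed

text \<open>Distinct positions that agree modulo 3 differ by at least 3. The difference is
  \<open>Suc (card X)\<close>, with \<open>X\<close> the set of elements strictly in
  between.\<close>

lemma card_mod_gap:
  fixes A :: "nat set"
  assumes A: "finite A" and p: "p \<in> A" "p' \<in> A" "p < p'"
    and eq: "card {x\<in>A. x < p} mod 3 = card {x\<in>A. x < p'} mod 3"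
  obtains p1 p2 where "p1 \<in> A" "p2 \<in> A" "p < p1" "p1 < p2" "p2 < p'"
proof -
  define X where "X = {x\<in>A. p < x \<and> x < p'}"
  have "{x\<in>A. x < p'} = {x\<in>A. x < p} \<union> insert p X" using p by (auto simp: X_def)
  moreover have "card ({x\<in>A. x < p} \<union> insert p X) = card {x\<in>A. x < p} + card (insert p X)"
    by (rule card_Un_disjoint) (use A in \<open>auto simp: X_def\<close>)
  moreover have "card (insert p X) = Suc (card X)"
    by (rule card_insert_disjoint) (use A in \<open>auto simp: X_def\<close>)
  ultimately have "card {x\<in>A. x < p'} = card {x\<in>A. x < p} + Suc (card X)" by simp
  then have "Suc (card X) mod 3 = 0" using eq by presburger
  then have "\<not> card X \<le> Suc 0" by presburger
  moreover have "finite X" using A by (simp add: X_def)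
  ultimately obtain x y where "x \<in> X" "y \<in> X" "x < y"
    using card_le_Suc0_iff_eq[of X] by (metis linorder_neqE_nat)
  then show thesis using that by (auto simp: X_def)
qed

locale averaging = reflexive_schauder_space sc h
  for sc :: "'k::{real_normed_field, euclidean_space} \<Rightarrow> 'e::banach \<Rightarrow> 'e" and h +
  fixes S :: "nat \<Rightarrow> nat" and l :: "nat \<Rightarrow> nat \<Rightarrow> real"
  assumes S_less: "N < S N" and l_nonneg: "0 \<le> l N j" and l_sum: "(\<Sum>j\<in>{N..<S N}. l N j) = 1"
begin

text \<open>The grid is generated by the same \<open>S\<close> that ends the windows of the weights,
  so the window of the mean at a grid point is exactly the block starting there.\<close>

definition grid :: "nat \<Rightarrow> nat" where "grid k = (S ^^ k) 0"

definition next_grid :: "nat \<Rightarrow> nat" where "next_grid i = grid (Suc (block_index grid i))"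

definition mean :: "nat \<Rightarrow> (nat \<Rightarrow> 'k) \<Rightarrow> 'k" where
  "mean N a = (\<Sum>j\<in>{N..<S N}. l N j *\<^sub>R a j)"

definition smooth :: "(nat \<Rightarrow> 'k) \<Rightarrow> nat \<Rightarrow> 'k" where
  "smooth a i = mean (next_grid i) a"

lemma grid_Suc: "grid (Suc k) = S (grid k)"
  by (simp add: grid_def)

lemma strict_mono_grid: "strict_mono grid"
  by (rule strict_monoI_Suc) (simp add: grid_Suc S_less)

lemma grid_block: "grid (block_index grid i) \<le> i" "i < next_grid i"
  using block_index[OF strict_mono_grid, of i] by (simp_all add: grid_def next_grid_def)

text \<open>The window of the mean at \<open>next_grid i\<close> is the block following that of
  \<open>i\<close>. As \<open>i'\<close> lies in this block or a later one, the window is over when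
  the block of \<open>i'\<close> ends.\<close>

lemma next_grid_step: "next_grid i \<le> i' \<Longrightarrow> S (next_grid i) \<le> next_grid i'"
proof -
  assume "next_grid i \<le> i'"
  then have "grid (Suc (block_index grid i)) < grid (Suc (block_index grid i'))"
    using grid_block(2)[of i'] by (simp add: next_grid_def)
  then have "Suc (Suc (block_index grid i)) \<le> Suc (block_index grid i')"
    by (simp add: strict_mono_less[OF strict_mono_grid])
  then have "grid (Suc (Suc (block_index grid i))) \<le> grid (Suc (block_index grid i'))"
    by (simp only: strict_mono_less_eq[OF strict_mono_grid])
  then show ?thesis by (simp add: next_grid_def grid_Suc)
qed

lemma next_grid_eq: "i \<le> i' \<Longrightarrow> i' < next_grid i \<Longrightarrow> next_grid i' = next_grid i"
  using block_index_eq[OF strict_mono_grid, of "block_index grid i" i'] grid_block(1)[of i]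
  by (simp add: next_grid_def)

lemma next_grid_mono: "i \<le> i' \<Longrightarrow> next_grid i \<le> next_grid i'"
  using next_grid_eq[of i i'] grid_block(2)[of i'] by (cases "i' < next_grid i") auto

lemma mean_add: "mean N (\<lambda>i. a i + b i) = mean N a + mean N b"
  by (simp add: mean_def scaleR_add_right sum.distrib)

lemma mean_scale: "mean N (\<lambda>i. c * a i) = c * mean N a"
  by (simp add: mean_def sum_distrib_left)

lemma mean_diff_const: "mean N a - c = (\<Sum>j\<in>{N..<S N}. l N j *\<^sub>R (a j - c))"
  by (simp add: mean_def scaleR_diff_right sum_subtractf scaleR_sum_left[symmetric] l_sum)

lemma norm_mean_diff_le:
  assumes "\<And>j. N \<le> j \<Longrightarrow> norm (a j - c) \<le> b"
  shows "norm (mean N a - c) \<le> b"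
proof -
  have "norm (mean N a - c) \<le> (\<Sum>j\<in>{N..<S N}. l N j * b)"
    unfolding mean_diff_const
    by (rule sum_norm_le) (use assms l_nonneg in \<open>auto intro!: mult_left_mono\<close>)
  then show ?thesis by (simp add: sum_distrib_right[symmetric] l_sum)
qed

lemma norm_mean_le: "norm (mean N a) \<le> (\<Sum>j\<in>{N..<S N}. l N j * norm (a j))"
  unfolding mean_def by (rule sum_norm_le) (simp add: l_nonneg)

lemma smooth_tendsto:
  assumes "a \<longlonglongrightarrow> c"
  shows "smooth a \<longlonglongrightarrow> c"
proof (rule LIMSEQ_I)
  fix e :: real assume e: "e > 0"
  then obtain N where N: "\<And>j. j \<ge> N \<Longrightarrow> norm (a j - c) < e / 2"
    using LIMSEQ_D[OF assms, of "e / 2"] by auto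
  have "norm (smooth a i - c) < e" if "i \<ge> N" for i
  proof -
    have "norm (smooth a i - c) \<le> e / 2"
      unfolding smooth_def
      by (rule norm_mean_diff_le) (use N that grid_block(2)[of i] in \<open>auto intro: less_imp_le\<close>)
    then show ?thesis using e by simp
  qed
  then show "\<exists>N. \<forall>i\<ge>N. norm (smooth a i - c) < e" by blast
qed

text \<open>
  When the samples \<open>s p\<close> stay below the third successor of \<open>p\<close> in \<open>A\<close>, each residue class of
  positions in \<open>A\<close> modulo 3 is interlaced with them.
\<close>

lemma norm_sampled_sum_le:
  assumes B: "jbound a B" and A: "finite A" and r: "\<And>p. p \<in> A \<Longrightarrow> p < r p"
    and gap: "\<And>p p1 p2 p3. p \<in> A \<Longrightarrow> p1 \<in> A \<Longrightarrow> p2 \<in> A \<Longrightarrow> p3 \<in> A \<Longrightarrow>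
      p < p1 \<Longrightarrow> p1 < p2 \<Longrightarrow> p2 < p3 \<Longrightarrow> S (r p) \<le> p3"
  shows "norm (\<Sum>p\<in>A. sc (a p - mean (r p) a) (h p)) \<le> 3 * B"
proof -
  define cl where "cl p = card {x\<in>A. x < p} mod 3" for p
  define t where "t p = sc (a p - mean (r p) a) (h p)" for p
  have part: "norm (\<Sum>p\<in>{p\<in>A. cl p = c}. t p) \<le> B" for c
  proof -
    let ?A = "{p\<in>A. cl p = c}"
    have "norm (0 + (\<Sum>p\<in>?A. sc (a p - (\<Sum>j\<in>{r p..<S (r p)}. l (r p) j *\<^sub>R a j)) (h p))) \<le> B"
    proof (rule norm_jsum_average_le)
      fix s assume s: "\<And>p. p \<in> ?A \<Longrightarrow> s p \<in> {r p..<S (r p)}"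
      have "interlaced ?A s"
        unfolding interlaced_def
      proof (intro conjI ballI impI)
        show "finite ?A" using A by simp
        fix p assume p: "p \<in> ?A"
        show "p < s p" using r[of p] s[OF p] p by auto
        fix p' assume p': "p' \<in> ?A" and less: "p < p'"
        obtain p1 p2 where "p1 \<in> A" "p2 \<in> A" "p < p1" "p1 < p2" "p2 < p'"
          using card_mod_gap[OF A, of p p'] p p' less by (auto simp: cl_def)
        then have "S (r p) \<le> p'" using gap[of p p1 p2 p'] p p' by auto
        then show "s p < p'" using s[OF p] by auto
      qed
      then show "norm (0 + jsum h ?A s a) \<le> B" using jboundD[OF B] by simp
    qed (use A l_nonneg l_sum in auto)
    then show ?thesis by (simp add: t_def mean_def)
  qed
  have "(\<Sum>p\<in>A. t p) = (\<Sum>c<3. \<Sum>p\<in>{p\<in>A. cl p = c}. t p)"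
    by (rule sum.group[symmetric]) (use A in \<open>auto simp: cl_def\<close>)
  also have "norm \<dots> \<le> (\<Sum>c<(3::nat). B)" by (rule sum_norm_le) (rule part)
  finally show ?thesis by (simp add: t_def)
qed

lemma jbound_smooth:
  assumes B: "jbound a B"
  shows "jbound (smooth a) (6 * B)"
  unfolding jbound_def
proof (intro allI impI)
  fix A q assume A: "interlaced A q"
  \<comment> \<open>Pairs inside one block contribute nothing, as \<open>smooth a\<close> is
    constant there. Each remaining pair has a grid point in between, which is what lets windows be
    overtaken after a few elements of \<open>A'\<close>.\<close>
  define A' where "A' = {p\<in>A. next_grid p \<noteq> next_grid (q p)}"
  have fin: "finite A'" using interlaced_finite[OF A] by (simp add: A'_def)
  have less: "p < q p" if "p \<in> A'" for p using interlaced_less[OF A] that by (simp add: A'_def)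
  have nxt: "q p < p'" if "p \<in> A'" "p' \<in> A'" "p < p'" for p p'
    using interlaced_next[OF A] that by (simp add: A'_def)
  have up: "next_grid p \<le> q p" if "p \<in> A'" for p
    using next_grid_eq[of p "q p"] less[OF that] that by (force simp: A'_def)
  have "jsum h A q (smooth a) = jsum h A' q (smooth a)"
    unfolding jsum_def
    by (rule sum.mono_neutral_right) (use interlaced_finite[OF A] in \<open>auto simp: A'_def smooth_def\<close>)
  also have "\<dots> = (\<Sum>p\<in>A'. sc (a p - mean (next_grid (q p)) a) (h p)) - (\<Sum>p\<in>A'. sc (a p - mean (next_grid p) a) (h p))"
    unfolding jsum_def sum_subtractf[symmetric] scale_left_diff_distrib[symmetric] smooth_def
    by (rule sum.cong) simp_all
  also have "norm \<dots> \<le> 3 * B + 3 * B"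
  proof (rule norm_triangle_le_diff[OF add_mono])
    \<comment> \<open>The sampling window starts at the end of the block of \<open>q p\<close>,
      hence no later than \<open>next_grid p1\<close>. The pair of \<open>p1\<close> crosses that
      point and the pair of \<open>p2\<close> crosses the end of the following block, so the window
      is over by \<open>p3\<close>.\<close>
    show "norm (\<Sum>p\<in>A'. sc (a p - mean (next_grid (q p)) a) (h p)) \<le> 3 * B"
    proof (rule norm_sampled_sum_le[OF B fin])
      show "p < next_grid (q p)" if "p \<in> A'" for p
        using less[OF that] grid_block(2)[of "q p"] by simp
      fix p p1 p2 p3 assume p: "p \<in> A'" "p1 \<in> A'" "p2 \<in> A'" "p3 \<in> A'" "p < p1" "p1 < p2" "p2 < p3"
      have "next_grid (q p) \<le> next_grid p1" using next_grid_mono nxt[OF p(1,2,5)] by simp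
      also have "\<dots> \<le> q p1" by (rule up[OF p(2)])
      also have "\<dots> \<le> p2" using nxt[OF p(2,3,6)] by simp
      finally have "S (next_grid (q p)) \<le> next_grid p2" by (rule next_grid_step)
      also have "\<dots> \<le> q p2" by (rule up[OF p(3)])
      also have "\<dots> \<le> p3" using nxt[OF p(3,4,7)] by simp
      finally show "S (next_grid (q p)) \<le> p3" .
    qed
    show "norm (\<Sum>p\<in>A'. sc (a p - mean (next_grid p) a) (h p)) \<le> 3 * B"
    proof (rule norm_sampled_sum_le[OF B fin grid_block(2)])
      fix p p1 p2 p3 assume p: "p \<in> A'" "p1 \<in> A'" "p2 \<in> A'" "p3 \<in> A'" "p < p1" "p1 < p2" "p2 < p3"
      have "next_grid p \<le> p1" using up[OF p(1)] nxt[OF p(1,2,5)] by simp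
      then have "S (next_grid p) \<le> next_grid p1" by (rule next_grid_step)
      also have "\<dots> \<le> q p1" by (rule up[OF p(2)])
      also have "\<dots> \<le> p3" using nxt[OF p(2,3,6)] p(7) by simp
      finally show "S (next_grid p) \<le> p3" .
    qed
  qed
  finally show "norm (jsum h A q (smooth a)) \<le> 6 * B" by simp
qed

definition remainder :: "(nat \<Rightarrow> 'k) \<Rightarrow> nat \<Rightarrow> 'k" where
  "remainder a = (\<lambda>i. a i - smooth a i)"

text \<open>The limit of \<open>a\<close>, which may be nonzero, is also the limit of
  \<open>smooth a\<close> and cancels. The constant 7 is 1 for the identity plus 6 for
  \<open>smooth\<close>.\<close>

lemma remainder_in_J:
  assumes "jbound a B"
  shows "remainder a \<in> pts J" and "nrm J (remainder a) \<le> 7 * B"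
proof -
  have b: "jbound (remainder a) (7 * B)"
    using jbound_diff[OF assms jbound_smooth[OF assms]] by (simp add: remainder_def fun_diff_def)
  obtain c where "a \<longlonglongrightarrow> c" using jbound_convergent[OF assms] by (auto simp: convergent_def)
  then have "(\<lambda>i. a i - smooth a i) \<longlonglongrightarrow> c - c" by (intro tendsto_diff smooth_tendsto)
  then show "remainder a \<in> pts J" using b unfolding J_pts by (auto simp: remainder_def)
  show "nrm J (remainder a) \<le> 7 * B" by (rule J_nrm_le[OF b])
qed

lemma bounded_op_remainder: "bounded_op J J remainder"
  unfolding bounded_op_def J_smult
proof (intro conjI ballI allI subsetI)
  fix y assume "y \<in> remainder ` pts J"
  then show "y \<in> pts J" using remainder_in_J(1)[OF jbound_nrm] by auto
next
  fix a b assume "a \<in> pts J" "b \<in> pts J"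
  show "remainder (a + b) = remainder a + remainder b"
    by (simp add: remainder_def smooth_def mean_add plus_fun_def fun_eq_iff)
next
  fix c a assume "a \<in> pts J"
  show "remainder (fscale c a) = fscale c (remainder a)"
    by (simp add: remainder_def smooth_def fscale_def mean_scale right_diff_distrib)
next
  show "\<exists>B. \<forall>a\<in>pts J. nrm J (remainder a) \<le> B * nrm J a"
    using remainder_in_J(2)[OF jbound_nrm] by blast
qed

lemma op_norm_remainder: "op_norm J J remainder \<le> 7"
  unfolding op_norm_def
proof (rule cSUP_least)
  have "jbound 0 0" by (simp add: jbound_def jsum_def)
  then have "nrm J 0 \<le> 1" using J_nrm_le[of 0 0] by simp
  then show "{x \<in> pts J. nrm J x \<le> 1} \<noteq> {}" using zero_in_J by blast
  show "nrm J (remainder x) \<le> 7" if "x \<in> {x \<in> pts J. nrm J x \<le> 1}" for x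
    using remainder_in_J(2)[OF jbound_mono[OF jbound_nrm, of x 1]] that by simp
qed

text \<open>Since \<open>next_grid i > i\<close>, all values of \<open>smooth a\<close> from
  \<open>p\<close> on are at most \<open>\<delta> / 2 ^ Suc p\<close>. The term of a J-sum starting
  at \<open>p\<close> is thus at most twice this, and the sum over all \<open>p\<close> is at most
  \<open>2 * \<delta>\<close>, whatever the pairs are.\<close>

lemma nrm_smooth_le:
  assumes "\<delta> \<ge> 0" and small: "\<And>N. (\<Sum>j\<in>{N..<S N}. l N j * norm (a j)) \<le> \<delta> * (1/2)^N"
  shows "nrm J (smooth a) \<le> 2 * \<delta>"
proof (rule J_nrm_le)
  have y: "norm (smooth a i) \<le> \<delta> * (1/2)^(Suc p)" if "p \<le> i" for p i
  proof -
    have "norm (smooth a i) \<le> \<delta> * (1/2)^(next_grid i)"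
      unfolding smooth_def using norm_mean_le small by (rule order_trans)
    also have "\<dots> \<le> \<delta> * (1/2)^(Suc p)"
      using grid_block(2)[of i] that assms(1) by (intro mult_left_mono power_decreasing) auto
    finally show ?thesis .
  qed
  show "jbound (smooth a) (2 * \<delta>)"
    unfolding jbound_def
  proof (intro allI impI)
    fix A q assume A: "interlaced A q"
    have "norm (jsum h A q (smooth a)) \<le> (\<Sum>p\<in>A. 2 * \<delta> * (1/2)^(Suc p))"
      unfolding jsum_def
    proof (rule sum_norm_le)
      fix p assume p: "p \<in> A"
      show "norm (sc (smooth a p - smooth a (q p)) (h p)) \<le> 2 * \<delta> * (1/2)^(Suc p)"
        using norm_triangle_ineq4[of "smooth a p" "smooth a (q p)"] y[of p p] y[of p "q p"]
          interlaced_less[OF A p] by (simp add: norm_sc norm_h)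
    qed
    also have "\<dots> = 2 * \<delta> * (\<Sum>p\<in>A. (1/2)^(Suc p))" by (simp add: sum_distrib_left)
    also have "(\<Sum>p\<in>A. (1/2)^(Suc p)) \<le> (\<Sum>p. (1/2::real)^(Suc p))"
      by (rule sum_le_suminf) (use power_half_series interlaced_finite[OF A] in \<open>auto simp: sums_iff\<close>)
    also have "(\<Sum>p. (1/2::real)^(Suc p)) = 1" using power_half_series by (simp only: sums_iff)
    finally show "norm (jsum h A q (smooth a)) \<le> 2 * \<delta>" using assms(1) by (simp add: mult_left_mono)
  qed
qed

end

section \<open>The weak topology of J(h)\<close>

context reflexive_schauder_space
begin

lemma coordinate_in_jdual: "(\<lambda>a. if a \<in> pts J then a j else 0) \<in> jdual"
  unfolding jdual_iff
  using J_add J_scale J_coord by (auto simp: fscale_def intro!: exI[of _ 1])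

lemma topspace_weak_J: "topspace (weak_topology J) = pts J"
proof -
  have "pts J \<in> {{x \<in> pts J. f x \<in> U} | f U. f \<in> jdual \<and> open U}"
    using coordinate_in_jdual[of 0] by (intro CollectI exI[of _ "\<lambda>a. if a \<in> pts J then a 0 else 0"] exI[of _ UNIV]) auto
  then show ?thesis unfolding weak_topology_def topology_generated_by_topspace by blast
qed

lemma continuous_map_jdual: "f \<in> jdual \<Longrightarrow> continuous_map (weak_topology J) euclidean f"
  unfolding continuous_map_def topspace_weak_J
proof (intro conjI allI impI)
  fix U :: "'k set" assume "f \<in> jdual" "openin euclidean U"
  then show "openin (weak_topology J) {x \<in> pts J. f x \<in> U}"
    unfolding weak_topology_def by (intro topology_generated_by_Basis) auto
qed simp

lemma continuous_map_coordinate: "continuous_map (weak_topology J) euclidean (\<lambda>a. a j)"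
  by (rule continuous_map_eq[OF continuous_map_jdual[OF coordinate_in_jdual[of j]]])
    (simp add: topspace_weak_J)

lemma Hausdorff_weak_J: "Hausdorff_space (weak_topology J)"
  unfolding Hausdorff_space_def
proof (intro allI impI)
  fix x y assume xy: "x \<in> topspace (weak_topology J) \<and> y \<in> topspace (weak_topology J) \<and> x \<noteq> y"
  then obtain j where j: "x j \<noteq> y j" by (auto simp: fun_eq_iff)
  obtain U V where UV: "open U" "open V" "x j \<in> U" "y j \<in> V" "U \<inter> V = {}"
    using hausdorff[OF j] by blast
  have "openin (weak_topology J) {a \<in> topspace (weak_topology J). a j \<in> U}" if "open U" for U
    using openin_continuous_map_preimage[OF continuous_map_coordinate] that by simp
  then show "\<exists>U V. openin (weak_topology J) U \<and> openin (weak_topology J) V \<and> x \<in> U \<and> y \<in> V \<and> disjnt U V"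
    using UV xy
    by (intro exI[of _ "{a \<in> topspace (weak_topology J). a j \<in> U}"] exI[of _ "{a \<in> topspace (weak_topology J). a j \<in> V}"])
      (auto simp: disjnt_def)
qed

lemma weakly_compact_subset: "weakly_compact J D \<Longrightarrow> D \<subseteq> pts J"
  unfolding weakly_compact_def using compactin_subset_topspace topspace_weak_J by blast

lemma weakly_compact_jdual_bounded:
  assumes D: "weakly_compact J D" and f: "f \<in> jdual"
  shows "\<exists>B. \<forall>x\<in>D. norm (f x) \<le> B"
proof -
  have "compact (f ` D)"
    using image_compactin[OF _ continuous_map_jdual[OF f]] D by (simp add: weakly_compact_def)
  then have "bounded (f ` D)" by (rule compact_imp_bounded)
  then show ?thesis by (auto simp: bounded_iff)
qed

text \<open>The ratio 1/5 is fitted to the gliding hump below: if no coordinate exceeds twice the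
  one in term \<open>k\<close>, the terms after \<open>k\<close> add up to at most half of that
  term, because 2 * (1/5) / (1 - 1/5) = 1/2.\<close>

lemma series_functional_in_jdual:
  defines "t \<equiv> \<lambda>l::nat. (1/5::real)^l"
  shows "(\<lambda>a. if a \<in> pts J then \<Sum>l. t l *\<^sub>R a (j l) else 0) \<in> jdual"
    and "a \<in> pts J \<Longrightarrow> summable (\<lambda>l. t l *\<^sub>R a (j l))"
proof -
  have t: "t sums (5/4)"
    unfolding t_def using geometric_sums[of "1/5::real"] by simp
  have bd: "norm (t l *\<^sub>R a (j l)) \<le> t l * nrm J a" if "a \<in> pts J" for a l
    using J_coord[OF that, of "j l"] by (simp add: t_def mult_left_mono)
  have ts: "(\<lambda>l. t l * nrm J a) sums (5/4 * nrm J a)" for a by (rule sums_mult2[OF t])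
  show summ: "summable (\<lambda>l. t l *\<^sub>R a (j l))" if "a \<in> pts J" for a
    by (rule summable_comparison_test'[OF sums_summable[OF ts], of 0]) (rule bd[OF that])
  have norm: "norm (\<Sum>l. t l *\<^sub>R a (j l)) \<le> 5/4 * nrm J a" if "a \<in> pts J" for a
    using norm_suminf_le[OF bd[OF that] sums_summable[OF ts]] ts[of a] by (simp add: sums_iff)
  show "(\<lambda>a. if a \<in> pts J then \<Sum>l. t l *\<^sub>R a (j l) else 0) \<in> jdual"
    unfolding jdual_iff
  proof (intro conjI ballI allI impI exI[of _ "5/4"])
    fix a b assume a: "a \<in> pts J" "b \<in> pts J"
    then show "(if a + b \<in> pts J then \<Sum>l. t l *\<^sub>R (a + b) (j l) else 0) =
        (if a \<in> pts J then \<Sum>l. t l *\<^sub>R a (j l) else 0) + (if b \<in> pts J then \<Sum>l. t l *\<^sub>R b (j l) else 0)"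
      using J_add[OF a] suminf_add[OF summ[OF a(1)] summ[OF a(2)]]
      by (simp add: scaleR_add_right)
  next
    fix c a assume a: "a \<in> pts J"
    then show "(if fscale c a \<in> pts J then \<Sum>l. t l *\<^sub>R fscale c a (j l) else 0) =
        c * (if a \<in> pts J then \<Sum>l. t l *\<^sub>R a (j l) else 0)"
      using J_scale[OF a, of c] suminf_mult[OF summ[OF a], of c] by (simp add: fscale_def)
  qed (use norm in auto)
qed

text \<open>A gliding hump: otherwise some geometric series of coordinates is unbounded on D.\<close>

lemma weakly_compact_coords_bounded:
  assumes D: "weakly_compact J D"
  shows "\<exists>M. \<forall>x\<in>D. \<forall>j. norm (x j) \<le> M"
proof (rule ccontr)
  assume neg: "\<not> ?thesis"
  have DJ: "x \<in> pts J" if "x \<in> D" for x using weakly_compact_subset[OF D] that by blast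
  define t where "t = (\<lambda>l::nat. (1/5::real)^l)"
  have t0: "t l > 0" for l by (simp add: t_def)
  have "\<exists>B. \<forall>x\<in>D. norm (x j) \<le> B" for j
    using weakly_compact_jdual_bounded[OF D coordinate_in_jdual[of j]] DJ by auto
  then obtain Mb where Mb: "\<And>x j. x \<in> D \<Longrightarrow> norm (x j) \<le> Mb j" by metis
  \<comment> \<open>The index \<open>j\<close> nearly attains the supremum of \<open>x\<close>, up
    to a factor 2. The later terms of the series are then controlled by the hump itself, wherever
    their indices will be chosen.\<close>
  have large: "\<exists>x j. x \<in> D \<and> (\<forall>i. norm (x i) \<le> 2 * norm (x j)) \<and> norm (x j) > C" for C
  proof -
    obtain x i where x: "x \<in> D" "norm (x i) > max 0 (2 * C)" using neg by (meson not_le)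
    define s where "s = (SUP j. norm (x j))"
    have bdd: "bdd_above (range (\<lambda>j. norm (x j)))"
      by (rule bdd_aboveI2[of _ _ "nrm J x"]) (use J_coord DJ x in auto)
    have s: "norm (x j) \<le> s" for j unfolding s_def by (rule cSUP_upper[OF UNIV_I bdd])
    have xi: "norm (x i) > 0" "norm (x i) > 2 * C" using x(2) by auto
    then have "s / 2 < s" using s[of i] by linarith
    then obtain j where j: "s / 2 < norm (x j)"
      using less_cSUP_iff[OF UNIV_not_empty bdd, of "s / 2", folded s_def] by auto
    have "norm (x k) \<le> 2 * norm (x j)" for k using s[of k] j by linarith
    moreover have "norm (x j) > C" using s[of i] xi j by linarith
    ultimately show ?thesis using x(1) by blast
  qed
  \<comment> \<open>The component \<open>c\<close> bounds, on all of \<open>D\<close>, the sum of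
    the terms chosen before \<open>k\<close>. Half of the hump is reserved against the tail, and
    what is left after subtracting \<open>c\<close> still exceeds \<open>k\<close>.\<close>
  define P where "P k = (\<lambda>(c, x, j). x \<in> D \<and> (\<forall>i. norm (x i) \<le> 2 * norm (x j)) \<and>
      t k * norm (x j) / 2 - c > real k \<and> (k = 0 \<longrightarrow> c = 0))" for k
  have ex: "\<exists>x j. P k (c, x, j)" if "k = 0 \<longrightarrow> c = 0" for k c
  proof -
    obtain x j where xj: "x \<in> D" "\<forall>i. norm (x i) \<le> 2 * norm (x j)" "norm (x j) > 2 * (real k + c) / t k"
      using large by metis
    then have "t k * norm (x j) / 2 - c > real k" using t0[of k] by (simp add: field_simps)
    then show ?thesis using xj that unfolding P_def by blast
  qed
  have "\<exists>f. \<forall>k. P k (f k) \<and> fst (f (Suc k)) = fst (f k) + t k * Mb (snd (snd (f k)))"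
  proof (rule dependent_nat_choice)
    show "\<exists>x. P 0 x" using ex[of 0 0] by blast
    show "\<exists>y. P (Suc k) y \<and> fst y = fst x + t k * Mb (snd (snd x))" for x k
      using ex[of "Suc k" "fst x + t k * Mb (snd (snd x))"] by force
  qed
  then obtain f where f: "\<And>k. P k (f k)" "\<And>k. fst (f (Suc k)) = fst (f k) + t k * Mb (snd (snd (f k)))"
    by blast
  define c where "c k = fst (f k)" for k
  define x where "x k = fst (snd (f k))" for k
  define j where "j k = snd (snd (f k))" for k
  have Pk: "P k (c k, x k, j k)" for k using f(1) by (simp add: c_def x_def j_def)
  have xD: "x k \<in> D" and x2: "norm (x k i) \<le> 2 * norm (x k (j k))"
    and big: "t k * norm (x k (j k)) / 2 - c k > real k" and c0: "c 0 = 0" for k i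
    using Pk[of k] Pk[of 0] by (simp_all add: P_def)
  have cS: "c (Suc k) = c k + t k * Mb (j k)" for k using f(2) by (simp add: c_def j_def)
  have c: "c k = (\<Sum>l<k. t l * Mb (j l))" for k by (induction k) (simp_all add: c0 cS)
  define F where "F = (\<lambda>a. if a \<in> pts J then \<Sum>l. t l *\<^sub>R a (j l) else 0)"
  have F: "F \<in> jdual" unfolding F_def t_def by (rule series_functional_in_jdual(1))
  have "norm (F (x k)) > real k" for k
  proof -
    let ?g = "\<lambda>l. t l *\<^sub>R x k (j l)"
    let ?m = "norm (x k (j k))"
    have xJ: "x k \<in> pts J" by (rule DJ[OF xD])
    have summ: "summable ?g" unfolding t_def by (rule series_functional_in_jdual(2)[OF xJ])
    have "F (x k) = (\<Sum>l. ?g (l + Suc k)) + (\<Sum>l<Suc k. ?g l)"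
      using suminf_split_initial_segment[OF summ, of "Suc k"] xJ by (simp add: F_def)
    then have split: "?g k = F (x k) - (\<Sum>l. ?g (l + Suc k)) - (\<Sum>l<k. ?g l)" by simp
    have head: "norm (\<Sum>l<k. ?g l) \<le> c k"
      unfolding c by (rule sum_norm_le) (use Mb[OF xD] t0 in \<open>simp add: mult_left_mono less_imp_le\<close>)
    have tail: "norm (\<Sum>l. ?g (l + Suc k)) \<le> t k * ?m / 2"
    proof -
      have s: "(\<lambda>l. t l * (t (Suc k) * (2 * ?m))) sums (1 / (1 - 1/5) * (t (Suc k) * (2 * ?m)))"
        unfolding t_def by (rule sums_mult2[OF geometric_sums]) simp
      have "norm (\<Sum>l. ?g (l + Suc k)) \<le> (\<Sum>l. t l * (t (Suc k) * (2 * ?m)))"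
      proof (rule norm_suminf_le[OF _ sums_summable[OF s]])
        fix l
        have "norm (?g (l + Suc k)) = t l * (t (Suc k) * norm (x k (j (l + Suc k))))"
          by (simp add: t_def power_add)
        also have "\<dots> \<le> t l * (t (Suc k) * (2 * ?m))"
          using x2 t0[THEN less_imp_le] by (intro mult_left_mono) auto
        finally show "norm (?g (l + Suc k)) \<le> t l * (t (Suc k) * (2 * ?m))" .
      qed
      also have "\<dots> = t k * ?m / 2" using s by (simp add: sums_iff t_def)
      finally show ?thesis .
    qed
    have "t k * ?m = norm (?g k)" using t0[of k] by simp
    also have "\<dots> \<le> norm (F (x k)) + norm (\<Sum>l. ?g (l + Suc k)) + norm (\<Sum>l<k. ?g l)"
      unfolding split by (meson add_mono norm_triangle_ineq4 order_refl order_trans)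
    finally show ?thesis using head tail big[of k] by linarith
  qed
  moreover obtain B where "\<And>x. x \<in> D \<Longrightarrow> norm (F x) \<le> B" using weakly_compact_jdual_bounded[OF D F] by blast
  moreover obtain k where "B < real k" using reals_Archimedean2 by blast
  ultimately show False using xD[of k] by (meson less_le_trans not_le order_less_trans)
qed

text \<open>Coordinates are weakly continuous, so the sequences of moduli of elements of
  \<open>D\<close> form a compact set for pointwise convergence. Moduli are used because the theorem
  on convex combinations bounds values only from above, and because the scalars may be
  complex.\<close>

lemma weakly_compact_convex_small:
  assumes D: "weakly_compact J D" and e: "e > 0"
  shows "\<exists>m c. N < m \<and> (\<forall>j. 0 \<le> c j) \<and> (\<Sum>j\<in>{N..<m}. c j) = 1 \<and>
     (\<forall>x\<in>D. (\<Sum>j\<in>{N..<m}. c j * norm (x j)) \<le> (e::real))"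
proof -
  define R where "R = (\<lambda>x j. norm (x j)) ` D"
  have "continuous_map (weak_topology J) (product_topology (\<lambda>_. euclidean) UNIV) (\<lambda>x j. norm (x j))"
    using continuous_map_coordinate
    by (intro continuous_map_coordinatewise_then_product continuous_map_norm) auto
  then have cont: "continuous_map (weak_topology J) euclidean (\<lambda>x j. norm (x j))"
    by (simp add: euclidean_product_topology)
  have "compactin euclidean R"
    using image_compactin[OF D[unfolded weakly_compact_def] cont] by (simp only: R_def)
  then have "compact R" by simp
  obtain M where M: "\<And>x j. x \<in> D \<Longrightarrow> norm (x j) \<le> M" using weakly_compact_coords_bounded[OF D] by blast
  have "\<exists>m F. convex_comb (\<lambda>j w. w j) N m F \<and> (\<forall>w\<in>R. F w \<le> e)"
  proof (rule uniformly_small_convex_comb[OF \<open>compact R\<close> _ _ _ e])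
    show "continuous_on R (\<lambda>w. w j)" for j
      by (rule continuous_on_subset[OF continuous_on_product_coordinates]) simp
    show "\<bar>w j\<bar> \<le> M" if "w \<in> R" for w j using that M by (auto simp: R_def)
    show "w \<longlonglongrightarrow> 0" if "w \<in> R" for w
      using that weakly_compact_subset[OF D] by (auto simp: R_def J_pts intro!: tendsto_norm_zero)
  qed
  then obtain m c where c: "\<And>j. 0 \<le> c j" "\<And>j. j \<notin> {N..<m} \<Longrightarrow> c j = 0" "(\<Sum>j<m. c j) = 1"
    and small: "\<And>w. w \<in> R \<Longrightarrow> (\<Sum>j<m. c j * w j) \<le> e"
    unfolding convex_comb_def by force
  have eq: "(\<Sum>j\<in>{N..<m}. c j * g j) = (\<Sum>j<m. c j * g j)" for g :: "nat \<Rightarrow> real"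
    by (rule sum.mono_neutral_left) (use c(2) in auto)
  have "(\<Sum>j\<in>{N..<m}. c j) = 1" using eq[of "\<lambda>_. 1"] c(3) by simp
  moreover from this have "N < m" by (cases "N < m") auto
  moreover have "(\<Sum>j\<in>{N..<m}. c j * norm (x j)) \<le> e" if "x \<in> D" for x
    using small[of "\<lambda>j. norm (x j)"] that by (simp add: eq R_def)
  ultimately show ?thesis using c(1) by blast
qed

lemma continuous_on_jsum: "continuous_on UNIV (jsum h A q)"
  unfolding jsum_def[abs_def]
  by (intro continuous_on_sum continuous_on_sc_left continuous_on_diff continuous_on_product_coordinates)

text \<open>Each inequality in \<open>jbound\<close> involves finitely many coordinates and is
  therefore closed in the product of balls. Convergence to zero is not imposed: it is not a closed
  condition, as initial segments of the constant 1 have J-norm 1 and converge pointwise to that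
  constant.\<close>

lemma compact_jball: "compact {a. jbound a 1 \<and> (\<forall>j. norm (a j) \<le> 1)}"
proof -
  have eq: "{a. jbound a 1 \<and> (\<forall>j. norm (a j) \<le> 1)} =
      {a. \<forall>j. a j \<in> cball 0 1} \<inter> (\<Inter>(A, q)\<in>{(A, q). interlaced A q}. {a. norm (jsum h A q a) \<le> 1})"
    by (auto simp: jbound_def)
  have "closed {a. norm (jsum h A q a) \<le> 1}" for A q
    by (intro closed_Collect_le continuous_on_norm continuous_on_jsum continuous_on_const)
  then show ?thesis
    unfolding eq by (intro compact_Int_closed compact_product closed_INT ballI) auto
qed

definition unit_seq :: "nat \<Rightarrow> nat \<Rightarrow> 'k" where
  "unit_seq j = (\<lambda>i. if i = j then 1 else 0)"

text \<open>A constant sequence has no increments, so cutting it off costs only its modulus, and a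
  unit vector is the difference of two such cuts.\<close>

lemma unit_seq_in_J: "unit_seq j \<in> pts J"
proof -
  have "jbound (cut_below N (\<lambda>_. 1)) (1 + 0)" for N
    by (rule jbound_cut_below) (simp_all add: jbound_def jsum_def)
  from jbound_diff[OF this[of j] this[of "Suc j"]]
  have "jbound (cut_below j (\<lambda>_. 1) - cut_below (Suc j) (\<lambda>_. 1)) 2" by simp
  also have "cut_below j (\<lambda>_. 1) - cut_below (Suc j) (\<lambda>_. 1) = unit_seq j"
    by (auto simp: cut_below_def unit_seq_def fun_eq_iff)
  finally have "jbound (unit_seq j) 2" .
  moreover have "unit_seq j \<longlonglongrightarrow> 0"
    by (rule tendsto_eventually) (auto simp: unit_seq_def intro: eventually_mono[OF eventually_gt_at_top[of j]])
  ultimately show ?thesis by (auto simp: J_pts)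
qed

text \<open>Up to its value on a tail, a functional is a finite combination of coordinates, which is
  pointwise continuous; this reduces continuity questions to uniform smallness on tails.\<close>

lemma jdual_head:
  assumes f: "f \<in> jdual" and a: "a \<in> pts J"
  shows "f a - f (cut_below N a) = (\<Sum>j<N. a j * f (unit_seq j))"
proof (induction N)
  case 0
  have "cut_below 0 a = a" by (simp add: cut_below_def)
  then show ?case by simp
next
  case (Suc N)
  have "cut_below N a = cut_below (Suc N) a + fscale (a N) (unit_seq N)"
    by (auto simp: cut_below_def fscale_def unit_seq_def fun_eq_iff less_Suc_eq)
  then have "f (cut_below N a) = f (cut_below (Suc N) a) + a N * f (unit_seq N)"
    using jdualD(1)[OF f _ J_scale[OF unit_seq_in_J]] jdualD(2)[OF f unit_seq_in_J] J_cut_below[OF a] by metis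
  then show ?case using Suc by (simp add: algebra_simps)
qed

end

section \<open>Weak compactness of the remainder\<close>

context averaging
begin

lemma continuous_on_remainder_coord: "continuous_on UNIV (\<lambda>a. remainder a j)"
  unfolding remainder_def smooth_def mean_def
  by (intro continuous_intros continuous_on_product_coordinates)

text \<open>A uniform limit of finite combinations of coordinates of \<open>remainder a\<close>,
  each of which depends on finitely many coordinates of \<open>a\<close>. The error is
  \<open>f\<close> on a tail of \<open>remainder a\<close>, uniformly small by
  \<open>jdual_tail_small\<close> because the remainders are bounded in J.\<close>

lemma continuous_on_jdual_remainder:
  assumes f: "f \<in> jdual"
  shows "continuous_on {a. jbound a 1 \<and> (\<forall>j. norm (a j) \<le> 1)} (\<lambda>a. f (remainder a))"
proof (rule uniform_limit_theorem)
  let ?K = "{a. jbound a 1 \<and> (\<forall>j. norm (a j) \<le> 1)}"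
  show "\<forall>\<^sub>F N in sequentially. continuous_on ?K (\<lambda>a. \<Sum>j<N. remainder a j * f (unit_seq j))"
    by (intro always_eventually allI continuous_intros continuous_on_subset[OF continuous_on_remainder_coord]) auto
  show "uniform_limit ?K (\<lambda>N a. \<Sum>j<N. remainder a j * f (unit_seq j)) (\<lambda>a. f (remainder a)) sequentially"
  proof (rule uniform_limitI)
    fix e :: real assume e: "e > 0"
    \<comment> \<open>The remainder has norm at most 7 and its tail at most 14, so the factor
      \<open>e / 28\<close> leaves an error of at most \<open>e / 2\<close>.\<close>
    obtain N where N: "\<And>a. a \<in> pts J \<Longrightarrow> (\<And>j. j < N \<Longrightarrow> a j = 0) \<Longrightarrow> norm (f a) \<le> e / 28 * nrm J a"
      using jdual_tail_small[OF f, of "e / 28"] e by auto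
    have "dist (\<Sum>j<n. remainder a j * f (unit_seq j)) (f (remainder a)) < e" if n: "n \<ge> N" and a: "a \<in> ?K" for n a
    proof -
      have r: "remainder a \<in> pts J" "nrm J (remainder a) \<le> 7" using remainder_in_J[of a 1] a by auto
      note cut = J_cut_below[OF r(1), of n]
      have "norm (f (cut_below n (remainder a))) \<le> e / 28 * nrm J (cut_below n (remainder a))"
        by (rule N) (use cut n in \<open>auto simp: cut_below_def\<close>)
      also have "\<dots> \<le> e / 28 * 14" using cut r(2) e by (intro mult_left_mono) auto
      finally have "norm (f (cut_below n (remainder a))) < e" using e by simp
      moreover have "(\<Sum>j<n. remainder a j * f (unit_seq j)) - f (remainder a) = - f (cut_below n (remainder a))"
        using jdual_head[OF f r(1), of n] by (simp add: algebra_simps)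
      ultimately show ?thesis by (simp add: dist_norm)
    qed
    then show "\<forall>\<^sub>F n in sequentially. \<forall>a\<in>?K. dist (\<Sum>j<n. remainder a j * f (unit_seq j)) (f (remainder a)) < e"
      by (auto simp: eventually_sequentially)
  qed
qed simp

lemma weakly_compact_op_remainder: "weakly_compact_op J J remainder"
  unfolding weakly_compact_op_def
proof (intro conjI bounded_op_remainder)
  let ?K = "{a. jbound a 1 \<and> (\<forall>j. norm (a j) \<le> 1)}"
  have RJ: "remainder a \<in> pts J" if "a \<in> ?K" for a using remainder_in_J(1)[of a 1] that by auto
  have "continuous_map (top_of_set ?K) (weak_topology J) remainder"
    unfolding weak_topology_def
  proof (rule continuous_on_generated_topo)
    fix U assume "U \<in> {{x \<in> pts J. f x \<in> V} | f V. f \<in> jdual \<and> open V}"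
    then obtain f V where f: "f \<in> jdual" "open V" and U: "U = {x \<in> pts J. f x \<in> V}" by blast
    have "remainder -` U \<inter> topspace (top_of_set ?K) = ?K \<inter> (\<lambda>a. f (remainder a)) -` V"
      using RJ by (auto simp: U)
    then show "openin (top_of_set ?K) (remainder -` U \<inter> topspace (top_of_set ?K))"
      using continuous_openin_preimage_gen[OF continuous_on_jdual_remainder[OF f(1)] f(2)] by simp
  next
    have "\<Union>{{x \<in> pts J. f x \<in> U} | f U. f \<in> jdual \<and> open U} = pts J"
      using topspace_weak_J unfolding weak_topology_def topology_generated_by_topspace .
    then show "remainder ` topspace (top_of_set ?K) \<subseteq> \<Union>{{x \<in> pts J. f x \<in> U} | f U. f \<in> jdual \<and> open U}"
      using RJ by auto
  qed
  moreover have "compactin (top_of_set ?K) ?K"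
    using compact_jball by (simp only: compactin_absolute compactin_euclidean_iff)
  ultimately have comp: "compactin (weak_topology J) (remainder ` ?K)" by (rule image_compactin[rotated])
  \<comment> \<open>The unit ball of J lies in \<open>?K\<close>, as the norm dominates all
    coordinates. The image of \<open>?K\<close> is weakly compact, hence closed in the Hausdorff
    weak topology, and so also contains the closure.\<close>
  have "remainder ` {x \<in> pts J. nrm J x \<le> 1} \<subseteq> remainder ` ?K"
    using J_coord jbound_mono[OF jbound_nrm] by (intro image_mono) (auto intro: order_trans)
  then have "weak_topology J closure_of (remainder ` {x \<in> pts J. nrm J x \<le> 1}) \<subseteq> remainder ` ?K"
    by (rule closure_of_minimal) (rule compactin_imp_closedin[OF Hausdorff_weak_J comp])
  then show "weakly_compact J (weak_topology J closure_of (remainder ` {x \<in> pts J. nrm J x \<le> 1}))"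
    unfolding weakly_compact_def by (rule closed_compactin[OF comp]) simp
qed

end

section \<open>The approximation property of J(h)\<close>

theorem theorem4p4:
  fixes sc :: "'k::{real_normed_field, euclidean_space} \<Rightarrow> 'e::banach \<Rightarrow> 'e"
    and h :: "nat \<Rightarrow> 'e"
  assumes "banach_over sc"
    and "reflexive (type_space sc)"
    and "schauder_basis sc h"
    and "\<And>j. norm (h j) = 1"
  shows "WAP (J_space sc h)"
proof -
  interpret banach_over sc by (rule assms(1))
  interpret reflexive_schauder_space sc h by unfold_locales (use assms in auto)
  show ?thesis
    unfolding WAP_def
  proof (rule exI[of _ 7], intro allI impI)
    fix D and \<epsilon> :: real assume D: "weakly_compact J D" and \<epsilon>: "\<epsilon> > 0"
    \<comment> \<open>Smoothing doubles the constant, so \<open>\<epsilon> / 4\<close> leaves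
      \<open>\<epsilon> / 2\<close> on \<open>D\<close>; the remaining half keeps the supremum
      strictly below \<epsilon>.\<close>
    define P where "P N m c \<longleftrightarrow> N < m \<and> (\<forall>j. 0 \<le> c j) \<and> (\<Sum>j\<in>{N..<m}. c j) = 1 \<and>
        (\<forall>x\<in>D. (\<Sum>j\<in>{N..<m}. c j * norm (x j)) \<le> \<epsilon> / 4 * (1/2)^N)" for N m c
    have "\<exists>m c. P N m c" for N
      unfolding P_def by (rule weakly_compact_convex_small[OF D]) (use \<epsilon> in simp)
    then obtain S l where "\<And>N. P N (S N) (l N)" by metis
    then have Sl: "N < S N" "0 \<le> l N j" "(\<Sum>j\<in>{N..<S N}. l N j) = 1"
      "x \<in> D \<Longrightarrow> (\<Sum>j\<in>{N..<S N}. l N j * norm (x j)) \<le> \<epsilon> / 4 * (1/2)^N" for N j x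
      by (simp_all add: P_def)
    interpret averaging sc h S l by unfold_locales (use Sl in auto)
    have "nrm J (x - remainder x) \<le> \<epsilon> / 2" if "x \<in> D" for x
    proof -
      have "x - remainder x = smooth x" by (simp add: remainder_def fun_eq_iff)
      then show ?thesis using nrm_smooth_le[of "\<epsilon> / 4" x] Sl(4)[OF that] \<epsilon> by simp
    qed
    then have "(SUP x\<in>D. ereal (nrm J (x - remainder x))) \<le> ereal (\<epsilon> / 2)"
      by (intro SUP_least) simp
    also have "\<dots> < ereal \<epsilon>" using \<epsilon> by simp
    finally show "\<exists>V. weakly_compact_op J J V \<and> (SUP x\<in>D. ereal (nrm J (x - V x))) < ereal \<epsilon> \<and> op_norm J J V \<le> 7"
      using weakly_compact_op_remainder op_norm_remainder by blast
  qed
qed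

end
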